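(* Suppose that for all $\nu=1,\dots,N$, $r_\nu\ge1$ and $r_\nu>(m_\nu-1)/2>\sum_{\lambda\in\Lambda(\nu)}l^{(\lambda)}$. Let $\boldsymbol{a}_0=((1-m_\nu)/2)_{\nu=1}^N$ and let $\boldsymbol{a}=((a_{i,\nu})_{i=1}^{m_\nu})_{\nu=1}^N$ with $a_{i,\nu}=1/2$ for all $i,\nu$. Then the Bayesian predictive mass with respect to the Jeffreys prior, namely $\hat f^{(\pi_{\boldsymbol{a}_0,\boldsymbol{a}})}(\cdot;\boldsymbol{X})$, is inadmissible under the Kullback--Leibler risk and is dominated by the Bayesian predictive mass $\hat f^{(\pi_{\alpha,\beta,\boldsymbol{\gamma},\boldsymbol{a}_0,\boldsymbol{a}})}(\cdot;\boldsymbol{X})$ (with the same $\boldsymbol{a}_0$ and $\boldsymbol{a}$) for some $\alpha>0$, $\beta>0$, and $\boldsymbol{\gamma}\in(0,\infty)^N$.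
   Context: Notation: $\mathbb{N}=\{1,2,\dots\}$, $\mathbb{N}_0=\{0,1,2,\dots\}$. Let $N\in\mathbb{N}$, $m_1,\dots,m_N\in\mathbb{N}$, $r_1,\dots,r_N>0$. For $\nu=1,\dots,N$, $\boldsymbol{p}_\nu=(p_{i,\nu})_{i=1}^{m_\nu}\in D_{m_\nu}=\{(q_1,\dots,q_{m_\nu}) : q_i>0\ \forall i,\ \sum_iq_i<1\}$ is unknown and $p_{0,\nu}=1-\sum_{i=1}^{m_\nu}p_{i,\nu}$; $\boldsymbol{p}=(\boldsymbol{p}_\nu)_{\nu=1}^N\in D=D_{m_1}\times\dots\times D_{m_N}$. The observation is $\boldsymbol{X}=(\boldsymbol{X}_\nu)_{\nu=1}^N$, with independent negative multinomial $\boldsymbol{X}_\nu=(X_{i,\nu})_{i=1}^{m_\nu}$ having mass function $\frac{\Gamma(r_\nu+\sum_ix_{i,\nu})}{\Gamma(r_\nu)\prod_ix_{i,\nu}!}p_{0,\nu}^{r_\nu}\prod_{i=1}^{m_\nu}p_{i,\nu}^{x_{i,\nu}}$ on $\mathbb{N}_0^{m_\nu}$. Variables to be predicted: let $L\in\mathbb{N}$, $d^{(1)},\dots,d^{(L)}\in\{1,\dots,N\}$, $l^{(1)},\dots,l^{(L)}\in\mathbb{N}$. For $\lambda=1,\dots,L$ let $1\le\nu_1^{(\lambda)}<\dots<\nu_{d^{(\lambda)}}^{(\lambda)}\le N$ be integers, let $I_0^{(\lambda)}=\prod_{h=1}^{d^{(\lambda)}}\{0,1,\dots,m_{\nu_h^{(\lambda)}}\}$,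 and $\mathcal{W}^{(\lambda)}=\{(w_{\boldsymbol{i}})_{\boldsymbol{i}\in I_0^{(\lambda)}} : w_{\boldsymbol{i}}\in\mathbb{N}_0,\ \sum_{\boldsymbol{i}}w_{\boldsymbol{i}}=l^{(\lambda)}\}$. The multinomial tables $\boldsymbol{W}^{(1)},\dots,\boldsymbol{W}^{(L)}$ are independent of each other and of $\boldsymbol{X}$, and $\boldsymbol{W}^{(\lambda)}$ has mass function $$f_\lambda(\boldsymbol{w}^{(\lambda)}|\boldsymbol{p})=\frac{l^{(\lambda)}!}{\prod_{\boldsymbol{i}\in I_0^{(\lambda)}}w^{(\lambda)}_{\boldsymbol{i}}!}\prod_{\boldsymbol{i}=(i_h)_{h}\in I_0^{(\lambda)}}\Big\{\prod_{h=1}^{d^{(\lambda)}}p_{i_h,\nu_h^{(\lambda)}}\Big\}^{w^{(\lambda)}_{\boldsymbol{i}}},\qquad \boldsymbol{w}^{(\lambda)}\in\mathcal{W}^{(\lambda)}.$$ Let $\mathcal{W}=\mathcal{W}^{(1)}\times\dots\times\mathcal{W}^{(L)}$, $\boldsymbol{W}=(\boldsymbol{W}^{(\lambda)})_{\lambda=1}^L$ and $f(\boldsymbol{w}|\boldsymbol{p})=\prod_{\lambda=1}^Lf_\lambda(\boldsymbol{w}^{(\lambda)}|\boldsymbol{p})$ for $\boldsymbol{w}\in\mathcal{W}$. For $\nu=1,\dots,N$, $\Lambda(\nu)=\{\lambda\in\{1,\dots,L\} : \nu\in\{\nu_1^{(\lambda)},\dots,\nu_{d^{(\lambda)}}^{(\lambda)}\}\}$.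 Risk: a predictive mass $\hat f(\cdot;\boldsymbol{X})$ (an estimator of $f(\cdot|\boldsymbol{p})$ based on $\boldsymbol{X}$) has Kullback--Leibler risk $E[\log\{f(\boldsymbol{W}|\boldsymbol{p})/\hat f(\boldsymbol{W};\boldsymbol{X})\}]$, a function of $\boldsymbol{p}\in D$. One predictive mass dominates another if its risk is less than or equal to the other's for every $\boldsymbol{p}\in D$, with strict inequality for at least one $\boldsymbol{p}$; a predictive mass is inadmissible if some predictive mass dominates it. The Bayesian predictive mass for a (possibly improper) prior density $\pi$ on $D$ is the posterior expectation $\hat f^{(\pi)}(\boldsymbol{w};\boldsymbol{X})=E_\pi[f(\boldsymbol{w}|\boldsymbol{p})\,|\,\boldsymbol{X}]$. Priors (densities on $D$ with respect to Lebesgue measure, up to normalization), for $\boldsymbol{a}_0=(a_{0,\nu})_\nu\in\mathbb{R}^N$, $\boldsymbol{a}=((a_{i,\nu})_i)_\nu$ with positive entries, $\alpha,\beta>0$, $\boldsymbol{\gamma}=(\gamma_\nu)_\nu\in(0,\infty)^N$: $$\pi_{\boldsymbol{a}_0,\boldsymbol{a}}(\boldsymbol{p})\propto\prod_{\nu=1}^N\Big(p_{0,\nu}^{a_{0,\nu}-1}\prod_{i=1}^{m_\nu}p_{i,\nu}^{a_{i,\nu}-1}\Big),$$ $$\pi_{\alpha,\beta,\boldsymbol{\gamma},\boldsymbol{a}_0,\boldsymbol{a}}(\boldsymbol{p})=\int_0^\infty u^{\alpha-1}e^{-\beta u}\Big\{\prod_{\nu=1}^N\Big(p_{0,\nu}^{\gamma_\nu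 u+a_{0,\nu}-1}\prod_{i=1}^{m_\nu}p_{i,\nu}^{a_{i,\nu}-1}\Big)\Big\}du.$$ The prior $\pi_{\boldsymbol{a}_0,\boldsymbol{a}}$ with $a_{0,\nu}=(1-m_\nu)/2$ and $a_{i,\nu}=1/2$ is the Jeffreys prior for the model of $\boldsymbol{X}$. *)

theory Defs
  imports "HOL-Analysis.Analysis"
begin

text \<open>
  Conventions. Populations \<open>\<nu>\<close> range over \<open>{1..N}\<close> and tables \<open>k\<close> over \<open>{1..L}\<close>; a family
  such as \<open>(p\<^sub>i\<^sub>,\<^sub>\<nu>)\<close> is a function with the population first, \<open>p \<nu> i\<close>. Tuples are extensional
  functions on their index sets (\<open>Pi\<^sub>E\<close>), so that every tuple has exactly one representative.
\<close>

definition simplexD :: "nat \<Rightarrow> (nat \<Rightarrow> real) set" where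
  "simplexD n = {q \<in> {1..n} \<rightarrow>\<^sub>E {0<..}. (\<Sum>i = 1..n. q i) < 1}"

definition paramD :: "nat \<Rightarrow> (nat \<Rightarrow> nat) \<Rightarrow> (nat \<Rightarrow> nat \<Rightarrow> real) set" where
  "paramD N m = (\<Pi>\<^sub>E \<nu>\<in>{1..N}. simplexD (m \<nu>))"

text \<open>Lebesgue measure on the product of the spaces \<open>\<real>\<close> to the power \<open>m \<nu>\<close>.\<close>

definition lebP :: "nat \<Rightarrow> (nat \<Rightarrow> nat) \<Rightarrow> (nat \<Rightarrow> nat \<Rightarrow> real) measure" where
  "lebP N m = (\<Pi>\<^sub>M \<nu>\<in>{1..N}. \<Pi>\<^sub>M i\<in>{1..m \<nu>}. lborel)"

text \<open>The probabilities \<open>p\<^sub>i\<^sub>,\<^sub>\<nu>\<close> for \<open>0 \<le> i \<le> m \<nu>\<close>; only those with \<open>i \<ge> 1\<close> are coordinates of \<open>p\<close>.\<close>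

definition cellprob :: "(nat \<Rightarrow> nat) \<Rightarrow> (nat \<Rightarrow> nat \<Rightarrow> real) \<Rightarrow> nat \<Rightarrow> nat \<Rightarrow> real" where
  "cellprob m p \<nu> i = (if i = 0 then 1 - (\<Sum>j = 1..m \<nu>. p \<nu> j) else p \<nu> i)"

definition obsX :: "nat \<Rightarrow> (nat \<Rightarrow> nat) \<Rightarrow> (nat \<Rightarrow> nat \<Rightarrow> nat) set" where
  "obsX N m = (\<Pi>\<^sub>E \<nu>\<in>{1..N}. {1..m \<nu>} \<rightarrow>\<^sub>E UNIV)"

definition negmult_mass ::
    "(nat \<Rightarrow> nat) \<Rightarrow> (nat \<Rightarrow> real) \<Rightarrow> nat \<Rightarrow> (nat \<Rightarrow> nat \<Rightarrow> real) \<Rightarrow> (nat \<Rightarrow> nat) \<Rightarrow> real" where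
  "negmult_mass m r \<nu> p y =
     Gamma (r \<nu> + real (\<Sum>i = 1..m \<nu>. y i)) / (Gamma (r \<nu>) * (\<Prod>i = 1..m \<nu>. fact (y i)))
     * cellprob m p \<nu> 0 powr r \<nu> * (\<Prod>i = 1..m \<nu>. cellprob m p \<nu> i ^ y i)"

definition obs_mass ::
    "nat \<Rightarrow> (nat \<Rightarrow> nat) \<Rightarrow> (nat \<Rightarrow> real) \<Rightarrow> (nat \<Rightarrow> nat \<Rightarrow> real) \<Rightarrow> (nat \<Rightarrow> nat \<Rightarrow> nat) \<Rightarrow> real" where
  "obs_mass N m r p x = (\<Prod>\<nu> = 1..N. negmult_mass m r \<nu> p (x \<nu>))"

text \<open>
  The table \<open>k\<close> crosses the \<open>d k\<close> populations \<open>nu k 1 < \<dots> < nu k (d k)\<close> and has total \<open>l k\<close>.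
\<close>

definition cellsI0 :: "(nat \<Rightarrow> nat) \<Rightarrow> (nat \<Rightarrow> nat) \<Rightarrow> (nat \<Rightarrow> nat \<Rightarrow> nat) \<Rightarrow> nat \<Rightarrow> (nat \<Rightarrow> nat) set" where
  "cellsI0 m d nu k = (\<Pi>\<^sub>E h\<in>{1..d k}. {0..m (nu k h)})"

definition tableW ::
    "(nat \<Rightarrow> nat) \<Rightarrow> (nat \<Rightarrow> nat) \<Rightarrow> (nat \<Rightarrow> nat) \<Rightarrow> (nat \<Rightarrow> nat \<Rightarrow> nat) \<Rightarrow> nat \<Rightarrow> ((nat \<Rightarrow> nat) \<Rightarrow> nat) set" where
  "tableW m d l nu k = {w \<in> cellsI0 m d nu k \<rightarrow>\<^sub>E UNIV. (\<Sum>i\<in>cellsI0 m d nu k. w i) = l k}"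

definition tablesW ::
    "(nat \<Rightarrow> nat) \<Rightarrow> nat \<Rightarrow> (nat \<Rightarrow> nat) \<Rightarrow> (nat \<Rightarrow> nat) \<Rightarrow> (nat \<Rightarrow> nat \<Rightarrow> nat)
      \<Rightarrow> (nat \<Rightarrow> (nat \<Rightarrow> nat) \<Rightarrow> nat) set" where
  "tablesW m L d l nu = (\<Pi>\<^sub>E k\<in>{1..L}. tableW m d l nu k)"

definition table_mass ::
    "(nat \<Rightarrow> nat) \<Rightarrow> (nat \<Rightarrow> nat) \<Rightarrow> (nat \<Rightarrow> nat) \<Rightarrow> (nat \<Rightarrow> nat \<Rightarrow> nat) \<Rightarrow> nat
      \<Rightarrow> (nat \<Rightarrow> nat \<Rightarrow> real) \<Rightarrow> ((nat \<Rightarrow> nat) \<Rightarrow> nat) \<Rightarrow> real" where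
  "table_mass m d l nu k p w =
     fact (l k) / (\<Prod>i\<in>cellsI0 m d nu k. fact (w i))
     * (\<Prod>i\<in>cellsI0 m d nu k. (\<Prod>h = 1..d k. cellprob m p (nu k h) (i h)) ^ w i)"

definition tables_mass ::
    "(nat \<Rightarrow> nat) \<Rightarrow> nat \<Rightarrow> (nat \<Rightarrow> nat) \<Rightarrow> (nat \<Rightarrow> nat) \<Rightarrow> (nat \<Rightarrow> nat \<Rightarrow> nat)
      \<Rightarrow> (nat \<Rightarrow> nat \<Rightarrow> real) \<Rightarrow> (nat \<Rightarrow> (nat \<Rightarrow> nat) \<Rightarrow> nat) \<Rightarrow> real" where
  "tables_mass m L d l nu p w = (\<Prod>k = 1..L. table_mass m d l nu k p (w k))"

definition tables_of :: "nat \<Rightarrow> (nat \<Rightarrow> nat) \<Rightarrow> (nat \<Rightarrow> nat \<Rightarrow> nat) \<Rightarrow> nat \<Rightarrow> nat set" where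
  "tables_of L d nu \<nu> = {k \<in> {1..L}. \<nu> \<in> nu k ` {1..d k}}"

type_synonym predictor = "(nat \<Rightarrow> (nat \<Rightarrow> nat) \<Rightarrow> nat) \<Rightarrow> (nat \<Rightarrow> nat \<Rightarrow> nat) \<Rightarrow> real"

definition predictive_mass ::
    "nat \<Rightarrow> (nat \<Rightarrow> nat) \<Rightarrow> nat \<Rightarrow> (nat \<Rightarrow> nat) \<Rightarrow> (nat \<Rightarrow> nat) \<Rightarrow> (nat \<Rightarrow> nat \<Rightarrow> nat) \<Rightarrow> predictor \<Rightarrow> bool" where
  "predictive_mass N m L d l nu fh \<longleftrightarrow>
     (\<forall>x\<in>obsX N m. (\<forall>w\<in>tablesW m L d l nu. 0 \<le> fh w x) \<and> (\<Sum>w\<in>tablesW m L d l nu. fh w x) = 1)"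

text \<open>Joint law of \<open>(X, W)\<close>; since \<open>X\<close> and \<open>W\<close> are independent, its mass function is a product.\<close>

definition joint_law ::
    "nat \<Rightarrow> (nat \<Rightarrow> nat) \<Rightarrow> (nat \<Rightarrow> real) \<Rightarrow> nat \<Rightarrow> (nat \<Rightarrow> nat) \<Rightarrow> (nat \<Rightarrow> nat) \<Rightarrow> (nat \<Rightarrow> nat \<Rightarrow> nat)
      \<Rightarrow> (nat \<Rightarrow> nat \<Rightarrow> real) \<Rightarrow> ((nat \<Rightarrow> nat \<Rightarrow> nat) \<times> (nat \<Rightarrow> (nat \<Rightarrow> nat) \<Rightarrow> nat)) measure" where
  "joint_law N m r L d l nu p =
     point_measure (obsX N m \<times> tablesW m L d l nu)
       (\<lambda>(x, w). ennreal (obs_mass N m r p x * tables_mass m L d l nu p w))"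

text \<open>
  Expectation with values in \<open>[-\<infinity>, \<infinity>]\<close>, so that an infinite risk is not confused with the value
  \<open>0\<close> which the Bochner integral assigns to a non-integrable function. In the risk below the
  negative part always has finite expectation (because \<open>ln t \<le> t - 1\<close>), so \<open>\<infinity> - \<infinity>\<close> does not occur.
\<close>

definition ereal_expectation :: "'a measure \<Rightarrow> ('a \<Rightarrow> ereal) \<Rightarrow> ereal" where
  "ereal_expectation M Z =
     enn2ereal (\<integral>\<^sup>+ z. e2ennreal (Z z) \<partial>M) - enn2ereal (\<integral>\<^sup>+ z. e2ennreal (- Z z) \<partial>M)"

text \<open>The value of \<open>log (a / b)\<close> for \<open>a > 0\<close> and \<open>b \<ge> 0\<close>, infinite at \<open>b = 0\<close>.\<close>

definition log_ratio :: "real \<Rightarrow> real \<Rightarrow> ereal" where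
  "log_ratio a b = (if b = 0 then \<infinity> else ereal (ln (a / b)))"

definition KL_risk ::
    "nat \<Rightarrow> (nat \<Rightarrow> nat) \<Rightarrow> (nat \<Rightarrow> real) \<Rightarrow> nat \<Rightarrow> (nat \<Rightarrow> nat) \<Rightarrow> (nat \<Rightarrow> nat) \<Rightarrow> (nat \<Rightarrow> nat \<Rightarrow> nat)
      \<Rightarrow> predictor \<Rightarrow> (nat \<Rightarrow> nat \<Rightarrow> real) \<Rightarrow> ereal" where
  "KL_risk N m r L d l nu fh p =
     ereal_expectation (joint_law N m r L d l nu p)
       (\<lambda>(x, w). log_ratio (tables_mass m L d l nu p w) (fh w x))"

definition dominates ::
    "nat \<Rightarrow> (nat \<Rightarrow> nat) \<Rightarrow> (nat \<Rightarrow> real) \<Rightarrow> nat \<Rightarrow> (nat \<Rightarrow> nat) \<Rightarrow> (nat \<Rightarrow> nat) \<Rightarrow> (nat \<Rightarrow> nat \<Rightarrow> nat)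
      \<Rightarrow> predictor \<Rightarrow> predictor \<Rightarrow> bool" where
  "dominates N m r L d l nu gh fh \<longleftrightarrow>
     predictive_mass N m L d l nu gh \<and> predictive_mass N m L d l nu fh \<and>
     (\<forall>p\<in>paramD N m. KL_risk N m r L d l nu gh p \<le> KL_risk N m r L d l nu fh p) \<and>
     (\<exists>p\<in>paramD N m. KL_risk N m r L d l nu gh p < KL_risk N m r L d l nu fh p)"

definition inadmissible ::
    "nat \<Rightarrow> (nat \<Rightarrow> nat) \<Rightarrow> (nat \<Rightarrow> real) \<Rightarrow> nat \<Rightarrow> (nat \<Rightarrow> nat) \<Rightarrow> (nat \<Rightarrow> nat) \<Rightarrow> (nat \<Rightarrow> nat \<Rightarrow> nat)
      \<Rightarrow> predictor \<Rightarrow> bool" where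
  "inadmissible N m r L d l nu fh \<longleftrightarrow> (\<exists>gh. dominates N m r L d l nu gh fh)"

text \<open>
  Posterior expectation of \<open>f(w|p)\<close> given \<open>X = x\<close>, by Bayes' formula. The prior density \<open>\<pi>\<close> may be
  improper and need not be normalized.
\<close>

definition bayes_predictive ::
    "nat \<Rightarrow> (nat \<Rightarrow> nat) \<Rightarrow> (nat \<Rightarrow> real) \<Rightarrow> nat \<Rightarrow> (nat \<Rightarrow> nat) \<Rightarrow> (nat \<Rightarrow> nat) \<Rightarrow> (nat \<Rightarrow> nat \<Rightarrow> nat)
      \<Rightarrow> ((nat \<Rightarrow> nat \<Rightarrow> real) \<Rightarrow> real) \<Rightarrow> predictor" where
  "bayes_predictive N m r L d l nu \<pi> w x =
     (LINT p:paramD N m|lebP N m. tables_mass m L d l nu p w * obs_mass N m r p x * \<pi> p)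
     / (LINT p:paramD N m|lebP N m. obs_mass N m r p x * \<pi> p)"

definition prior_a ::
    "nat \<Rightarrow> (nat \<Rightarrow> nat) \<Rightarrow> (nat \<Rightarrow> real) \<Rightarrow> (nat \<Rightarrow> nat \<Rightarrow> real) \<Rightarrow> (nat \<Rightarrow> nat \<Rightarrow> real) \<Rightarrow> real" where
  "prior_a N m a0 a p =
     (\<Prod>\<nu> = 1..N. cellprob m p \<nu> 0 powr (a0 \<nu> - 1)
        * (\<Prod>i = 1..m \<nu>. cellprob m p \<nu> i powr (a \<nu> i - 1)))"

definition prior_mix ::
    "nat \<Rightarrow> (nat \<Rightarrow> nat) \<Rightarrow> real \<Rightarrow> real \<Rightarrow> (nat \<Rightarrow> real) \<Rightarrow> (nat \<Rightarrow> real) \<Rightarrow> (nat \<Rightarrow> nat \<Rightarrow> real)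
      \<Rightarrow> (nat \<Rightarrow> nat \<Rightarrow> real) \<Rightarrow> real" where
  "prior_mix N m \<alpha> \<beta> \<gamma> a0 a p =
     (LBINT u:{0<..}. u powr (\<alpha> - 1) * exp (- \<beta> * u)
        * (\<Prod>\<nu> = 1..N. cellprob m p \<nu> 0 powr (\<gamma> \<nu> * u + a0 \<nu> - 1)
             * (\<Prod>i = 1..m \<nu>. cellprob m p \<nu> i powr (a \<nu> i - 1))))"

end

theory Submission
  imports Defs "HOL-Probability.Distributions"
begin

text \<open>
  The observation enters the comparison only through the totals \<open>n\<^sub>\<nu> = \<Sum>\<^sub>i x\<^sub>i\<^sub>,\<^sub>\<nu>\<close>, and the table
  only through its cell counts. Given \<open>X\<close>, the prior \<open>\<pi>\<^sub>a\<close> leads to a product of Dirichlet laws, and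
  \<open>f(w|p)\<close> is a constant times a monomial in the cell probabilities, so the predictive mass is
  explicit: up to factors that the mixture prior leaves unchanged it is the product over \<open>\<nu>\<close> of
  \<open>(R\<^sub>\<nu> + u)\<^sup>(\<^sup>s\<^sup>) / (b\<^sub>\<nu> + n\<^sub>\<nu> + u)\<^sup>(\<^sup>S\<^sup>)\<close> at \<open>u = 0\<close>. These are rising factorials,
  \<open>R\<^sub>\<nu> = r\<^sub>\<nu> + a\<^sub>0\<^sub>,\<^sub>\<nu>\<close>, \<open>b\<^sub>\<nu> = R\<^sub>\<nu> + \<Sum>\<^sub>i a\<^sub>i\<^sub>,\<^sub>\<nu>\<close>, \<open>s\<close> is the number of draws that fall into cell
  \<open>0\<close> of population \<open>\<nu>\<close>, and \<open>S\<close> is the number of all draws from it. The mixture prior (with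
  \<open>\<alpha> = 1\<close> and \<open>\<gamma> = 1\<close>) shifts \<open>a\<^sub>0\<^sub>,\<^sub>\<nu>\<close> by \<open>u\<close>, so its predictive mass is the mean of the same
  product when \<open>u\<close> has a density proportional to \<open>e\<^sup>-\<^sup>\<beta>\<^sup>u\<close> times the decreasing function
  \<open>\<Prod>\<^sub>\<nu> \<Gamma>(R\<^sub>\<nu> + u) / \<Gamma>(b\<^sub>\<nu> + n\<^sub>\<nu> + u)\<close>.

  Write \<open>g(n)\<close> for the mean of \<open>u\<close> under this density. Its second moment is at most \<open>\<epsilon> g(n)\<close> with
  \<open>\<epsilon> = 2 / \<beta>\<close>, because the additional factor is decreasing. Jensen's inequality therefore bounds the
  logarithm of the ratio of the two predictive masses from below by
  \<open>g(n) \<Sum>\<^sub>\<nu> (\<kappa>\<^sub>\<nu> s\<^sub>\<nu> - S\<^sub>\<nu> / (b\<^sub>\<nu> + n\<^sub>\<nu>))\<close>, where \<open>\<kappa>\<^sub>\<nu>\<close> tends to \<open>1 / (R\<^sub>\<nu> + S\<^sub>\<nu> - 1)\<close> as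
  \<open>\<beta> \<rightarrow> \<infinity>\<close> (lemma \<open>mixture_ge\<close>). The mean of \<open>s\<^sub>\<nu>\<close> is \<open>S\<^sub>\<nu> p\<^sub>0\<^sub>,\<^sub>\<nu>\<close>, so the risk decreases as soon
  as \<open>E[g(n) (\<kappa>\<^sub>\<nu> p\<^sub>0\<^sub>,\<^sub>\<nu> - 1 / (b\<^sub>\<nu> + n\<^sub>\<nu>))] > 0\<close> for every population
  with \<open>S\<^sub>\<nu> > 0\<close>.

  For constant \<open>g\<close> this holds because \<open>E[1 / (r\<^sub>\<nu> + n\<^sub>\<nu> - 1)] = p\<^sub>0\<^sub>,\<^sub>\<nu> / (r\<^sub>\<nu> - 1)\<close>, \<open>b\<^sub>\<nu> > r\<^sub>\<nu> - 1\<close>, and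
  \<open>R\<^sub>\<nu> + S\<^sub>\<nu> - 1 < r\<^sub>\<nu> - 1\<close>; the last inequality is the hypothesis \<open>(m\<^sub>\<nu> - 1) / 2 > S\<^sub>\<nu>\<close>. The
  function \<open>g\<close> decreases in \<open>n\<close>, which works against the inequality, but only slowly: one more
  observation divides the density of \<open>u\<close> by \<open>b\<^sub>\<nu> + n\<^sub>\<nu> + u\<close> and changes \<open>g\<close> by a relative amount of
  at most \<open>\<epsilon> / (r\<^sub>\<nu> + n\<^sub>\<nu>)\<close> (lemma \<open>tilt_mean_bump\<close>). An identity of Hudson type for the negative
  multinomial law turns this into a loss of \<open>\<epsilon>\<close> in \<open>r\<^sub>\<nu> - 1\<close> (lemma \<open>mean_gain_positive\<close>), and the
  gap in \<open>R\<^sub>\<nu> + S\<^sub>\<nu> - 1 < r\<^sub>\<nu> - 1\<close> absorbs it when \<open>\<beta>\<close> is large. The risks are finite, since the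
  loss of the first predictive mass grows at most linearly in the totals; hence the inequality
  between them is strict at every \<open>p\<close>.
\<close>

section \<open>Dirichlet integrals\<close>

lemma nn_integral_Beta_scaled:
  fixes a b t :: real
  assumes "a > 0" "b > 0" "t > 0"
  shows "(\<integral>\<^sup>+y. ennreal (y powr (a - 1) * (t - y) powr (b - 1)) * indicator {0<..<t} y \<partial>lborel)
    = ennreal (Beta a b * t powr (a + b - 1))"
proof -
  have "((\<lambda>z. z powr (a - 1) * (1 - z) powr (b - 1)) has_integral Beta a b) {0<..<1}"
    using has_integral_Beta_real[of a b] assms by (simp add: has_integral_Icc_iff_Ioo)
  then have unit: "(\<integral>\<^sup>+z. ennreal (indicator {0<..<1} z * (z powr (a - 1) * (1 - z) powr (b - 1))) \<partial>lborel)
      = ennreal (Beta a b)"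
    by (intro nn_integral_has_integral_lebesgue) auto
  have "(\<integral>\<^sup>+y. ennreal (y powr (a - 1) * (t - y) powr (b - 1)) * indicator {0<..<t} y \<partial>lborel)
     = ennreal t * (\<integral>\<^sup>+z. ennreal ((t * z) powr (a - 1) * (t - t * z) powr (b - 1))
          * indicator {0<..<t} (t * z) \<partial>lborel)"
    using assms by (subst nn_integral_real_affine[where c = t and t = 0]) auto
  also have "(\<integral>\<^sup>+z. ennreal ((t * z) powr (a - 1) * (t - t * z) powr (b - 1))
          * indicator {0<..<t} (t * z) \<partial>lborel)
     = (\<integral>\<^sup>+z. ennreal (t powr (a + b - 2))
          * ennreal (indicator {0<..<1} z * (z powr (a - 1) * (1 - z) powr (b - 1))) \<partial>lborel)"
  proof (rule nn_integral_cong)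
    fix z :: real
    show "ennreal ((t * z) powr (a - 1) * (t - t * z) powr (b - 1)) * indicator {0<..<t} (t * z)
      = ennreal (t powr (a + b - 2))
          * ennreal (indicator {0<..<1} z * (z powr (a - 1) * (1 - z) powr (b - 1)))"
    proof (cases "0 < z \<and> z < 1")
      case True
      have "t - t * z = t * (1 - z)" by (simp add: algebra_simps)
      moreover have "t powr (a - 1) * t powr (b - 1) = t powr (a + b - 2)"
        by (simp add: powr_add[symmetric])
      ultimately have "(t * z) powr (a - 1) * (t - t * z) powr (b - 1)
          = t powr (a + b - 2) * (z powr (a - 1) * (1 - z) powr (b - 1))"
        using True assms by (simp add: powr_mult mult_ac)
      then show ?thesis using True assms by (simp add: ennreal_mult')
    next
      case False
      then have "t * z \<notin> {0<..<t}" using assms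
        by (auto simp: zero_less_mult_iff)
      then show ?thesis using False by (auto simp: indicator_def)
    qed
  qed
  also have "ennreal t * \<dots> = ennreal t * (ennreal (t powr (a + b - 2)) * ennreal (Beta a b))"
    by (subst nn_integral_cmult) (auto simp: unit)
  also have "\<dots> = ennreal (t * t powr (a + b - 2) * Beta a b)"
    using assms by (simp add: ennreal_mult' mult.assoc)
  also have "t * t powr (a + b - 2) = t powr (a + b - 1)"
    using assms by (subst powr_mult_base) (auto simp: algebra_simps)
  finally show ?thesis by (simp add: mult.commute)
qed

text \<open>
  Integrating over the simplex of size \<open>t\<close> instead of \<open>1\<close> makes the induction work: once the last
  coordinate \<open>y\<close> is fixed, the others range over the simplex of size \<open>t - y\<close>, and the remaining
  integral over \<open>y\<close> is a Beta integral.
\<close>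

lemma nn_integral_Dirichlet_scaled:
  fixes e :: "nat \<Rightarrow> real"
  assumes "\<And>i. i \<le> n \<Longrightarrow> e i > 0" "t > 0"
  shows "(\<integral>\<^sup>+q. ennreal ((t - (\<Sum>i=1..n. q i)) powr (e 0 - 1) * (\<Prod>i=1..n. q i powr (e i - 1)))
        * indicator {q. (\<forall>i\<in>{1..n}. 0 < q i) \<and> (\<Sum>i=1..n. q i) < t} q \<partial>(\<Pi>\<^sub>M i\<in>{1..n}. lborel))
    = ennreal ((\<Prod>i=0..n. Gamma (e i)) / Gamma (\<Sum>i=0..n. e i) * t powr ((\<Sum>i=0..n. e i) - 1))"
  using assms
proof (induction n arbitrary: t)
  case 0
  then have "Gamma (e 0) \<noteq> 0" by (intro less_imp_neq[symmetric] Gamma_real_pos) auto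
  then show ?case using 0 by (simp add: PiM_empty nn_integral_count_space_finite)
next
  case (Suc n)
  interpret product_sigma_finite "\<lambda>i::nat. lborel :: real measure" by standard
  define K where "K t = (\<lambda>q. ennreal ((t - (\<Sum>i=1..n. q i)) powr (e 0 - 1) * (\<Prod>i=1..n. q i powr (e i - 1)))
        * indicator {q. (\<forall>i\<in>{1..n}. 0 < q i) \<and> (\<Sum>i=1..n. q i) < t} q)" for t :: real
  define A where "A = (\<Sum>i=0..n. e i)"
  have Apos: "A > 0" unfolding A_def using Suc.prems by (intro sum_pos) auto
  let ?f = "\<lambda>q. ennreal ((t - (\<Sum>i=1..Suc n. q i)) powr (e 0 - 1) * (\<Prod>i=1..Suc n. q i powr (e i - 1)))
        * indicator {q. (\<forall>i\<in>{1..Suc n}. 0 < q i) \<and> (\<Sum>i=1..Suc n. q i) < t} q"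
  have I: "{1..Suc n} = insert (Suc n) {1..n}" by auto
  have meas: "?f \<in> borel_measurable (Pi\<^sub>M (insert (Suc n) {1..n}) (\<lambda>_. lborel))"
    unfolding I[symmetric] by measurable
  have Kmeas: "K s \<in> borel_measurable (Pi\<^sub>M {1..n} (\<lambda>_. lborel))" for s
    unfolding K_def by measurable
  have inner: "(\<integral>\<^sup>+q. ?f (q(Suc n := y)) \<partial>Pi\<^sub>M {1..n} (\<lambda>_. lborel))
     = ennreal ((\<Prod>i=0..n. Gamma (e i)) / Gamma A) *
        (ennreal (y powr (e (Suc n) - 1) * (t - y) powr (A - 1)) * indicator {0<..<t} y)" for y
  proof -
    have f_eq: "?f (q(Suc n := y)) = ennreal (y powr (e (Suc n) - 1)) * indicator {0<..} y * K (t - y) q" for q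
    proof -
      have 1: "(\<Sum>i=1..Suc n. (q(Suc n := y)) i) = (\<Sum>i=1..n. q i) + y"
        by (simp add: I)
      have 2: "(\<Prod>i=1..Suc n. (q(Suc n := y)) i powr (e i - 1))
          = y powr (e (Suc n) - 1) * (\<Prod>i=1..n. q i powr (e i - 1))"
        by (simp add: I)
      have 3: "(\<forall>i\<in>{1..Suc n}. 0 < (q(Suc n := y)) i) \<longleftrightarrow> 0 < y \<and> (\<forall>i\<in>{1..n}. 0 < q i)"
        by (auto simp: I)
      show ?thesis unfolding K_def mem_Collect_eq 1 2
        using 3 by (auto simp: indicator_def ennreal_mult'[symmetric] algebra_simps)
    qed
    show ?thesis
    proof (cases "0 < y \<and> y < t")
      case True
      have "(\<integral>\<^sup>+q. ?f (q(Suc n := y)) \<partial>Pi\<^sub>M {1..n} (\<lambda>_. lborel))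
          = ennreal (y powr (e (Suc n) - 1)) * integral\<^sup>N (Pi\<^sub>M {1..n} (\<lambda>_. lborel)) (K (t - y))"
      proof -
        have "indicator {0<..} y = (1 :: ennreal)" using True by simp
        then show ?thesis unfolding f_eq by (simp only: mult_1_right nn_integral_cmult[OF Kmeas])
      qed
      also have "integral\<^sup>N (Pi\<^sub>M {1..n} (\<lambda>_. lborel)) (K (t - y))
          = ennreal ((\<Prod>i=0..n. Gamma (e i)) / Gamma A * (t - y) powr (A - 1))"
        unfolding K_def A_def using Suc.IH[of "t - y"] Suc.prems True by auto
      also have "ennreal (y powr (e (Suc n) - 1)) * \<dots> = ennreal ((\<Prod>i=0..n. Gamma (e i)) / Gamma A) *
        (ennreal (y powr (e (Suc n) - 1) * (t - y) powr (A - 1)) * indicator {0<..<t} y)"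
      proof -
        have "0 \<le> (\<Prod>i=0..n. Gamma (e i)) / Gamma A"
          using Apos Suc.prems by (intro divide_nonneg_nonneg prod_nonneg) auto
        then show ?thesis using True by (simp add: ennreal_mult'[symmetric] mult_ac)
      qed
      finally show ?thesis .
    next
      case False
      \<comment> \<open>For \<open>y \<ge> t\<close> the simplex that is left for the other coordinates is empty.\<close>
      have z: "indicator {0<..} y * K (t - y) q = 0" for q
      proof (cases "0 < y")
        case True
        then have "t - y \<le> 0" using False by auto
        moreover have "0 \<le> (\<Sum>i=1..n. q i)" if "\<forall>i\<in>{1..n}. 0 < q i"
          using that by (intro sum_nonneg) (auto intro: less_imp_le)
        ultimately have "\<not> ((\<forall>i\<in>{1..n}. 0 < q i) \<and> (\<Sum>i=1..n. q i) < t - y)"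
          by (meson le_less_trans not_le)
        then show ?thesis by (simp add: K_def)
      qed simp
      show ?thesis unfolding f_eq mult.assoc z using False by auto
    qed
  qed
  have "(\<integral>\<^sup>+q. ?f q \<partial>Pi\<^sub>M {1..Suc n} (\<lambda>_. lborel))
      = (\<integral>\<^sup>+y. \<integral>\<^sup>+q. ?f (q(Suc n := y)) \<partial>Pi\<^sub>M {1..n} (\<lambda>_. lborel) \<partial>lborel)"
    unfolding I by (rule product_nn_integral_insert_rev) (use meas in \<open>auto simp: I\<close>)
  also have "\<dots> = ennreal ((\<Prod>i=0..n. Gamma (e i)) / Gamma A) *
      ennreal (Beta (e (Suc n)) A * t powr (e (Suc n) + A - 1))"
    unfolding inner
    by (subst nn_integral_cmult) (use Suc.prems Apos in \<open>auto simp: nn_integral_Beta_scaled\<close>)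
  also have "\<dots> = ennreal ((\<Prod>i=0..n. Gamma (e i)) / Gamma A * (Beta (e (Suc n)) A * t powr (e (Suc n) + A - 1)))"
    using Suc.prems Apos by (intro ennreal_mult'[symmetric] divide_nonneg_nonneg prod_nonneg) auto
  also have "(\<Prod>i=0..n. Gamma (e i)) / Gamma A * (Beta (e (Suc n)) A * t powr (e (Suc n) + A - 1))
     = (\<Prod>i=0..Suc n. Gamma (e i)) / Gamma (\<Sum>i=0..Suc n. e i) * t powr ((\<Sum>i=0..Suc n. e i) - 1)"
  proof -
    have "Gamma A > 0" using Apos by simp
    then show ?thesis unfolding Beta_def by (simp add: A_def[symmetric] add.commute field_simps)
  qed
  finally show ?case .
qed

section \<open>Multinomial sums\<close>

definition compositions :: "'a set \<Rightarrow> nat \<Rightarrow> ('a \<Rightarrow> nat) set" where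
  "compositions I l = {w \<in> I \<rightarrow>\<^sub>E UNIV. (\<Sum>i\<in>I. w i) = l}"

definition multinomial_mass :: "'a set \<Rightarrow> nat \<Rightarrow> ('a \<Rightarrow> real) \<Rightarrow> ('a \<Rightarrow> nat) \<Rightarrow> real" where
  "multinomial_mass I l q w = fact l / (\<Prod>i\<in>I. fact (w i)) * (\<Prod>i\<in>I. q i ^ w i)"

lemma finite_compositions:
  assumes "finite I"
  shows "finite (compositions I l)"
proof (rule finite_subset)
  show "compositions I l \<subseteq> I \<rightarrow>\<^sub>E {..l}"
  proof
    fix w assume w: "w \<in> compositions I l"
    have "w i \<le> l" if "i \<in> I" for i
      using w assms that member_le_sum[of i I w] by (auto simp: compositions_def)
    then show "w \<in> I \<rightarrow>\<^sub>E {..l}" using w by (auto simp: compositions_def PiE_iff)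
  qed
  show "finite (I \<rightarrow>\<^sub>E {..l})" using assms by (intro finite_PiE) auto
qed

text \<open>
  Splitting off the count of one cell turns a multinomial sum into a binomial one. The weight \<open>F\<close> of
  that count makes the same step usable for the total mass and for the expected count.
\<close>

lemma sum_multinomial_mass_insert:
  assumes "finite I" "a \<notin> I"
  shows "(\<Sum>w\<in>compositions (insert a I) l. multinomial_mass (insert a I) l q w * F (w a))
     = (\<Sum>k\<le>l. real (l choose k) * q a ^ k * F k
          * (\<Sum>w\<in>compositions I (l - k). multinomial_mass I (l - k) q w))"
proof -
  have "(\<Sum>w\<in>compositions (insert a I) l. multinomial_mass (insert a I) l q w * F (w a))
     = (\<Sum>(k, w)\<in>(SIGMA k:{..l}. compositions I (l - k)).
          real (l choose k) * q a ^ k * F k * multinomial_mass I (l - k) q w)"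
  proof (rule sum.reindex_bij_witness[where
        i = "\<lambda>(k, w). w(a := k)" and j = "\<lambda>w. (w a, w(a := undefined))"])
    fix w assume w: "w \<in> compositions (insert a I) l"
    have eqI: "(w(a := undefined)) i = w i" if "i \<in> I" for i using that assms by auto
    have s: "w a + (\<Sum>i\<in>I. w i) = l" using w assms by (simp add: compositions_def)
    show "(case (w a, w(a := undefined)) of (k, w) \<Rightarrow> w(a := k)) = w" by simp
    have "w(a := undefined) \<in> I \<rightarrow>\<^sub>E UNIV"
      using w by (auto simp: compositions_def PiE_iff extensional_def)
    moreover have "(\<Sum>i\<in>I. (w(a := undefined)) i) = l - w a"
      using s eqI by simp
    ultimately show "(w a, w(a := undefined)) \<in> (SIGMA k:{..l}. compositions I (l - k))"
      using s by (auto simp: compositions_def)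
    have "multinomial_mass (insert a I) l q w = real (l choose w a) * q a ^ w a * multinomial_mass I (l - w a) q w"
      using assms s binomial_fact[of "w a" l, where 'a = real]
      by (simp add: multinomial_mass_def)
    moreover have "multinomial_mass I (l - w a) q (w(a := undefined)) = multinomial_mass I (l - w a) q w"
      unfolding multinomial_mass_def using eqI by (simp cong: prod.cong)
    ultimately show "(case (w a, w(a := undefined)) of (k, w) \<Rightarrow>
          real (l choose k) * q a ^ k * F k * multinomial_mass I (l - k) q w)
        = multinomial_mass (insert a I) l q w * F (w a)" by simp
  next
    fix kw assume "kw \<in> (SIGMA k:{..l}. compositions I (l - k))"
    then obtain k w where kw: "kw = (k, w)" "k \<le> l" "w \<in> compositions I (l - k)" by auto
    then have wa: "w a = undefined" using assms by (auto simp: compositions_def PiE_iff extensional_def)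
    then have "w(a := undefined) = w" by auto
    then show "(\<lambda>w. (w a, w(a := undefined))) (case kw of (k, w) \<Rightarrow> w(a := k)) = kw" using kw by simp
    have "(\<Sum>i\<in>I. (w(a := k)) i) = (\<Sum>i\<in>I. w i)" using assms by (intro sum.cong) auto
    then show "(case kw of (k, w) \<Rightarrow> w(a := k)) \<in> compositions (insert a I) l"
      using kw assms by (auto simp: compositions_def PiE_iff extensional_def)
  qed
  also have "\<dots> = (\<Sum>k\<le>l. \<Sum>w\<in>compositions I (l - k). real (l choose k) * q a ^ k * F k * multinomial_mass I (l - k) q w)"
    by (rule sum.Sigma[symmetric]) (simp_all add: finite_compositions assms)
  finally show ?thesis by (simp add: sum_distrib_left)
qed

lemma sum_multinomial_mass:
  assumes "finite I"
  shows "(\<Sum>w\<in>compositions I l. multinomial_mass I l q w) = (\<Sum>i\<in>I. q i) ^ l"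
  using assms
proof (induction I arbitrary: l)
  case empty
  have "compositions ({} :: 'a set) l = (if l = 0 then {\<lambda>_. undefined} else {})"
    by (auto simp: compositions_def)
  then show ?case by (cases "l = 0") (simp_all add: multinomial_mass_def)
next
  case (insert a I)
  then show ?case
    using sum_multinomial_mass_insert[of I a l q "\<lambda>_. 1"] by (simp add: binomial_ring)
qed

text \<open>
  For probabilities \<open>q\<close> the other cells have total probability \<open>1 - q a\<close>, so the count of \<open>a\<close> is
  binomial and its mean is the first moment of the Bernstein polynomials.
\<close>

lemma sum_multinomial_mass_count:
  assumes "finite I" "a \<in> I" "(\<Sum>i\<in>I. q i) = 1"
  shows "(\<Sum>w\<in>compositions I l. multinomial_mass I l q w * real (w a)) = real l * q a"
proof -
  define J where "J = I - {a}"
  have I: "I = insert a J" "finite J" "a \<notin> J" using assms by (auto simp: J_def)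
  have Q: "(\<Sum>i\<in>J. q i) = 1 - q a" using assms(3) I by simp
  have "(\<Sum>w\<in>compositions I l. multinomial_mass I l q w * real (w a))
      = (\<Sum>k\<le>l. real k * Bernstein l k (q a))"
    unfolding I(1) using I sum_multinomial_mass_insert[of J a l q real]
    by (simp add: sum_multinomial_mass Q Bernstein_def mult_ac)
  then show ?thesis by (simp add: sum_k_Bernstein)
qed

section \<open>The negative multinomial observation\<close>

text \<open>
  Summed over all counts with a given total, the terms form a negative binomial series in \<open>\<Sum> q\<close>,
  by the multinomial theorem.
\<close>

lemma negative_multinomial_summable:
  fixes r :: real
  assumes "finite I" and "\<And>i. i \<in> I \<Longrightarrow> 0 \<le> q i" and "(\<Sum>i\<in>I. q i) < 1" and "0 < r"
  shows "integrable (count_space (I \<rightarrow>\<^sub>E (UNIV :: nat set)))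
    (\<lambda>y. Gamma (r + real (\<Sum>i\<in>I. y i)) / (\<Prod>i\<in>I. fact (y i)) * (\<Prod>i\<in>I. q i ^ y i))"
proof -
  define f where "f = (\<lambda>y :: 'a \<Rightarrow> nat. Gamma (r + real (\<Sum>i\<in>I. y i)) / (\<Prod>i\<in>I. fact (y i)) * (\<Prod>i\<in>I. q i ^ y i))"
  define Q where "Q = (\<Sum>i\<in>I. q i)"
  have Q: "0 \<le> Q" "Q < 1" using assms by (auto simp: Q_def intro: sum_nonneg)
  define c where "c l = Gamma (r + real l) / fact l * Q ^ l" for l :: nat
  have c_nonneg: "0 \<le> c l" for l using Q assms by (auto simp: c_def intro!: mult_nonneg_nonneg divide_nonneg_nonneg)
  have r: "r \<notin> \<int>\<^sub>\<le>\<^sub>0" using assms by (auto elim: nonpos_Ints_cases)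
  have "Gamma r \<noteq> 0" using assms by (intro less_imp_neq[symmetric] Gamma_real_pos) auto
  have c_eq: "c l = Gamma r * ((- r gchoose l) * (- Q) ^ l)" for l
  proof -
    have "(- 1) ^ l * (- Q) ^ l = Q ^ l" by (simp add: power_mult_distrib[symmetric])
    then have "(- r gchoose l) * (- Q) ^ l = pochhammer r l / fact l * Q ^ l"
      by (simp add: gbinomial_pochhammer mult_ac)
    then show ?thesis using \<open>Gamma r \<noteq> 0\<close> by (simp add: c_def pochhammer_Gamma[OF r])
  qed
  have "summable (\<lambda>l. (- r gchoose l) * (- Q) ^ l)"
    using gen_binomial_real[of "- Q" "- r"] Q by (auto simp: sums_iff)
  then have c_sum: "summable c" unfolding c_eq[abs_def] by (rule summable_mult)
  have f_nonneg: "0 \<le> f y" for y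
  proof -
    have "0 < r + real (\<Sum>i\<in>I. y i)" using assms(4) by (rule add_pos_nonneg) (rule of_nat_0_le_iff)
    then have "0 \<le> Gamma (r + real (\<Sum>i\<in>I. y i))" by (intro less_imp_le Gamma_real_pos)
    then show ?thesis
      unfolding f_def using assms by (intro mult_nonneg_nonneg divide_nonneg_nonneg prod_nonneg) auto
  qed
  have level: "(\<Sum>y\<in>compositions I l. f y) = c l" for l
  proof -
    have "(\<Sum>y\<in>compositions I l. f y) = (\<Sum>y\<in>compositions I l. Gamma (r + real l) / fact l * multinomial_mass I l q y)"
      by (intro sum.cong) (auto simp: f_def compositions_def multinomial_mass_def)
    also have "\<dots> = c l"
      unfolding sum_distrib_left[symmetric] sum_multinomial_mass[OF assms(1)] by (simp add: c_def Q_def)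
    finally show ?thesis .
  qed
  have "Infinite_Set_Sum.abs_summable_on f (I \<rightarrow>\<^sub>E UNIV)"
  proof (rule abs_summable_finite_sumsI)
    fix F :: "('a \<Rightarrow> nat) set" assume F: "finite F" "F \<subseteq> I \<rightarrow>\<^sub>E UNIV"
    define M where "M = Max ((\<lambda>y. \<Sum>i\<in>I. y i) ` F)"
    have M: "(\<Sum>i\<in>I. y i) \<le> M" if "y \<in> F" for y
      unfolding M_def using F(1) that by (intro Max_ge) auto
    have "(\<Sum>y\<in>F. norm (f y)) = (\<Sum>y\<in>F. f y)" using f_nonneg by simp
    also have "\<dots> \<le> (\<Sum>y\<in>(\<Union>l\<le>M. compositions I l). f y)"
    proof (rule sum_mono2)
      show "finite (\<Union>l\<le>M. compositions I l)" using assms by (auto simp: finite_compositions)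
      show "F \<subseteq> (\<Union>l\<le>M. compositions I l)" using F M by (auto simp: compositions_def)
    qed (use f_nonneg in auto)
    also have "\<dots> = (\<Sum>l\<le>M. \<Sum>y\<in>compositions I l. f y)"
    proof (rule sum.UNION_disjoint)
      show "\<forall>l\<in>{..M}. \<forall>k\<in>{..M}. l \<noteq> k \<longrightarrow> compositions I l \<inter> compositions I k = {}"
        by (auto simp: compositions_def)
    qed (auto simp: finite_compositions assms)
    also have "\<dots> = (\<Sum>l\<le>M. c l)" by (simp add: level)
    also have "\<dots> \<le> suminf c" using c_sum c_nonneg by (intro sum_le_suminf) auto
    finally show "(\<Sum>y\<in>F. norm (f y)) \<le> suminf c" .
  qed
  then show ?thesis by (simp add: Infinite_Set_Sum.abs_summable_on_def f_def)
qed

lemma Gamma_real_Suc: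
  fixes z :: real
  assumes "0 < z"
  shows "Gamma (z + 1) = z * Gamma z"
proof (rule Gamma_plus1)
  show "z \<notin> \<int>\<^sub>\<le>\<^sub>0" using assms by (auto elim: nonpos_Ints_cases)
qed

lemma cellprob_pos:
  assumes "p \<in> paramD N m" "\<nu> \<in> {1..N}" "i \<le> m \<nu>"
  shows "0 < cellprob m p \<nu> i"
  using assms by (auto simp: paramD_def simplexD_def cellprob_def PiE_iff)

lemma sum_cellprob: "(\<Sum>i=0..m \<nu>. cellprob m p \<nu> i) = 1"
proof -
  have "(\<Sum>i=1..m \<nu>. cellprob m p \<nu> i) = (\<Sum>i=1..m \<nu>. p \<nu> i)"
    by (intro sum.cong) (auto simp: cellprob_def)
  then show ?thesis by (subst sum.atLeast_Suc_atMost) (auto simp: cellprob_def)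
qed

lemma negmult_mass_pos:
  assumes "p \<in> paramD N m" "\<nu> \<in> {1..N}" "0 < r \<nu>"
  shows "0 < negmult_mass m r \<nu> p y"
proof -
  have "0 < r \<nu> + real (\<Sum>i=1..m \<nu>. y i)"
    using assms(3) by (rule add_pos_nonneg) (rule of_nat_0_le_iff)
  moreover have "0 < (\<Prod>i=1..m \<nu>. cellprob m p \<nu> i ^ y i)"
    using cellprob_pos[OF assms(1,2)] by (intro prod_pos) auto
  moreover have "0 < (\<Prod>i=1..m \<nu>. fact (y i) :: real)" by (intro prod_pos) auto
  moreover have "0 < cellprob m p \<nu> 0" using cellprob_pos[OF assms(1,2)] by auto
  ultimately show ?thesis unfolding negmult_mass_def using assms(3)
    by (intro mult_pos_pos divide_pos_pos Gamma_real_pos) auto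
qed

lemma obs_mass_pos:
  assumes "p \<in> paramD N m" "\<forall>\<nu>\<in>{1..N}. 0 < r \<nu>"
  shows "0 < obs_mass N m r p x"
  unfolding obs_mass_def using assms by (intro prod_pos ballI negmult_mass_pos) auto

lemma countable_obsX: "countable (obsX N m)"
  unfolding obsX_def by (intro countable_PiE) auto

lemma obs_mass_integrable:
  assumes "p \<in> paramD N m" "\<forall>\<nu>\<in>{1..N}. 0 < r \<nu>"
  shows "integrable (count_space (obsX N m)) (obs_mass N m r p)"
proof -
  have "Infinite_Set_Sum.abs_summable_on (negmult_mass m r \<nu> p) ({1..m \<nu>} \<rightarrow>\<^sub>E UNIV)" if \<nu>: "\<nu> \<in> {1..N}" for \<nu>
  proof -
    have p: "\<And>i. i \<in> {1..m \<nu>} \<Longrightarrow> 0 < p \<nu> i" "(\<Sum>i=1..m \<nu>. p \<nu> i) < 1"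
      using assms(1) \<nu> by (auto simp: paramD_def simplexD_def PiE_iff)
    let ?t = "\<lambda>y. cellprob m p \<nu> 0 powr r \<nu> / Gamma (r \<nu>) *
       (Gamma (r \<nu> + real (\<Sum>i\<in>{1..m \<nu>}. y i)) / (\<Prod>i\<in>{1..m \<nu>}. fact (y i)) * (\<Prod>i\<in>{1..m \<nu>}. p \<nu> i ^ y i))"
    have "integrable (count_space ({1..m \<nu>} \<rightarrow>\<^sub>E UNIV)) ?t"
      using p assms \<nu> by (intro integrable_mult_right negative_multinomial_summable) (auto intro: less_imp_le)
    also have "?t = negmult_mass m r \<nu> p"
    proof
      fix y :: "nat \<Rightarrow> nat"
      have "(\<Prod>i=1..m \<nu>. cellprob m p \<nu> i ^ y i) = (\<Prod>i=1..m \<nu>. p \<nu> i ^ y i)"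
        by (intro prod.cong) (auto simp: cellprob_def)
      then show "?t y = negmult_mass m r \<nu> p y" by (simp add: negmult_mass_def)
    qed
    finally show ?thesis by (simp add: Infinite_Set_Sum.abs_summable_on_def)
  qed
  then have "Infinite_Set_Sum.abs_summable_on (\<lambda>x. \<Prod>\<nu>\<in>{1..N}. negmult_mass m r \<nu> p (x \<nu>)) (obsX N m)"
    unfolding obsX_def
    by (intro Infinite_Set_Sum.abs_summable_on_prod_PiE) (auto intro: countable_PiE)
  then show ?thesis unfolding Infinite_Set_Sum.abs_summable_on_def obs_mass_def[abs_def] .
qed

definition obs_total :: "(nat \<Rightarrow> nat) \<Rightarrow> (nat \<Rightarrow> nat \<Rightarrow> nat) \<Rightarrow> nat \<Rightarrow> nat" where
  "obs_total m x \<nu> = (\<Sum>i=1..m \<nu>. x \<nu> i)"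

text \<open>
  Increasing \<open>r \<nu>\<close> by one multiplies the mass by a multiple of \<open>r \<nu> + n\<^sub>\<nu>\<close>. So the mass times the
  total is dominated by a multiple of the mass for another parameter.
\<close>

lemma obs_mass_times_total_integrable:
  assumes p: "p \<in> paramD N m" and r: "\<forall>\<nu>\<in>{1..N}. 0 < r \<nu>" and \<nu>: "\<nu> \<in> {1..N}"
  shows "integrable (count_space (obsX N m)) (\<lambda>x. obs_mass N m r p x * real (obs_total m x \<nu>))"
proof -
  define r' where "r' = r(\<nu> := r \<nu> + 1)"
  have r': "\<forall>\<nu>\<in>{1..N}. 0 < r' \<nu>" using r by (auto simp: r'_def intro: add_pos_pos)
  have p0: "0 < cellprob m p \<nu> 0" using cellprob_pos[OF p \<nu>] by simp
  have r0: "0 < r \<nu>" using r \<nu> by auto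
  have obs': "obs_mass N m r' p x = (r \<nu> + real (obs_total m x \<nu>)) / r \<nu> * cellprob m p \<nu> 0 * obs_mass N m r p x" for x
  proof -
    have "Gamma (r \<nu>) \<noteq> 0" using r0 by (intro less_imp_neq[symmetric] Gamma_real_pos)
    have shape: "negmult_mass m s \<nu> p (x \<nu>) = Gamma (s \<nu> + real (obs_total m x \<nu>)) / Gamma (s \<nu>)
        * cellprob m p \<nu> 0 powr s \<nu>
        * ((\<Prod>i=1..m \<nu>. cellprob m p \<nu> i ^ x \<nu> i) / (\<Prod>i=1..m \<nu>. fact (x \<nu> i)))" for s
      by (simp add: negmult_mass_def obs_total_def)
    have Gn: "Gamma (r \<nu> + 1 + real (obs_total m x \<nu>)) = (r \<nu> + real (obs_total m x \<nu>)) * Gamma (r \<nu> + real (obs_total m x \<nu>))"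
      using Gamma_real_Suc[of "r \<nu> + real (obs_total m x \<nu>)"] r0 by (simp add: add_ac)
    have G0: "Gamma (r \<nu> + 1) = r \<nu> * Gamma (r \<nu>)" using r0 by (intro Gamma_real_Suc)
    have pw: "cellprob m p \<nu> 0 powr (r \<nu> + 1) = cellprob m p \<nu> 0 * cellprob m p \<nu> 0 powr r \<nu>"
      using p0 by (simp add: powr_add)
    have fac: "negmult_mass m r' \<nu> p (x \<nu>)
        = (r \<nu> + real (obs_total m x \<nu>)) / r \<nu> * cellprob m p \<nu> 0 * negmult_mass m r \<nu> p (x \<nu>)"
      unfolding shape r'_def fun_upd_same Gn G0 pw by (simp add: mult_ac)
    have "(\<Prod>\<mu>\<in>{1..N} - {\<nu>}. negmult_mass m r' \<mu> p (x \<mu>)) = (\<Prod>\<mu>\<in>{1..N} - {\<nu>}. negmult_mass m r \<mu> p (x \<mu>))"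
      by (intro prod.cong) (auto simp: negmult_mass_def r'_def)
    with fac show ?thesis unfolding obs_mass_def using \<nu> by (simp add: prod.remove)
  qed
  show ?thesis
  proof (rule Bochner_Integration.integrable_bound)
    show "integrable (count_space (obsX N m)) (\<lambda>x. r \<nu> / cellprob m p \<nu> 0 * obs_mass N m r' p x)"
      by (intro integrable_mult_right obs_mass_integrable p r')
    show "AE x in count_space (obsX N m). norm (obs_mass N m r p x * real (obs_total m x \<nu>))
        \<le> norm (r \<nu> / cellprob m p \<nu> 0 * obs_mass N m r' p x)"
    proof (rule AE_I2)
      fix x
      have "0 < obs_mass N m r p x" by (rule obs_mass_pos[OF p r])
      moreover have "r \<nu> / cellprob m p \<nu> 0 * obs_mass N m r' p x = (r \<nu> + real (obs_total m x \<nu>)) * obs_mass N m r p x"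
        using p0 r0 by (simp add: obs')
      ultimately show "norm (obs_mass N m r p x * real (obs_total m x \<nu>)) \<le> norm (r \<nu> / cellprob m p \<nu> 0 * obs_mass N m r' p x)"
        using r0 by (simp add: abs_mult algebra_simps)
    qed
  qed simp
qed

lemma obs_mass_bounded_integrable:
  assumes "p \<in> paramD N m" "\<forall>\<nu>\<in>{1..N}. 0 < r \<nu>" and "\<And>x. x \<in> obsX N m \<Longrightarrow> \<bar>h x\<bar> \<le> C"
  shows "integrable (count_space (obsX N m)) (\<lambda>x. obs_mass N m r p x * h x)"
proof (rule Bochner_Integration.integrable_bound)
  show "integrable (count_space (obsX N m)) (\<lambda>x. C * obs_mass N m r p x)"
    using assms by (intro integrable_mult_right obs_mass_integrable)
  have "norm (obs_mass N m r p x * h x) \<le> norm (C * obs_mass N m r p x)" if "x \<in> obsX N m" for x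
    using assms(3)[OF that] obs_mass_pos[OF assms(1,2), of x]
    by (auto simp: abs_mult mult.commute intro!: mult_right_mono)
  then show "AE x in count_space (obsX N m). norm (obs_mass N m r p x * h x) \<le> norm (C * obs_mass N m r p x)"
    by (auto simp: AE_count_space)
qed simp

definition bump :: "nat \<Rightarrow> nat \<Rightarrow> (nat \<Rightarrow> nat \<Rightarrow> nat) \<Rightarrow> (nat \<Rightarrow> nat \<Rightarrow> nat)" where
  "bump \<nu> i x = x(\<nu> := (x \<nu>)(i := Suc (x \<nu> i)))"

lemma bij_betw_bump:
  assumes "\<nu> \<in> {1..N}" "i \<in> {1..m \<nu>}"
  shows "bij_betw (bump \<nu> i) (obsX N m) {x \<in> obsX N m. 0 < x \<nu> i}"
proof (rule bij_betw_byWitness[where f' = "\<lambda>x. x(\<nu> := (x \<nu>)(i := x \<nu> i - 1))"])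
  show "bump \<nu> i ` obsX N m \<subseteq> {x \<in> obsX N m. 0 < x \<nu> i}"
    using assms by (auto simp: bump_def obsX_def PiE_iff extensional_def)
  show "(\<lambda>x. x(\<nu> := (x \<nu>)(i := x \<nu> i - 1))) ` {x \<in> obsX N m. 0 < x \<nu> i} \<subseteq> obsX N m"
    using assms by (auto simp: obsX_def PiE_iff extensional_def)
qed (auto simp: bump_def fun_eq_iff)

lemma bump_in_obsX:
  assumes "\<nu> \<in> {1..N}" "i \<in> {1..m \<nu>}" "x \<in> obsX N m"
  shows "bump \<nu> i x \<in> obsX N m"
  using bij_betwE[OF bij_betw_bump[where m = m, OF assms(1,2)]] assms(3) by auto

lemma obs_total_bump:
  assumes "i \<in> {1..m \<nu>}"
  shows "obs_total m (bump \<nu> i x) \<nu> = Suc (obs_total m x \<nu>)"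
proof -
  have "(\<Sum>j\<in>{1..m \<nu>} - {i}. bump \<nu> i x \<nu> j) = (\<Sum>j\<in>{1..m \<nu>} - {i}. x \<nu> j)"
    by (intro sum.cong) (auto simp: bump_def)
  then show ?thesis unfolding obs_total_def
    using assms sum.remove[of "{1..m \<nu>}" i "bump \<nu> i x \<nu>"] sum.remove[of "{1..m \<nu>}" i "x \<nu>"]
    by (simp add: bump_def)
qed

lemma obs_total_bump_other: "\<mu> \<noteq> \<nu> \<Longrightarrow> obs_total m (bump \<nu> i x) \<mu> = obs_total m x \<mu>"
  by (simp add: obs_total_def bump_def)

lemma obs_mass_bump:
  assumes r: "\<forall>\<nu>\<in>{1..N}. 0 < r \<nu>" and \<nu>: "\<nu> \<in> {1..N}" and i: "i \<in> {1..m \<nu>}"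
  shows "obs_mass N m r p (bump \<nu> i x) * real (Suc (x \<nu> i))
    = obs_mass N m r p x * p \<nu> i * (r \<nu> + real (obs_total m x \<nu>))"
proof -
  have r0: "0 < r \<nu>" using r \<nu> by auto
  define R where "R = (\<Prod>j\<in>{1..m \<nu>} - {i}. cellprob m p \<nu> j ^ x \<nu> j) / (\<Prod>j\<in>{1..m \<nu>} - {i}. fact (x \<nu> j))"
  have shape: "negmult_mass m r \<nu> p (y \<nu>) = Gamma (r \<nu> + real (obs_total m y \<nu>)) / Gamma (r \<nu>) * cellprob m p \<nu> 0 powr r \<nu>
       * (R * (p \<nu> i ^ y \<nu> i / fact (y \<nu> i)))"
    if "\<And>j. j \<noteq> i \<Longrightarrow> y \<nu> j = x \<nu> j" for y
  proof -
    have 1: "(\<Prod>j=1..m \<nu>. cellprob m p \<nu> j ^ y \<nu> j)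
        = p \<nu> i ^ y \<nu> i * (\<Prod>j\<in>{1..m \<nu>} - {i}. cellprob m p \<nu> j ^ x \<nu> j)"
    proof -
      have "(\<Prod>j\<in>{1..m \<nu>} - {i}. cellprob m p \<nu> j ^ y \<nu> j) = (\<Prod>j\<in>{1..m \<nu>} - {i}. cellprob m p \<nu> j ^ x \<nu> j)"
        using that by (intro prod.cong) auto
      moreover have "cellprob m p \<nu> i = p \<nu> i" using i by (simp add: cellprob_def)
      ultimately show ?thesis
        using i prod.remove[of "{1..m \<nu>}" i "\<lambda>j. cellprob m p \<nu> j ^ y \<nu> j"] by simp
    qed
    have 2: "(\<Prod>j=1..m \<nu>. fact (y \<nu> j)) = (fact (y \<nu> i) * (\<Prod>j\<in>{1..m \<nu>} - {i}. fact (x \<nu> j)) :: real)"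
    proof -
      have "(\<Prod>j\<in>{1..m \<nu>} - {i}. fact (y \<nu> j) :: real) = (\<Prod>j\<in>{1..m \<nu>} - {i}. fact (x \<nu> j))"
        using that by (intro prod.cong) auto
      then show ?thesis
        using i prod.remove[of "{1..m \<nu>}" i "\<lambda>j. fact (y \<nu> j) :: real"] by simp
    qed
    show ?thesis unfolding negmult_mass_def obs_total_def[symmetric] 1 2 R_def by (simp add: mult_ac)
  qed
  have Gn: "Gamma (r \<nu> + real (Suc (obs_total m x \<nu>))) = (r \<nu> + real (obs_total m x \<nu>)) * Gamma (r \<nu> + real (obs_total m x \<nu>))"
    using Gamma_real_Suc[of "r \<nu> + real (obs_total m x \<nu>)"] r0 by (simp add: add_ac)
  have b: "bump \<nu> i x \<nu> i = Suc (x \<nu> i)" by (simp add: bump_def)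
  have "negmult_mass m r \<nu> p (bump \<nu> i x \<nu>) = Gamma (r \<nu> + real (Suc (obs_total m x \<nu>))) / Gamma (r \<nu>) * cellprob m p \<nu> 0 powr r \<nu>
       * (R * (p \<nu> i ^ Suc (x \<nu> i) / fact (Suc (x \<nu> i))))"
    by (subst shape) (auto simp: bump_def obs_total_bump[where m = m, OF i, unfolded bump_def])
  moreover have "negmult_mass m r \<nu> p (x \<nu>) = Gamma (r \<nu> + real (obs_total m x \<nu>)) / Gamma (r \<nu>) * cellprob m p \<nu> 0 powr r \<nu>
       * (R * (p \<nu> i ^ x \<nu> i / fact (x \<nu> i)))"
    by (rule shape) simp
  ultimately have fac: "negmult_mass m r \<nu> p (bump \<nu> i x \<nu>) * real (Suc (x \<nu> i))
      = negmult_mass m r \<nu> p (x \<nu>) * p \<nu> i * (r \<nu> + real (obs_total m x \<nu>))"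
    unfolding Gn by (simp add: fact_Suc del: of_nat_Suc)
  have "(\<Prod>\<mu>\<in>{1..N} - {\<nu>}. negmult_mass m r \<mu> p (bump \<nu> i x \<mu>)) = (\<Prod>\<mu>\<in>{1..N} - {\<nu>}. negmult_mass m r \<mu> p (x \<mu>))"
    by (intro prod.cong) (auto simp: bump_def)
  with fac show ?thesis unfolding obs_mass_def using \<nu> by (simp add: prod.remove mult_ac)
qed

text \<open>
  The Hudson-type identity of the negative multinomial law: a factor \<open>p\<^sub>i\<^sub>,\<^sub>\<nu>\<close> can be traded for one
  more observation in cell \<open>i\<close>, because \<open>obs_mass_bump\<close> relates the masses of neighbouring observations.
\<close>

lemma integral_obs_mass_bump:
  assumes r: "\<forall>\<nu>\<in>{1..N}. 0 < r \<nu>" and \<nu>: "\<nu> \<in> {1..N}" and i: "i \<in> {1..m \<nu>}"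
  shows "(LINT x|count_space (obsX N m). obs_mass N m r p x * (p \<nu> i * H (bump \<nu> i x)))
     = (LINT x|count_space (obsX N m).
          obs_mass N m r p x * (real (x \<nu> i) / (r \<nu> + real (obs_total m x \<nu>) - 1) * H x))"
    (is "_ = (LINT x|_. ?g x)")
proof -
  have r0: "0 < r \<nu>" using r \<nu> by auto
  have "obs_mass N m r p x * (p \<nu> i * H (bump \<nu> i x)) = ?g (bump \<nu> i x)" for x
  proof -
    have pos: "0 < r \<nu> + real (obs_total m x \<nu>)" using r0 by simp
    have "?g (bump \<nu> i x) = (obs_mass N m r p (bump \<nu> i x) * real (Suc (x \<nu> i)))
        / (r \<nu> + real (obs_total m x \<nu>)) * H (bump \<nu> i x)"
      by (simp add: obs_total_bump[where m = m, OF i]) (simp add: bump_def)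
    also have "\<dots> = obs_mass N m r p x * (p \<nu> i * H (bump \<nu> i x))"
      unfolding obs_mass_bump[where m = m, OF r \<nu> i] using pos by simp
    finally show ?thesis ..
  qed
  then have "(LINT x|count_space (obsX N m). obs_mass N m r p x * (p \<nu> i * H (bump \<nu> i x)))
     = (LINT x|count_space (obsX N m). ?g (bump \<nu> i x))" by simp
  also have "\<dots> = (LINT x|count_space {x \<in> obsX N m. 0 < x \<nu> i}. ?g x)"
    by (rule integral_bij_count_space[OF bij_betw_bump[where m = m, OF \<nu> i]])
  also have "\<dots> = (LINT x|count_space (obsX N m). ?g x)"
    unfolding infsetsum_def[symmetric] by (rule infsetsum_cong_neutral) auto
  finally show ?thesis .
qed

lemma obsX_nonempty: "obsX N m \<noteq> {}"
  by (auto simp: obsX_def PiE_eq_empty_iff)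

text \<open>
  Apply \<open>integral_obs_mass_bump\<close> to every term of \<open>p\<^sub>0\<^sub>,\<^sub>\<nu> = 1 - \<Sum>\<^sub>i p\<^sub>i\<^sub>,\<^sub>\<nu>\<close>. If \<open>g\<close> did not depend on \<open>x\<close>, this would
  give \<open>E[p\<^sub>0\<^sub>,\<^sub>\<nu> g] = E[g (r\<^sub>\<nu> - 1) / (r\<^sub>\<nu> + n\<^sub>\<nu> - 1)]\<close>. The step bound for \<open>g\<close> costs \<open>\<epsilon>\<close> in the
  numerator, and the assumption on \<open>\<kappa>\<close> pays for it. Strictness comes from \<open>r\<^sub>\<nu> - 1 < b\<close>.
\<close>

lemma mean_gain_positive:
  assumes p: "p \<in> paramD N m" and r: "\<forall>\<nu>\<in>{1..N}. 0 < r \<nu>" and \<nu>: "\<nu> \<in> {1..N}"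
    and r1: "1 < r \<nu>" and b: "r \<nu> \<le> b" and \<epsilon>: "0 \<le> \<epsilon>"
    and \<kappa>: "0 \<le> \<kappa>" "1 \<le> \<kappa> * (r \<nu> - 1 - \<epsilon>)"
    and g_pos: "\<And>x. x \<in> obsX N m \<Longrightarrow> 0 < g x" and g_le: "\<And>x. x \<in> obsX N m \<Longrightarrow> g x \<le> C"
    and g_step: "\<And>x i. x \<in> obsX N m \<Longrightarrow> i \<in> {1..m \<nu>} \<Longrightarrow>
        g x \<le> g (bump \<nu> i x) * (1 + \<epsilon> / (r \<nu> + real (obs_total m x \<nu>)))"
  shows "0 < (LINT x|count_space (obsX N m).
      obs_mass N m r p x * (g x * (\<kappa> * cellprob m p \<nu> 0 - 1 / (b + real (obs_total m x \<nu>)))))"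
proof -
  let ?M = "count_space (obsX N m)"
  let ?o = "obs_mass N m r p"
  define n where "n x = real (obs_total m x \<nu>)" for x
  have n0: "0 \<le> n x" for x by (simp add: n_def)
  \<comment> \<open>The denominator in the identity; it is positive also at \<open>n x = 0\<close> because \<open>r \<nu> > 1\<close>.\<close>
  define q where "q x = r \<nu> + n x - 1" for x
  have q_pos: "0 < q x" for x using n0[of x] r1 by (simp add: q_def)
  have q_ge: "r \<nu> - 1 \<le> q x" for x using n0[of x] by (simp add: q_def)
  have C: "0 \<le> C" using obsX_nonempty[of N m] g_pos g_le by fastforce
  note int = obs_mass_bounded_integrable[OF p r]
  have g_abs: "\<bar>g x\<bar> \<le> C" if "x \<in> obsX N m" for x using g_pos[OF that] g_le[OF that] by simp
  define H where "H x = g x * (1 + \<epsilon> / q x)" for x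
  have H_le: "\<bar>H x\<bar> \<le> C * (1 + \<epsilon> / (r \<nu> - 1))" if "x \<in> obsX N m" for x
  proof -
    have "\<epsilon> / q x \<le> \<epsilon> / (r \<nu> - 1)" using q_ge[of x] r1 \<epsilon> by (intro divide_left_mono) (auto intro: mult_pos_pos q_pos)
    moreover have "0 \<le> \<epsilon> / q x" using \<epsilon> q_pos[of x] by simp
    ultimately show ?thesis unfolding H_def abs_mult using g_abs[OF that] C
      by (intro mult_mono) auto
  qed
  have frac_le: "\<bar>real (x \<nu> i) / q x\<bar> \<le> r \<nu> / (r \<nu> - 1)" if "i \<in> {1..m \<nu>}" for x i
  proof -
    have "real (x \<nu> i) \<le> n x"
      unfolding n_def obs_total_def using that by (intro of_nat_mono member_le_sum) auto
    also have "n x \<le> q x * (r \<nu> / (r \<nu> - 1))"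
    proof -
      have "n x * (r \<nu> - 1) \<le> q x * r \<nu>"
      proof -
        have "r \<nu> * 1 \<le> r \<nu> * r \<nu>" using r1 by (intro mult_left_mono) auto
        moreover have "q x * r \<nu> - n x * (r \<nu> - 1) = r \<nu> * r \<nu> - r \<nu> + n x"
          by (simp add: q_def algebra_simps)
        ultimately show ?thesis using n0[of x] by linarith
      qed
      then show ?thesis using r1 by (simp add: field_simps)
    qed
    finally show ?thesis using q_pos[of x] by (simp add: field_simps)
  qed
  have Hint: "integrable ?M (\<lambda>x. ?o x * (real (x \<nu> i) / q x * H x))" if "i \<in> {1..m \<nu>}" for i
  proof (rule int)
    fix x assume x: "x \<in> obsX N m"
    show "\<bar>real (x \<nu> i) / q x * H x\<bar> \<le> r \<nu> / (r \<nu> - 1) * (C * (1 + \<epsilon> / (r \<nu> - 1)))"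
      unfolding abs_mult[of _ "H x"] using frac_le[OF that, of x] H_le[OF x] r1 by (intro mult_mono) auto
  qed
  have gint: "integrable ?M (\<lambda>x. ?o x * g x)" by (rule int) (rule g_abs)
  have qint: "integrable ?M (\<lambda>x. ?o x * (g x * (c / q x)))" for c
  proof (rule int)
    fix x assume x: "x \<in> obsX N m"
    have "\<bar>c / q x\<bar> \<le> \<bar>c\<bar> / (r \<nu> - 1)"
      using q_ge[of x] q_pos[of x] r1 by (auto simp: abs_divide intro!: divide_left_mono)
    then show "\<bar>g x * (c / q x)\<bar> \<le> C * (\<bar>c\<bar> / (r \<nu> - 1))"
      unfolding abs_mult using g_abs[OF x] C by (intro mult_mono) auto
  qed
  have step: "p \<nu> i * (LINT x|?M. ?o x * g x) \<le> (LINT x|?M. ?o x * (real (x \<nu> i) / q x * H x))"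
    if i: "i \<in> {1..m \<nu>}" for i
  proof -
    have pi: "0 < p \<nu> i" using cellprob_pos[OF p \<nu>, of i] i by (simp add: cellprob_def)
    have "p \<nu> i * (LINT x|?M. ?o x * g x) = (LINT x|?M. ?o x * (p \<nu> i * g x))"
      by (subst integral_mult_right_zero[symmetric]) (simp add: mult_ac)
    also have "\<dots> \<le> (LINT x|?M. ?o x * (p \<nu> i * H (bump \<nu> i x)))"
    proof (rule integral_mono)
      show "integrable ?M (\<lambda>x. ?o x * (p \<nu> i * g x))"
        using integrable_mult_right[OF gint, of "p \<nu> i"] by (simp add: mult_ac)
      show "integrable ?M (\<lambda>x. ?o x * (p \<nu> i * H (bump \<nu> i x)))"
      proof (rule int)
        fix x assume x: "x \<in> obsX N m"
        show "\<bar>p \<nu> i * H (bump \<nu> i x)\<bar> \<le> p \<nu> i * (C * (1 + \<epsilon> / (r \<nu> - 1)))"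
          using H_le[OF bump_in_obsX[where m = m, OF \<nu> i x]] pi by (simp add: abs_mult)
      qed
      fix x assume "x \<in> space ?M"
      then have "g x \<le> H (bump \<nu> i x)"
        using g_step[OF _ i, of x] by (simp add: H_def q_def n_def obs_total_bump[where m = m, OF i])
      then show "?o x * (p \<nu> i * g x) \<le> ?o x * (p \<nu> i * H (bump \<nu> i x))"
        using pi obs_mass_pos[OF p r, of x] by (intro mult_left_mono) auto
    qed
    also have "\<dots> = (LINT x|?M. ?o x * (real (x \<nu> i) / q x * H x))"
      unfolding integral_obs_mass_bump[where m = m, OF r \<nu> i] by (simp add: q_def n_def)
    finally show ?thesis .
  qed
  have "(\<Sum>i=1..m \<nu>. p \<nu> i) * (LINT x|?M. ?o x * g x)
      \<le> (\<Sum>i=1..m \<nu>. (LINT x|?M. ?o x * (real (x \<nu> i) / q x * H x)))"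
    unfolding sum_distrib_right by (rule sum_mono) (rule step)
  also have "\<dots> = (LINT x|?M. (\<Sum>i=1..m \<nu>. ?o x * (real (x \<nu> i) / q x * H x)))"
    by (rule Bochner_Integration.integral_sum[symmetric]) (rule Hint)
  also have "\<dots> \<le> (LINT x|?M. ?o x * g x - ?o x * (g x * ((r \<nu> - 1 - \<epsilon>) / q x)))"
  proof (rule integral_mono)
    show "integrable ?M (\<lambda>x. \<Sum>i=1..m \<nu>. ?o x * (real (x \<nu> i) / q x * H x))"
      by (rule Bochner_Integration.integrable_sum) (rule Hint)
    show "integrable ?M (\<lambda>x. ?o x * g x - ?o x * (g x * ((r \<nu> - 1 - \<epsilon>) / q x)))"
      by (intro Bochner_Integration.integrable_diff gint qint)
    fix x assume "x \<in> space ?M"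
    then have gx: "0 < g x" using g_pos by simp
    have "(\<Sum>i=1..m \<nu>. ?o x * (real (x \<nu> i) / q x * H x)) = ?o x * (n x / q x * H x)"
      by (simp add: n_def obs_total_def sum_distrib_left sum_distrib_right sum_divide_distrib)
    also have "n x / q x * H x = g x * (n x / q x * (1 + \<epsilon> / q x))" by (simp add: H_def)
    also have "\<dots> \<le> g x * ((n x + \<epsilon>) / q x)"
    proof (rule mult_left_mono)
      have "n x / q x * (1 + \<epsilon> / q x) = (n x + \<epsilon> * (n x / q x)) / q x"
        by (simp add: field_simps)
      also have "\<epsilon> * (n x / q x) \<le> \<epsilon> * 1"
        using \<epsilon> q_pos[of x] r1 by (intro mult_left_mono) (auto simp: q_def field_simps)
      then have "(n x + \<epsilon> * (n x / q x)) / q x \<le> (n x + \<epsilon>) / q x"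
        using q_pos[of x] by (intro divide_right_mono) auto
      finally show "n x / q x * (1 + \<epsilon> / q x) \<le> (n x + \<epsilon>) / q x" .
    qed (use gx in simp)
    also have "(n x + \<epsilon>) / q x = 1 - (r \<nu> - 1 - \<epsilon>) / q x"
      using q_pos[of x] by (simp add: q_def field_simps)
    finally show "(\<Sum>i=1..m \<nu>. ?o x * (real (x \<nu> i) / q x * H x)) \<le> ?o x * g x - ?o x * (g x * ((r \<nu> - 1 - \<epsilon>) / q x))"
      using obs_mass_pos[OF p r, of x] by (simp add: algebra_simps)
  qed
  also have "\<dots> = (LINT x|?M. ?o x * g x) - (LINT x|?M. ?o x * (g x * ((r \<nu> - 1 - \<epsilon>) / q x)))"
    by (rule Bochner_Integration.integral_diff[OF gint qint])
  finally have "(LINT x|?M. ?o x * (g x * ((r \<nu> - 1 - \<epsilon>) / q x))) \<le> cellprob m p \<nu> 0 * (LINT x|?M. ?o x * g x)"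
    by (simp add: cellprob_def algebra_simps)
  from mult_left_mono[OF this \<kappa>(1)]
  have main: "\<kappa> * (LINT x|?M. ?o x * (g x * ((r \<nu> - 1 - \<epsilon>) / q x))) \<le> (LINT x|?M. \<kappa> * cellprob m p \<nu> 0 * (?o x * g x))"
    by (simp only: integral_mult_right_zero mult.assoc)
  define h where "h x = ?o x * (g x * (1 / q x - 1 / (b + n x)))" for x
  have h_pos: "0 < h x" if "x \<in> obsX N m" for x
  proof -
    have "1 / (b + n x) < 1 / q x" using q_pos[of x] b by (intro divide_strict_left_mono) (auto simp: q_def)
    then show ?thesis using g_pos[OF that] obs_mass_pos[OF p r, of x] by (simp add: h_def)
  qed
  have bint: "integrable ?M (\<lambda>x. ?o x * (g x * (1 / (b + n x))))"
  proof (rule int)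
    fix x assume x: "x \<in> obsX N m"
    have "\<bar>1 / (b + n x)\<bar> \<le> 1 / b" using b r1 n0[of x] by (auto simp: abs_divide intro!: divide_left_mono)
    then show "\<bar>g x * (1 / (b + n x))\<bar> \<le> C * (1 / b)"
      unfolding abs_mult using g_abs[OF x] C by (intro mult_mono) auto
  qed
  have h_eq: "h = (\<lambda>x. ?o x * (g x * (1 / q x)) - ?o x * (g x * (1 / (b + n x))))"
    by (simp add: h_def fun_eq_iff algebra_simps)
  have hint: "integrable ?M h" unfolding h_eq by (intro Bochner_Integration.integrable_diff qint bint)
  have "0 < (LINT x|?M. h x)"
  proof -
    have "(LINT x|?M. h x) \<noteq> 0"
    proof
      assume "(LINT x|?M. h x) = 0"
      then have "AE x in ?M. h x = 0"
        using integral_nonneg_eq_0_iff_AE[OF hint] h_pos by (auto simp: AE_count_space less_imp_le)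
      then show False using obsX_nonempty[of N m] h_pos by (fastforce simp: AE_count_space)
    qed
    moreover have "0 \<le> (LINT x|?M. h x)"
      using h_pos by (intro integral_nonneg_AE) (auto simp: AE_count_space less_imp_le)
    ultimately show ?thesis by linarith
  qed
  also have "(LINT x|?M. h x) \<le> \<kappa> * (LINT x|?M. ?o x * (g x * ((r \<nu> - 1 - \<epsilon>) / q x))) - (LINT x|?M. ?o x * (g x * (1 / (b + n x))))"
  proof -
    have "(LINT x|?M. ?o x * (g x * (1 / q x))) \<le> (LINT x|?M. \<kappa> * (?o x * (g x * ((r \<nu> - 1 - \<epsilon>) / q x))))"
    proof (rule integral_mono[OF qint integrable_mult_right[OF qint]])
      fix x assume "x \<in> space ?M"
      then have "0 < ?o x * (g x / q x)" using g_pos q_pos[of x] obs_mass_pos[OF p r, of x] by simp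
      then have "(?o x * (g x / q x)) * 1 \<le> (?o x * (g x / q x)) * (\<kappa> * (r \<nu> - 1 - \<epsilon>))"
        by (intro mult_left_mono \<kappa>) simp
      then show "?o x * (g x * (1 / q x)) \<le> \<kappa> * (?o x * (g x * ((r \<nu> - 1 - \<epsilon>) / q x)))"
        by (simp add: mult_ac)
    qed
    then show ?thesis unfolding h_eq
      by (simp only: Bochner_Integration.integral_diff[OF qint bint] integral_mult_right_zero)
  qed
  also have "\<dots> \<le> (LINT x|?M. \<kappa> * cellprob m p \<nu> 0 * (?o x * g x)) - (LINT x|?M. ?o x * (g x * (1 / (b + n x))))"
    using main by simp
  also have "\<dots> = (LINT x|?M. \<kappa> * cellprob m p \<nu> 0 * (?o x * g x) - ?o x * (g x * (1 / (b + n x))))"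
    by (rule Bochner_Integration.integral_diff[symmetric]) (intro bint integrable_mult_right gint)+
  also have "\<dots> = (LINT x|?M. ?o x * (g x * (\<kappa> * cellprob m p \<nu> 0 - 1 / (b + real (obs_total m x \<nu>)))))"
    by (simp add: n_def algebra_simps)
  finally show ?thesis .
qed

section \<open>Exponential weights with a decreasing factor\<close>

lemma has_bochner_integral_exp_moment:
  fixes \<beta> :: real
  assumes "\<beta> > 0"
  shows "has_bochner_integral lborel (\<lambda>u. u ^ k * (indicator {0<..} u * exp (- \<beta> * u))) (fact k / \<beta> ^ Suc k)"
proof (rule has_bochner_integral_nn_integral)
  have "(\<integral>\<^sup>+u. ennreal (u ^ k * (indicator {0<..} u * exp (- \<beta> * u))) \<partial>lborel)
      = (\<integral>\<^sup>+u. ennreal (1 / \<beta>) * ennreal (erlang_density 0 \<beta> u * u ^ k) \<partial>lborel)"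
  proof (rule nn_integral_cong_AE, rule AE_mp[OF AE_lborel_singleton[of 0]], rule AE_I2, rule impI)
    fix u :: real assume "u \<noteq> 0"
    then show "ennreal (u ^ k * (indicator {0<..} u * exp (- \<beta> * u)))
        = ennreal (1 / \<beta>) * ennreal (erlang_density 0 \<beta> u * u ^ k)"
      using assms by (auto simp: erlang_density_def indicator_def ennreal_mult'[symmetric] mult_ac)
  qed
  also have "\<dots> = ennreal (fact k / \<beta> ^ Suc k)"
    using nn_integral_erlang_ith_moment[OF assms, of 0 k] assms
    by (subst nn_integral_cmult) (auto simp: ennreal_mult'[symmetric] field_simps)
  finally show "(\<integral>\<^sup>+u. ennreal (u ^ k * (indicator {0<..} u * exp (- \<beta> * u))) \<partial>lborel)
      = ennreal (fact k / \<beta> ^ Suc k)" .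
qed (use assms in \<open>auto simp: indicator_def\<close>)

text \<open>
  The density \<open>e\<^sup>-\<^sup>\<beta>\<^sup>u T(u)\<close> on \<open>u > 0\<close>, not normalized, with a decreasing \<open>T\<close>: this is the law of the
  mixing parameter given the observation.
\<close>

locale tilted_exponential =
  fixes \<beta> :: real and T :: "real \<Rightarrow> real"
  assumes rate: "0 < \<beta>"
    and T_pos: "\<And>u. 0 \<le> u \<Longrightarrow> 0 < T u"
    and T_anti: "\<And>u v. 0 \<le> u \<Longrightarrow> u \<le> v \<Longrightarrow> T v \<le> T u"
    and T_cont: "continuous_on {0<..} T"
begin

definition wt :: "real \<Rightarrow> real" where
  "wt u = indicator {0<..} u * (exp (- \<beta> * u) * T u)"

definition mom :: "nat \<Rightarrow> real" where
  "mom k = (LBINT u. u ^ k * wt u)"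

lemma wt_measurable [measurable]: "wt \<in> borel_measurable borel"
proof -
  have "(\<lambda>u. indicator {0<..} u *\<^sub>R T u) \<in> borel_measurable borel"
    by (rule borel_measurable_continuous_on_indicator) (auto intro: T_cont)
  then have "(\<lambda>u. exp (- \<beta> * u) * (indicator {0<..} u *\<^sub>R T u)) \<in> borel_measurable borel"
    by measurable
  also have "(\<lambda>u. exp (- \<beta> * u) * (indicator {0<..} u *\<^sub>R T u)) = wt"
    by (simp add: wt_def fun_eq_iff)
  finally show ?thesis .
qed

lemma wt_nonneg: "0 \<le> wt u"
  using T_pos[of u] by (auto simp: wt_def indicator_def)

lemma integrable_mom: "integrable lborel (\<lambda>u. u ^ k * wt u)"
proof (rule Bochner_Integration.integrable_bound)
  show "integrable lborel (\<lambda>u. T 0 * (u ^ k * (indicator {0<..} u * exp (- \<beta> * u))))"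
    using has_bochner_integral_exp_moment[OF rate, of k]
    by (intro integrable_mult_right) (auto simp: has_bochner_integral_iff)
  show "AE u in lborel. norm (u ^ k * wt u) \<le> norm (T 0 * (u ^ k * (indicator {0<..} u * exp (- \<beta> * u))))"
    using T_pos T_anti[of 0]
    by (intro AE_I2) (auto simp: wt_def indicator_def abs_mult less_imp_le mult_ac intro!: mult_left_mono)
qed measurable

lemma mom_pos: "0 < mom k"
proof -
  \<comment> \<open>The least value of the density on the interval from \<open>1\<close> to \<open>2\<close>.\<close>
  define c where "c = exp (- \<beta> * 2) * T 2"
  have "c > 0" using T_pos by (simp add: c_def)
  have "(LBINT u. indicator {1..2::real} u *\<^sub>R c) \<le> mom k"
    unfolding mom_def
  proof (rule integral_mono)
    fix u :: real
    show "indicator {1..2} u *\<^sub>R c \<le> u ^ k * wt u"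
    proof (cases "u \<in> {1..2}")
      case True
      have "c \<le> exp (- \<beta> * u) * T u"
        unfolding c_def using True T_pos[of 2] rate T_anti[of u 2] by (intro mult_mono) auto
      also have "\<dots> = wt u" using True by (simp add: wt_def)
      also have "\<dots> \<le> u ^ k * wt u"
        using True wt_nonneg[of u] mult_right_mono[of 1 "u ^ k" "wt u"] one_le_power[of u k] by auto
      finally show ?thesis using True by simp
    next
      case False
      then show ?thesis using wt_nonneg[of u] by (cases "u > 0") (auto simp: wt_def)
    qed
  qed (auto intro: integrable_mom)
  moreover have "(LBINT u. indicator {1..2::real} u *\<^sub>R c) = c" by simp
  ultimately show ?thesis using \<open>c > 0\<close> by linarith
qed

text \<open>
  For \<open>T = 1\<close> there is equality. In general \<open>u - q\<close>, with \<open>q = (k + 1) / \<beta>\<close>, changes sign once, and the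
  decreasing \<open>T\<close> gives less weight to the side where it is positive. So \<open>T\<close> can be replaced by the
  constant \<open>T q\<close>.
\<close>

lemma mom_Suc_le: "mom (Suc k) \<le> real (Suc k) / \<beta> * mom k"
proof -
  define q where "q = real (Suc k) / \<beta>"
  have qpos: "q > 0" using rate by (simp add: q_def)
  let ?E = "\<lambda>j u. u ^ j * (indicator {0<..} u * exp (- \<beta> * u))"
  have E: "integrable lborel (?E j)" "(LBINT u. ?E j u) = fact j / \<beta> ^ Suc j" for j
    using has_bochner_integral_exp_moment[OF rate, of j] by (auto simp: has_bochner_integral_iff)
  have "(LBINT u. u ^ Suc k * wt u - q * (u ^ k * wt u))
      \<le> (LBINT u. T q * (?E (Suc k) u - q * ?E k u))"
  proof (rule integral_mono)
    fix u :: real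
    have sign: "(u - q) * T u \<le> (u - q) * T q" if "u > 0"
    proof (cases "u \<le> q")
      case True
      then show ?thesis using T_anti[of u q] that by (intro mult_left_mono_neg) auto
    next
      case False
      then show ?thesis using T_anti[of q u] qpos by (intro mult_left_mono) auto
    qed
    have le: "u ^ k * exp (- \<beta> * u) * ((u - q) * T u) \<le> u ^ k * exp (- \<beta> * u) * ((u - q) * T q)" if "u > 0"
      by (rule mult_left_mono[OF sign[OF that]]) (use that in auto)
    show "u ^ Suc k * wt u - q * (u ^ k * wt u) \<le> T q * (?E (Suc k) u - q * ?E k u)"
    proof (cases "u > 0")
      case True
      have "u ^ Suc k * wt u - q * (u ^ k * wt u) = u ^ k * exp (- \<beta> * u) * ((u - q) * T u)"
        using True by (simp add: wt_def algebra_simps)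
      also note le[OF True]
      also have "u ^ k * exp (- \<beta> * u) * ((u - q) * T q) = T q * (?E (Suc k) u - q * ?E k u)"
        using True by (simp add: algebra_simps)
      finally show ?thesis .
    qed (simp add: wt_def)
  qed (intro integrable_mom E Bochner_Integration.integrable_diff integrable_mult_right)+
  also have "\<dots> = T q * (fact (Suc k) / \<beta> ^ Suc (Suc k) - q * (fact k / \<beta> ^ Suc k))"
    by (simp only: E integral_mult_right_zero integral_mult_right Bochner_Integration.integral_diff integrable_mult_right)
  also have "\<dots> = 0" by (simp add: q_def)
  also have "(LBINT u. u ^ Suc k * wt u - q * (u ^ k * wt u)) = mom (Suc k) - q * mom k"
    unfolding mom_def
    by (simp only: integrable_mom integral_mult_right_zero integral_mult_right Bochner_Integration.integral_diff integrable_mult_right)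
  finally show ?thesis by (simp add: q_def)
qed

text \<open>
  Jensen's inequality for \<open>exp\<close>, in the form of its tangent at the mean \<open>t\<close> of the exponent. The bound
  on the second moment turns the quadratic term into a correction of the linear one.
\<close>

lemma exp_le_weighted_mean:
  assumes int: "integrable lborel (\<lambda>u. Y u * wt u)"
    and lower: "\<And>u. 0 < u \<Longrightarrow> exp (A * u - B * u\<^sup>2) \<le> Y u" and "0 \<le> B"
  shows "exp ((A - B * (2 / \<beta>)) * (mom 1 / mom 0)) \<le> (LBINT u. Y u * wt u) / mom 0"
proof -
  define t where "t = (A * mom 1 - B * mom 2) / mom 0"
  have "exp t * mom 0 = (LBINT u. exp t * ((1 - t) * (u ^ 0 * wt u) + A * (u ^ 1 * wt u) - B * (u ^ 2 * wt u)))"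
  proof -
    have "(LBINT u. exp t * ((1 - t) * (u ^ 0 * wt u) + A * (u ^ 1 * wt u) - B * (u ^ 2 * wt u)))
       = exp t * ((1 - t) * mom 0 + A * mom 1 - B * mom 2)"
      unfolding mom_def
      by (simp only: integrable_mom integral_mult_right_zero integral_mult_right Bochner_Integration.integral_diff
          Bochner_Integration.integral_add Bochner_Integration.integrable_add integrable_mult_right)
    also have "\<dots> = exp t * mom 0"
      using mom_pos[of 0] by (simp add: t_def field_simps)
    finally show ?thesis ..
  qed
  also have "\<dots> \<le> (LBINT u. Y u * wt u)"
  proof (rule integral_mono)
    fix u :: real
    show "exp t * ((1 - t) * (u ^ 0 * wt u) + A * (u ^ 1 * wt u) - B * (u ^ 2 * wt u)) \<le> Y u * wt u"
    proof (cases "u > 0")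
      case True
      have "exp t * (1 + (A * u - B * u\<^sup>2 - t)) \<le> exp t * exp (A * u - B * u\<^sup>2 - t)"
        by (intro mult_left_mono exp_ge_add_one_self) auto
      also have "\<dots> = exp (A * u - B * u\<^sup>2)" by (simp add: exp_add[symmetric])
      also have "\<dots> \<le> Y u" by (rule lower[OF True])
      finally have "exp t * (1 + (A * u - B * u\<^sup>2 - t)) * wt u \<le> Y u * wt u"
        using wt_nonneg by (rule mult_right_mono)
      then show ?thesis by (simp add: algebra_simps)
    qed (simp add: wt_def)
  qed (intro integrable_mom int Bochner_Integration.integrable_diff Bochner_Integration.integrable_add integrable_mult_right)+
  finally have "exp t \<le> (LBINT u. Y u * wt u) / mom 0"
    using mom_pos[of 0] by (simp add: field_simps)
  moreover have "(A - B * (2 / \<beta>)) * (mom 1 / mom 0) \<le> t"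
  proof -
    have "B * mom 2 \<le> B * (2 / \<beta> * mom 1)"
      using mom_Suc_le[of 1] \<open>0 \<le> B\<close> by (intro mult_left_mono) (auto simp: numeral_2_eq_2)
    then have "((A - B * (2 / \<beta>)) * mom 1) / mom 0 \<le> t" unfolding t_def
      using mom_pos[of 0] by (intro divide_right_mono) (auto simp: algebra_simps)
    then show ?thesis by simp
  qed
  ultimately show ?thesis by (meson exp_le_cancel_iff order_trans)
qed

end

text \<open>
  On \<open>u > 0\<close> the additional factor \<open>1 / (q + u)\<close> lies between \<open>(1 - u / q) / q\<close> and \<open>1 / q\<close>. The upper
  bound serves for the total mass, the lower bound for the first moment.
\<close>

lemma tilted_mean_shift:
  assumes T: "tilted_exponential \<beta> T" and T': "tilted_exponential \<beta> T'"
    and "q > 0" "K > 0"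
    and shift: "\<And>u. 0 < u \<Longrightarrow> T' u = K * T u / (q + u)"
  shows "tilted_exponential.mom \<beta> T 1 / tilted_exponential.mom \<beta> T 0 * (1 - (2 / \<beta>) / q)
     \<le> tilted_exponential.mom \<beta> T' 1 / tilted_exponential.mom \<beta> T' 0"
proof -
  interpret T: tilted_exponential \<beta> T by fact
  interpret T': tilted_exponential \<beta> T' by fact
  have wt': "T'.wt u = K * T.wt u / (q + u)" for u
    using shift[of u] by (auto simp: T.wt_def T'.wt_def indicator_def)
  have 0: "T'.mom 0 \<le> K / q * T.mom 0"
  proof -
    have "T'.mom 0 \<le> (LBINT u. K / q * (u ^ 0 * T.wt u))" unfolding T'.mom_def
    proof (rule integral_mono)
      fix u :: real
      show "u ^ 0 * T'.wt u \<le> K / q * (u ^ 0 * T.wt u)"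
      proof (cases "u > 0")
        case True
        then show ?thesis using \<open>q > 0\<close> \<open>K > 0\<close> T.wt_nonneg[of u] 
          by (auto simp: wt' intro!: divide_left_mono mult_nonneg_nonneg)
      qed (simp add: T.wt_def wt')
    qed (intro T.integrable_mom T'.integrable_mom integrable_mult_right)+
    then show ?thesis by (simp add: T.mom_def)
  qed
  have 1: "K / q * (T.mom 1 - T.mom 2 / q) \<le> T'.mom 1"
  proof -
    have "(LBINT u. K / q * (u ^ 1 * T.wt u - 1 / q * (u ^ 2 * T.wt u))) \<le> T'.mom 1" unfolding T'.mom_def
    proof (rule integral_mono)
      fix u :: real
      show "K / q * (u ^ 1 * T.wt u - 1 / q * (u ^ 2 * T.wt u)) \<le> u ^ 1 * T'.wt u"
      proof (cases "u > 0")
        case True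
        have "1 / q * (1 - u / q) \<le> 1 / (q + u)"
          using True \<open>q > 0\<close> by (simp add: field_simps power2_eq_square)
        then have "(K * u * T.wt u) * (1 / q * (1 - u / q)) \<le> (K * u * T.wt u) * (1 / (q + u))"
          using True \<open>K > 0\<close> T.wt_nonneg[of u] by (intro mult_left_mono) auto
        then show ?thesis by (simp add: wt' algebra_simps power2_eq_square)
      qed (simp add: T.wt_def wt')
    qed (intro T.integrable_mom T'.integrable_mom integrable_mult_right Bochner_Integration.integrable_diff)+
    also have "(LBINT u. K / q * (u ^ 1 * T.wt u - 1 / q * (u ^ 2 * T.wt u))) = K / q * (T.mom 1 - T.mom 2 / q)"
      unfolding T.mom_def
      by (simp only: T.integrable_mom integral_mult_right_zero integral_mult_right Bochner_Integration.integral_diff integrable_mult_right) simp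
    finally show ?thesis .
  qed
  have "T.mom 2 \<le> 2 / \<beta> * T.mom 1"
    using T.mom_Suc_le[of 1] by (simp add: numeral_2_eq_2)
  then have "T.mom 1 * (1 - (2 / \<beta>) / q) \<le> T.mom 1 - T.mom 2 / q"
    using \<open>q > 0\<close> by (simp add: field_simps)
  then have "K / q * (T.mom 1 * (1 - (2 / \<beta>) / q)) \<le> K / q * (T.mom 1 - T.mom 2 / q)"
    using \<open>q > 0\<close> \<open>K > 0\<close> by (intro mult_left_mono) auto
  with 1 have 2: "K / q * (T.mom 1 * (1 - (2 / \<beta>) / q)) \<le> T'.mom 1" by linarith
  show ?thesis
  proof (cases "1 - (2 / \<beta>) / q \<ge> 0")
    case True
    have "T.mom 1 / T.mom 0 * (1 - (2 / \<beta>) / q) = K / q * (T.mom 1 * (1 - (2 / \<beta>) / q)) / (K / q * T.mom 0)"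
      using \<open>q > 0\<close> \<open>K > 0\<close> by simp
    also have "\<dots> \<le> K / q * (T.mom 1 * (1 - (2 / \<beta>) / q)) / T'.mom 0"
      using 0 T'.mom_pos[of 0] T.mom_pos[of 0] T.mom_pos[of 1] True \<open>q > 0\<close> \<open>K > 0\<close>
      by (intro divide_left_mono mult_nonneg_nonneg) auto
    also have "\<dots> \<le> T'.mom 1 / T'.mom 0"
      using 2 T'.mom_pos[of 0] by (intro divide_right_mono) auto
    finally show ?thesis .
  next
    case False
    then have "T.mom 1 / T.mom 0 * (1 - (2 / \<beta>) / q) \<le> 0"
      using T.mom_pos[of 0] T.mom_pos[of 1] by (intro mult_nonneg_nonpos) auto
    also have "0 \<le> T'.mom 1 / T'.mom 0" using T'.mom_pos[of 0] T'.mom_pos[of 1] by simp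
    finally show ?thesis .
  qed
qed

section \<open>Products of Dirichlet kernels and their mixtures\<close>

text \<open>
  The posterior density for given exponents, up to a constant; the exponents \<open>e \<nu> i\<close> are the Dirichlet
  parameters, with the cell \<open>0\<close> included.
\<close>

definition dir_kernel :: "nat \<Rightarrow> (nat \<Rightarrow> nat) \<Rightarrow> (nat \<Rightarrow> nat \<Rightarrow> real) \<Rightarrow> (nat \<Rightarrow> nat \<Rightarrow> real) \<Rightarrow> real" where
  "dir_kernel N m e p = (\<Prod>\<nu>=1..N. \<Prod>i=0..m \<nu>. cellprob m p \<nu> i powr (e \<nu> i - 1))"

definition dir_const :: "nat \<Rightarrow> (nat \<Rightarrow> nat) \<Rightarrow> (nat \<Rightarrow> nat \<Rightarrow> real) \<Rightarrow> real" where
  "dir_const N m e = (\<Prod>\<nu>=1..N. (\<Prod>i=0..m \<nu>. Gamma (e \<nu> i)) / Gamma (\<Sum>i=0..m \<nu>. e \<nu> i))"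

definition tilt :: "(nat \<Rightarrow> nat \<Rightarrow> real) \<Rightarrow> real \<Rightarrow> nat \<Rightarrow> nat \<Rightarrow> real" where
  "tilt e u \<nu> i = (if i = 0 then e \<nu> 0 + u else e \<nu> i)"

lemma space_lebP: "space (lebP N m) = (\<Pi>\<^sub>E \<nu>\<in>{1..N}. {1..m \<nu>} \<rightarrow>\<^sub>E UNIV)"
  by (simp add: lebP_def space_PiM)

lemma sigma_finite_lebesgue_product: "sigma_finite_measure (\<Pi>\<^sub>M i\<in>{1..n :: nat}. (lborel :: real measure))"
proof -
  interpret product_sigma_finite "\<lambda>i::nat. lborel :: real measure" by standard
  show ?thesis by (rule sigma_finite) simp
qed

lemma product_sigma_finite_lebP: "product_sigma_finite (\<lambda>\<nu>. \<Pi>\<^sub>M i\<in>{1..(m :: nat \<Rightarrow> nat) \<nu>}. (lborel :: real measure))"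
  by (simp only: product_sigma_finite_def sigma_finite_lebesgue_product simp_thms)

lemma sigma_finite_lebP: "sigma_finite_measure (lebP N m)"
proof -
  interpret product_sigma_finite "\<lambda>\<nu>. \<Pi>\<^sub>M i\<in>{1..m \<nu>}. (lborel :: real measure)"
    by (rule product_sigma_finite_lebP)
  show ?thesis unfolding lebP_def by (rule sigma_finite) simp
qed

lemma coordinate_measurable:
  assumes "\<nu> \<in> {1..N}" "i \<in> {1..m \<nu>}"
  shows "(\<lambda>p. p \<nu> i) \<in> borel_measurable (lebP N m)"
proof -
  have "(\<lambda>p. p \<nu>) \<in> measurable (lebP N m) (\<Pi>\<^sub>M i\<in>{1..m \<nu>}. lborel)"
    unfolding lebP_def by (rule measurable_component_singleton[OF assms(1)])
  moreover have "(\<lambda>q. q i) \<in> measurable (\<Pi>\<^sub>M i\<in>{1..m \<nu>}. lborel) (lborel :: real measure)"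
    by (rule measurable_component_singleton[OF assms(2)])
  ultimately have "(\<lambda>p. p \<nu> i) \<in> measurable (lebP N m) (lborel :: real measure)"
    by (rule measurable_compose)
  then show ?thesis by simp
qed

lemma cellprob_measurable:
  assumes "\<nu> \<in> {1..N}" "i \<in> {0..m \<nu>}"
  shows "(\<lambda>p. cellprob m p \<nu> i) \<in> borel_measurable (lebP N m)"
proof (cases "i = 0")
  case True
  have "(\<lambda>p. 1 - (\<Sum>j=1..m \<nu>. p \<nu> j)) \<in> borel_measurable (lebP N m)"
    using assms by (intro borel_measurable_diff borel_measurable_sum coordinate_measurable) auto
  then show ?thesis using True by (simp add: cellprob_def)
next
  case False
  then show ?thesis using assms coordinate_measurable[of \<nu> N i m] by (simp add: cellprob_def)
qed

lemma paramD_iff: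
  assumes "p \<in> space (lebP N m)"
  shows "p \<in> paramD N m \<longleftrightarrow> (\<forall>\<nu>\<in>{1..N}. \<forall>i\<in>{0..m \<nu>}. 0 < cellprob m p \<nu> i)"
proof -
  have "(\<forall>i\<in>{0..m \<nu>}. 0 < cellprob m p \<nu> i) \<longleftrightarrow> (\<Sum>i=1..m \<nu>. p \<nu> i) < 1 \<and> (\<forall>i\<in>{1..m \<nu>}. 0 < p \<nu> i)" for \<nu>
  proof -
    have "{0..m \<nu>} = insert 0 {1..m \<nu>}" by auto
    then show ?thesis by (auto simp: cellprob_def)
  qed
  then show ?thesis using assms by (auto simp: space_lebP paramD_def simplexD_def PiE_iff)
qed

lemma paramD_sets [measurable]: "paramD N m \<in> sets (lebP N m)"
proof -
  have "paramD N m = {p \<in> space (lebP N m). \<forall>\<nu>\<in>{1..N}. \<forall>i\<in>{0..m \<nu>}. 0 < cellprob m p \<nu> i}"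
  proof -
    have "simplexD n \<subseteq> {1..n} \<rightarrow>\<^sub>E UNIV" for n
      using PiE_mono[of "{1..n}" "\<lambda>_. {0 :: real<..}" "\<lambda>_. UNIV"] by (auto simp: simplexD_def)
    then have "paramD N m \<subseteq> space (lebP N m)"
      unfolding space_lebP paramD_def by (intro PiE_mono)
    then show ?thesis using paramD_iff[of _ N m] by blast
  qed
  also have "\<dots> \<in> sets (lebP N m)"
  proof (intro sets.sets_Collect_finite_All)
    fix \<nu> i assume "\<nu> \<in> {1..N}" "i \<in> {0..m \<nu>}"
    note [measurable] = cellprob_measurable[where m = m, OF this]
    show "{p \<in> space (lebP N m). 0 < cellprob m p \<nu> i} \<in> sets (lebP N m)" by measurable
  qed auto
  finally show ?thesis .
qed

lemma dir_kernel_measurable [measurable]: "dir_kernel N m e \<in> borel_measurable (lebP N m)"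
  unfolding dir_kernel_def[abs_def]
  by (intro borel_measurable_prod powr_real_measurable cellprob_measurable borel_measurable_const)

lemma dir_kernel_pos: "p \<in> paramD N m \<Longrightarrow> 0 < dir_kernel N m e p"
  unfolding dir_kernel_def using cellprob_pos[of p N m] by (intro prod_pos ballI) (auto simp: less_imp_neq[symmetric])

lemma dir_const_pos:
  assumes "\<And>\<nu> i. \<nu> \<in> {1..N} \<Longrightarrow> i \<le> m \<nu> \<Longrightarrow> 0 < e \<nu> i"
  shows "0 < dir_const N m e"
  unfolding dir_const_def using assms
  by (intro prod_pos ballI divide_pos_pos Gamma_real_pos sum_pos) auto

lemma nn_integral_dir_kernel:
  assumes e: "\<And>\<nu> i. \<nu> \<in> {1..N} \<Longrightarrow> i \<le> m \<nu> \<Longrightarrow> 0 < e \<nu> i"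
  shows "(\<integral>\<^sup>+p. ennreal (dir_kernel N m e p) * indicator (paramD N m) p \<partial>lebP N m) = ennreal (dir_const N m e)"
proof -
  interpret product_sigma_finite "\<lambda>\<nu>. \<Pi>\<^sub>M i\<in>{1..m \<nu>}. (lborel :: real measure)"
    by (rule product_sigma_finite_lebP)
  define F where "F \<nu> = (\<lambda>q. ennreal ((1 - (\<Sum>i=1..m \<nu>. q i)) powr (e \<nu> 0 - 1) * (\<Prod>i=1..m \<nu>. q i powr (e \<nu> i - 1)))
        * indicator {q. (\<forall>i\<in>{1..m \<nu>}. 0 < q i) \<and> (\<Sum>i=1..m \<nu>. q i) < 1} q)" for \<nu>
  have F_meas: "F \<nu> \<in> borel_measurable (\<Pi>\<^sub>M i\<in>{1..m \<nu>}. lborel)" for \<nu>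
    unfolding F_def by measurable
  have "(\<integral>\<^sup>+p. ennreal (dir_kernel N m e p) * indicator (paramD N m) p \<partial>lebP N m)
      = (\<integral>\<^sup>+p. (\<Prod>\<nu>\<in>{1..N}. F \<nu> (p \<nu>)) \<partial>lebP N m)"
  proof (rule nn_integral_cong)
    fix p assume sp: "p \<in> space (lebP N m)"
    have ind: "p \<in> paramD N m \<longleftrightarrow> (\<forall>\<nu>\<in>{1..N}. (\<forall>i\<in>{1..m \<nu>}. 0 < p \<nu> i) \<and> (\<Sum>i=1..m \<nu>. p \<nu> i) < 1)"
      using sp by (auto simp: space_lebP paramD_def simplexD_def PiE_iff)
    show "ennreal (dir_kernel N m e p) * indicator (paramD N m) p = (\<Prod>\<nu>\<in>{1..N}. F \<nu> (p \<nu>))"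
    proof (cases "p \<in> paramD N m")
      case True
      have "F \<nu> (p \<nu>) = ennreal (\<Prod>i=0..m \<nu>. cellprob m p \<nu> i powr (e \<nu> i - 1))" if "\<nu> \<in> {1..N}" for \<nu>
      proof -
        have "(\<Prod>i=1..m \<nu>. cellprob m p \<nu> i powr (e \<nu> i - 1)) = (\<Prod>i=1..m \<nu>. p \<nu> i powr (e \<nu> i - 1))"
          by (intro prod.cong) (auto simp: cellprob_def)
        moreover have "{0..m \<nu>} = insert 0 {1..m \<nu>}" by auto
        ultimately have "(\<Prod>i=0..m \<nu>. cellprob m p \<nu> i powr (e \<nu> i - 1))
           = (1 - (\<Sum>i=1..m \<nu>. p \<nu> i)) powr (e \<nu> 0 - 1) * (\<Prod>i=1..m \<nu>. p \<nu> i powr (e \<nu> i - 1))"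
          by (simp add: cellprob_def)
        then show ?thesis using True ind that by (simp add: F_def)
      qed
      then show ?thesis using True by (simp add: dir_kernel_def prod_ennreal prod_nonneg)
    next
      case False
      then obtain \<nu> where "\<nu> \<in> {1..N}" "\<not> ((\<forall>i\<in>{1..m \<nu>}. 0 < p \<nu> i) \<and> (\<Sum>i=1..m \<nu>. p \<nu> i) < 1)"
        using ind by blast
      then have "F \<nu> (p \<nu>) = 0" by (simp add: F_def)
      then have "(\<Prod>\<nu>\<in>{1..N}. F \<nu> (p \<nu>)) = 0" using \<open>\<nu> \<in> {1..N}\<close> by (intro prod_zero) auto
      then show ?thesis using False by simp
    qed
  qed
  also have "\<dots> = (\<Prod>\<nu>\<in>{1..N}. integral\<^sup>N (\<Pi>\<^sub>M i\<in>{1..m \<nu>}. lborel) (F \<nu>))"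
    unfolding lebP_def by (rule product_nn_integral_prod[OF _ F_meas]) simp
  also have "\<dots> = (\<Prod>\<nu>\<in>{1..N}. ennreal ((\<Prod>i=0..m \<nu>. Gamma (e \<nu> i)) / Gamma (\<Sum>i=0..m \<nu>. e \<nu> i)))"
  proof (rule prod.cong[OF refl])
    fix \<nu> assume "\<nu> \<in> {1..N}"
    then show "integral\<^sup>N (\<Pi>\<^sub>M i\<in>{1..m \<nu>}. lborel) (F \<nu>) = ennreal ((\<Prod>i=0..m \<nu>. Gamma (e \<nu> i)) / Gamma (\<Sum>i=0..m \<nu>. e \<nu> i))"
      unfolding F_def using nn_integral_Dirichlet_scaled[of "m \<nu>" "e \<nu>" 1] e by simp
  qed
  also have "\<dots> = ennreal (dir_const N m e)"
    unfolding dir_const_def using e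
    by (intro prod_ennreal divide_nonneg_nonneg prod_nonneg less_imp_le[OF Gamma_real_pos] sum_pos) auto
  finally show ?thesis .
qed

lemma tilt_pos:
  assumes "\<And>\<nu> i. \<nu> \<in> {1..N} \<Longrightarrow> i \<le> m \<nu> \<Longrightarrow> 0 < e \<nu> i" "0 \<le> u" "\<nu> \<in> {1..N}" "i \<le> m \<nu>"
  shows "0 < tilt e u \<nu> i"
  using assms by (auto simp: tilt_def intro: add_pos_nonneg)

lemma dir_kernel_tilt:
  assumes "p \<in> paramD N m"
  shows "dir_kernel N m (tilt e u) p = (\<Prod>\<nu>=1..N. cellprob m p \<nu> 0) powr u * dir_kernel N m e p"
proof -
  have "(\<Prod>i=0..m \<nu>. cellprob m p \<nu> i powr (tilt e u \<nu> i - 1))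
      = cellprob m p \<nu> 0 powr u * (\<Prod>i=0..m \<nu>. cellprob m p \<nu> i powr (e \<nu> i - 1))" if "\<nu> \<in> {1..N}" for \<nu>
  proof -
    have "{0..m \<nu>} = insert 0 {1..m \<nu>}" by auto
    moreover have "(\<Prod>i=1..m \<nu>. cellprob m p \<nu> i powr (tilt e u \<nu> i - 1)) = (\<Prod>i=1..m \<nu>. cellprob m p \<nu> i powr (e \<nu> i - 1))"
      by (intro prod.cong) (auto simp: tilt_def)
    moreover have "cellprob m p \<nu> 0 powr (tilt e u \<nu> 0 - 1) = cellprob m p \<nu> 0 powr u * cellprob m p \<nu> 0 powr (e \<nu> 0 - 1)"
      by (simp add: tilt_def powr_add[symmetric] algebra_simps)
    ultimately show ?thesis by simp
  qed
  moreover have "(\<Prod>\<nu>=1..N. cellprob m p \<nu> 0) powr u = (\<Prod>\<nu>=1..N. cellprob m p \<nu> 0 powr u)"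
    by (rule prod_powr_distrib)
  ultimately show ?thesis by (simp add: dir_kernel_def prod.distrib[symmetric])
qed

text \<open>
  This makes every integral over \<open>u\<close> below finite, because all cell probabilities are at most \<open>1\<close>.
\<close>

lemma dir_kernel_tilt_le:
  assumes "p \<in> paramD N m" "0 \<le> u"
  shows "dir_kernel N m (tilt e u) p \<le> dir_kernel N m e p"
proof -
  have "cellprob m p \<nu> 0 \<le> 1" if "\<nu> \<in> {1..N}" for \<nu>
  proof -
    have "0 \<le> (\<Sum>j=1..m \<nu>. p \<nu> j)"
      using assms(1) that by (intro sum_nonneg) (auto simp: paramD_def simplexD_def PiE_iff less_imp_le)
    then show ?thesis by (simp add: cellprob_def)
  qed
  then have "(\<Prod>\<nu>=1..N. cellprob m p \<nu> 0) \<le> 1"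
    using cellprob_pos[OF assms(1)] by (intro prod_le_1) (auto intro: less_imp_le)
  moreover have "0 \<le> (\<Prod>\<nu>=1..N. cellprob m p \<nu> 0)"
    using cellprob_pos[OF assms(1)] by (intro prod_nonneg) (auto intro: less_imp_le)
  ultimately have "(\<Prod>\<nu>=1..N. cellprob m p \<nu> 0) powr u \<le> 1"
    using assms(2) by (intro powr_le1) auto
  then show ?thesis unfolding dir_kernel_tilt[OF assms(1)]
    using dir_kernel_pos[OF assms(1), of e] mult_right_mono[of _ 1 "dir_kernel N m e p"] by simp
qed

lemma dir_kernel_tilt_measurable [measurable]:
  "(\<lambda>(p, u). dir_kernel N m (tilt e u) p) \<in> borel_measurable (lebP N m \<Otimes>\<^sub>M lborel)"
proof -
  have "(\<lambda>z. \<Prod>\<nu>=1..N. \<Prod>i=0..m \<nu>. cellprob m (fst z) \<nu> i powr ((if i = 0 then e \<nu> 0 + snd z else e \<nu> i) - 1))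
      \<in> borel_measurable (lebP N m \<Otimes>\<^sub>M lborel)"
  proof (intro borel_measurable_prod powr_real_measurable)
    fix \<nu> i assume "\<nu> \<in> {1..N}" "i \<in> {0..m \<nu>}"
    then show "(\<lambda>z. cellprob m (fst z) \<nu> i) \<in> borel_measurable (lebP N m \<Otimes>\<^sub>M lborel)"
      by (intro measurable_compose[OF measurable_fst cellprob_measurable])
    show "(\<lambda>z. (if i = 0 then e \<nu> 0 + snd z else e \<nu> i) - 1) \<in> borel_measurable (lebP N m \<Otimes>\<^sub>M lborel)"
      by measurable
  qed
  then show ?thesis unfolding dir_kernel_def tilt_def case_prod_beta' .
qed

definition mixture_kernel :: "nat \<Rightarrow> (nat \<Rightarrow> nat) \<Rightarrow> real \<Rightarrow> (nat \<Rightarrow> nat \<Rightarrow> real) \<Rightarrow> (nat \<Rightarrow> nat \<Rightarrow> real) \<Rightarrow> real" where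
  "mixture_kernel N m \<beta> e p = (LBINT u:{0<..}. exp (- \<beta> * u) * dir_kernel N m (tilt e u) p)"

lemma mixture_kernel_integrable:
  assumes "0 < \<beta>" "p \<in> paramD N m"
  shows "set_integrable lborel {0<..} (\<lambda>u. exp (- \<beta> * u) * dir_kernel N m (tilt e u) p)"
  unfolding set_integrable_def
proof (rule Bochner_Integration.integrable_bound)
  show "integrable lborel (\<lambda>u. dir_kernel N m e p * (indicator {0<..} u * exp (- \<beta> * u)))"
    using has_bochner_integral_exp_moment[OF assms(1), of 0]
    by (intro integrable_mult_right) (simp add: has_bochner_integral_iff)
  have [measurable]: "(\<lambda>u. dir_kernel N m (tilt e u) p) \<in> borel_measurable lborel"
    unfolding dir_kernel_tilt[OF assms(2)] by measurable
  show "(\<lambda>u. indicator {0<..} u *\<^sub>R (exp (- \<beta> * u) * dir_kernel N m (tilt e u) p)) \<in> borel_measurable lborel"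
    by measurable
  show "AE u in lborel. norm (indicator {0<..} u *\<^sub>R (exp (- \<beta> * u) * dir_kernel N m (tilt e u) p))
      \<le> norm (dir_kernel N m e p * (indicator {0<..} u * exp (- \<beta> * u)))"
    using dir_kernel_tilt_le[OF assms(2)] dir_kernel_pos[OF assms(2)]
    by (intro AE_I2) (auto simp: indicator_def abs_mult less_imp_le mult.commute)
qed

lemma integral_dir_kernel:
  assumes e: "\<And>\<nu> i. \<nu> \<in> {1..N} \<Longrightarrow> i \<le> m \<nu> \<Longrightarrow> 0 < e \<nu> i"
  shows "set_integrable (lebP N m) (paramD N m) (dir_kernel N m e)"
    and "(LINT p:paramD N m|lebP N m. dir_kernel N m e p) = dir_const N m e"
proof -
  have "has_bochner_integral (lebP N m) (\<lambda>p. indicator (paramD N m) p *\<^sub>R dir_kernel N m e p) (dir_const N m e)"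
  proof (rule has_bochner_integral_nn_integral)
    show "AE p in lebP N m. 0 \<le> indicator (paramD N m) p *\<^sub>R dir_kernel N m e p"
      using dir_kernel_pos by (intro AE_I2) (auto simp: indicator_def less_imp_le)
    show "0 \<le> dir_const N m e" by (rule less_imp_le, rule dir_const_pos, rule e)
    have "(\<integral>\<^sup>+p. ennreal (indicator (paramD N m) p *\<^sub>R dir_kernel N m e p) \<partial>lebP N m)
        = (\<integral>\<^sup>+p. ennreal (dir_kernel N m e p) * indicator (paramD N m) p \<partial>lebP N m)"
      by (intro nn_integral_cong) (auto simp: indicator_def)
    then show "(\<integral>\<^sup>+p. ennreal (indicator (paramD N m) p *\<^sub>R dir_kernel N m e p) \<partial>lebP N m) = ennreal (dir_const N m e)"
      using nn_integral_dir_kernel[where N = N and m = m and e = e] e by simp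
  qed measurable
  then show "set_integrable (lebP N m) (paramD N m) (dir_kernel N m e)"
    and "(LINT p:paramD N m|lebP N m. dir_kernel N m e p) = dir_const N m e"
    by (auto simp: has_bochner_integral_iff set_integrable_def set_lebesgue_integral_def)
qed

text \<open>
  Tonelli: integrating over \<open>p\<close> first gives the Dirichlet constants. The integral over \<open>u\<close> inside
  \<open>mixture_kernel\<close> is a Bochner integral, so it has to be finite for each \<open>p\<close> before it can be
  replaced by the nonnegative one.
\<close>

lemma integral_mixture_kernel:
  assumes e: "\<And>\<nu> i. \<nu> \<in> {1..N} \<Longrightarrow> i \<le> m \<nu> \<Longrightarrow> 0 < e \<nu> i" and \<beta>: "0 < \<beta>"
    and int: "set_integrable lborel {0<..} (\<lambda>u. exp (- \<beta> * u) * dir_const N m (tilt e u))"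
  shows "set_integrable (lebP N m) (paramD N m) (mixture_kernel N m \<beta> e)"
    and "(LINT p:paramD N m|lebP N m. mixture_kernel N m \<beta> e p)
      = (LBINT u:{0<..}. exp (- \<beta> * u) * dir_const N m (tilt e u))"
proof -
  interpret S: sigma_finite_measure "lebP N m" by (rule sigma_finite_lebP)
  interpret P: pair_sigma_finite "lebP N m" "lborel :: real measure" ..
  define G where "G = (\<lambda>p u. indicator (paramD N m) p * indicator {0<..} u * (exp (- \<beta> * u) * dir_kernel N m (tilt e u) p))"
  have G_meas [measurable]: "(\<lambda>(p, u). G p u) \<in> borel_measurable (lebP N m \<Otimes>\<^sub>M lborel)"
  proof -
    have "(\<lambda>z. indicator (paramD N m) (fst z) * indicator {0<..} (snd z) * (exp (- \<beta> * snd z) * (case z of (p, u) \<Rightarrow> dir_kernel N m (tilt e u) p)))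
        \<in> borel_measurable (lebP N m \<Otimes>\<^sub>M lborel)"
      by measurable
    then show ?thesis by (simp add: G_def case_prod_beta')
  qed
  have G_nonneg: "0 \<le> G p u" for p u
    using dir_kernel_pos[of p N m "tilt e u"] by (auto simp: G_def indicator_def)
  let ?I = "LBINT u:{0<..}. exp (- \<beta> * u) * dir_const N m (tilt e u)"
  have D_pos: "0 < dir_const N m (tilt e u)" if "0 < u" for u
    using that by (intro dir_const_pos tilt_pos[of N m e] e) auto
  have inner: "(\<integral>\<^sup>+u. ennreal (G p u) \<partial>lborel) = ennreal (indicator (paramD N m) p *\<^sub>R mixture_kernel N m \<beta> e p)" for p
  proof (cases "p \<in> paramD N m")
    case True
    have "(\<integral>\<^sup>+u. ennreal (indicator {0<..} u *\<^sub>R (exp (- \<beta> * u) * dir_kernel N m (tilt e u) p)) \<partial>lborel)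
       = ennreal (mixture_kernel N m \<beta> e p)"
      unfolding mixture_kernel_def set_lebesgue_integral_def
      using mixture_kernel_integrable[OF \<beta> True, of e] dir_kernel_pos[OF True]
      by (intro nn_integral_eq_integral) (auto simp: set_integrable_def indicator_def less_imp_le)
    then show ?thesis using True by (simp add: G_def)
  qed (simp add: G_def)
  have "(\<integral>\<^sup>+p. ennreal (indicator (paramD N m) p *\<^sub>R mixture_kernel N m \<beta> e p) \<partial>lebP N m)
      = (\<integral>\<^sup>+u. \<integral>\<^sup>+p. ennreal (G p u) \<partial>lebP N m \<partial>lborel)"
    unfolding inner[symmetric] by (rule P.Fubini'[symmetric]) measurable
  also have "\<dots> = (\<integral>\<^sup>+u. ennreal (indicator {0<..} u *\<^sub>R (exp (- \<beta> * u) * dir_const N m (tilt e u))) \<partial>lborel)"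
  proof (rule nn_integral_cong)
    fix u :: real
    show "(\<integral>\<^sup>+p. ennreal (G p u) \<partial>lebP N m) = ennreal (indicator {0<..} u *\<^sub>R (exp (- \<beta> * u) * dir_const N m (tilt e u)))"
    proof (cases "0 < u")
      case True
      have "(\<integral>\<^sup>+p. ennreal (G p u) \<partial>lebP N m)
          = (\<integral>\<^sup>+p. ennreal (exp (- \<beta> * u)) * (ennreal (dir_kernel N m (tilt e u) p) * indicator (paramD N m) p) \<partial>lebP N m)"
        using True by (intro nn_integral_cong) (auto simp: G_def indicator_def ennreal_mult')
      also have "\<dots> = ennreal (exp (- \<beta> * u)) * ennreal (dir_const N m (tilt e u))"
        using True by (subst nn_integral_cmult) (auto intro!: arg_cong2[where f = "(*)"] nn_integral_dir_kernel tilt_pos[of N m e] e)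
      finally show ?thesis using True by (simp add: ennreal_mult')
    qed (simp add: G_def)
  qed
  also have "\<dots> = ennreal ?I"
    unfolding set_lebesgue_integral_def using int D_pos
    by (intro nn_integral_eq_integral) (auto simp: set_integrable_def indicator_def less_imp_le)
  finally have nn: "(\<integral>\<^sup>+p. ennreal (indicator (paramD N m) p *\<^sub>R mixture_kernel N m \<beta> e p) \<partial>lebP N m) = ennreal ?I" .
  have mk_nonneg: "0 \<le> mixture_kernel N m \<beta> e p" if "p \<in> paramD N m" for p
    unfolding mixture_kernel_def set_lebesgue_integral_def using dir_kernel_pos[OF that]
    by (intro integral_nonneg_AE AE_I2) (auto simp: indicator_def less_imp_le)
  have "has_bochner_integral (lebP N m) (\<lambda>p. indicator (paramD N m) p *\<^sub>R mixture_kernel N m \<beta> e p) ?I"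
  proof (rule has_bochner_integral_nn_integral)
    have "(\<lambda>p. enn2real (\<integral>\<^sup>+u. ennreal (G p u) \<partial>lborel)) \<in> borel_measurable (lebP N m)"
      by measurable
    moreover have "enn2real (\<integral>\<^sup>+u. ennreal (G p u) \<partial>lborel) = indicator (paramD N m) p *\<^sub>R mixture_kernel N m \<beta> e p" for p
      unfolding inner using mk_nonneg[of p] by (auto simp: indicator_def)
    ultimately show "(\<lambda>p. indicator (paramD N m) p *\<^sub>R mixture_kernel N m \<beta> e p) \<in> borel_measurable (lebP N m)"
      by simp
    show "AE p in lebP N m. 0 \<le> indicator (paramD N m) p *\<^sub>R mixture_kernel N m \<beta> e p"
      using mk_nonneg by (intro AE_I2) (auto simp: indicator_def)
    show "0 \<le> ?I"
      unfolding set_lebesgue_integral_def using D_pos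
      by (intro integral_nonneg_AE AE_I2) (auto simp: indicator_def less_imp_le)
  qed (rule nn)
  then show "set_integrable (lebP N m) (paramD N m) (mixture_kernel N m \<beta> e)"
    and "(LINT p:paramD N m|lebP N m. mixture_kernel N m \<beta> e p) = ?I"
    by (auto simp: has_bochner_integral_iff set_integrable_def set_lebesgue_integral_def)
qed

section \<open>Cell counts of the tables\<close>

text \<open>
  The draws of table \<open>k\<close> that show cell \<open>i\<close> of population \<open>\<nu>\<close>. Summing over the positions \<open>h\<close> with
  \<open>nu k h = \<nu>\<close> gives \<open>0\<close> for a table that does not cross \<open>\<nu>\<close>, which avoids a case distinction.
\<close>

definition slot_count :: "(nat \<Rightarrow> nat) \<Rightarrow> (nat \<Rightarrow> nat) \<Rightarrow> (nat \<Rightarrow> nat \<Rightarrow> nat) \<Rightarrow> nat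
    \<Rightarrow> nat \<Rightarrow> nat \<Rightarrow> ((nat \<Rightarrow> nat) \<Rightarrow> nat) \<Rightarrow> nat" where
  "slot_count m d nu k \<nu> i v = (\<Sum>h\<in>{h\<in>{1..d k}. nu k h = \<nu>}. \<Sum>c\<in>{c\<in>cellsI0 m d nu k. c h = i}. v c)"

definition cell_count :: "(nat \<Rightarrow> nat) \<Rightarrow> nat \<Rightarrow> (nat \<Rightarrow> nat) \<Rightarrow> (nat \<Rightarrow> nat \<Rightarrow> nat)
    \<Rightarrow> (nat \<Rightarrow> (nat \<Rightarrow> nat) \<Rightarrow> nat) \<Rightarrow> nat \<Rightarrow> nat \<Rightarrow> nat" where
  "cell_count m L d nu w \<nu> i = (\<Sum>k=1..L. slot_count m d nu k \<nu> i (w k))"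

definition tables_coeff :: "(nat \<Rightarrow> nat) \<Rightarrow> nat \<Rightarrow> (nat \<Rightarrow> nat) \<Rightarrow> (nat \<Rightarrow> nat) \<Rightarrow> (nat \<Rightarrow> nat \<Rightarrow> nat)
    \<Rightarrow> (nat \<Rightarrow> (nat \<Rightarrow> nat) \<Rightarrow> nat) \<Rightarrow> real" where
  "tables_coeff m L d l nu w = (\<Prod>k=1..L. fact (l k) / (\<Prod>c\<in>cellsI0 m d nu k. fact (w k c)))"

lemma finite_cellsI0: "finite (cellsI0 m d nu k)"
  unfolding cellsI0_def by (intro finite_PiE) auto

lemma tableW_eq_compositions: "tableW m d l nu k = compositions (cellsI0 m d nu k) (l k)"
  by (simp add: tableW_def compositions_def)

lemma table_mass_eq_multinomial_mass:
  "table_mass m d l nu k p = multinomial_mass (cellsI0 m d nu k) (l k) (\<lambda>c. \<Prod>h=1..d k. cellprob m p (nu k h) (c h))"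
  by (simp add: fun_eq_iff table_mass_def multinomial_mass_def)

lemma finite_tableW: "finite (tableW m d l nu k)"
  by (simp add: tableW_eq_compositions finite_compositions finite_cellsI0)

lemma finite_tablesW: "finite (tablesW m L d l nu)"
  unfolding tablesW_def by (intro finite_PiE) (auto simp: finite_tableW)

lemma sum_cell_prob: "(\<Sum>c\<in>cellsI0 m d nu k. \<Prod>h=1..d k. cellprob m p (nu k h) (c h)) = 1"
  unfolding cellsI0_def by (subst prod_sum_PiE[symmetric]) (auto simp: sum_cellprob)

text \<open>
  The probabilities of a table factor over its positions, so fixing the position \<open>h\<close> leaves the factor
  of that position.
\<close>

lemma sum_cell_prob_marginal:
  assumes h: "h \<in> {1..d k}"
  shows "(\<Sum>c\<in>{c\<in>cellsI0 m d nu k. c h = 0}. \<Prod>h=1..d k. cellprob m p (nu k h) (c h)) = cellprob m p (nu k h) 0"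
proof -
  define F where "F h' j = (if h' = h \<and> j \<noteq> 0 then 0 else cellprob m p (nu k h') j)" for h' j
  have eq: "(\<Prod>h'=1..d k. F h' (c h')) = (if c h = 0 then \<Prod>h=1..d k. cellprob m p (nu k h) (c h) else 0)" for c
    using h by (auto simp: F_def intro!: prod.cong)
  have "(\<Sum>c\<in>{c\<in>cellsI0 m d nu k. c h = 0}. \<Prod>h=1..d k. cellprob m p (nu k h) (c h))
      = (\<Sum>c\<in>cellsI0 m d nu k. \<Prod>h'=1..d k. F h' (c h'))"
    unfolding eq by (rule sum.inter_filter) (rule finite_cellsI0)
  also have "\<dots> = (\<Prod>h'=1..d k. \<Sum>j=0..m (nu k h'). F h' j)"
    unfolding cellsI0_def by (rule prod_sum_PiE[symmetric]) auto
  also have "\<dots> = (\<Prod>h'=1..d k. if h' = h then cellprob m p (nu k h) 0 else 1)"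
  proof (intro prod.cong refl)
    fix h' show "(\<Sum>j=0..m (nu k h'). F h' j) = (if h' = h then cellprob m p (nu k h) 0 else 1)"
      using sum_cellprob[of m p "nu k h'"]
      by (cases "h' = h") (auto simp: F_def sum.atLeast_Suc_atMost)
  qed
  also have "\<dots> = cellprob m p (nu k h) 0" using h by simp
  finally show ?thesis .
qed

lemma sum_table_mass: "(\<Sum>v\<in>tableW m d l nu k. table_mass m d l nu k p v) = 1"
  unfolding tableW_eq_compositions table_mass_eq_multinomial_mass
  unfolding sum_multinomial_mass[OF finite_cellsI0] sum_cell_prob by simp

lemma sum_tables_mass: "(\<Sum>w\<in>tablesW m L d l nu. tables_mass m L d l nu p w) = 1"
  unfolding tables_mass_def tablesW_def
  by (subst prod_sum_PiE[symmetric]) (auto simp: finite_tableW sum_table_mass)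

text \<open>
  As a function of \<open>p\<close> the mass of the tables is a constant times a monomial in the cell
  probabilities, with the cell counts as exponents. This is what makes the posterior mean of \<open>f(w|p)\<close> a quotient of Dirichlet
  constants.
\<close>

lemma tables_mass_eq:
  assumes nu: "\<forall>k\<in>{1..L}. nu k \<in> {1..d k} \<rightarrow> {1..N}"
  shows "tables_mass m L d l nu p w
    = tables_coeff m L d l nu w * (\<Prod>\<nu>=1..N. \<Prod>i=0..m \<nu>. cellprob m p \<nu> i ^ cell_count m L d nu w \<nu> i)"
proof -
  let ?q = "cellprob m p"
  have one: "(\<Prod>\<nu>=1..N. \<Prod>i=0..m \<nu>. ?q \<nu> i ^ slot_count m d nu k \<nu> i (w k))
     = (\<Prod>c\<in>cellsI0 m d nu k. (\<Prod>h=1..d k. ?q (nu k h) (c h)) ^ w k c)" if k: "k \<in> {1..L}" for k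
  proof -
    have "(\<Prod>\<nu>=1..N. \<Prod>i=0..m \<nu>. ?q \<nu> i ^ slot_count m d nu k \<nu> i (w k))
       = (\<Prod>\<nu>=1..N. \<Prod>h\<in>{h\<in>{1..d k}. nu k h = \<nu>}.
            \<Prod>i=0..m (nu k h). \<Prod>c\<in>{c\<in>cellsI0 m d nu k. c h = i}. ?q (nu k h) (c h) ^ w k c)"
    proof (rule prod.cong[OF refl])
      fix \<nu>
      have "(\<Prod>i=0..m \<nu>. ?q \<nu> i ^ slot_count m d nu k \<nu> i (w k))
        = (\<Prod>i=0..m \<nu>. \<Prod>h\<in>{h\<in>{1..d k}. nu k h = \<nu>}. \<Prod>c\<in>{c\<in>cellsI0 m d nu k. c h = i}. ?q \<nu> i ^ w k c)"
        by (simp add: slot_count_def power_sum)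
      also have "\<dots> = (\<Prod>h\<in>{h\<in>{1..d k}. nu k h = \<nu>}. \<Prod>i=0..m \<nu>. \<Prod>c\<in>{c\<in>cellsI0 m d nu k. c h = i}. ?q \<nu> i ^ w k c)"
        by (rule prod.swap)
      also have "\<dots> = (\<Prod>h\<in>{h\<in>{1..d k}. nu k h = \<nu>}.
            \<Prod>i=0..m (nu k h). \<Prod>c\<in>{c\<in>cellsI0 m d nu k. c h = i}. ?q (nu k h) (c h) ^ w k c)"
        by (intro prod.cong) auto
      finally show "(\<Prod>i=0..m \<nu>. ?q \<nu> i ^ slot_count m d nu k \<nu> i (w k)) = \<dots>" .
    qed
    also have "\<dots> = (\<Prod>h=1..d k. \<Prod>i=0..m (nu k h). \<Prod>c\<in>{c\<in>cellsI0 m d nu k. c h = i}. ?q (nu k h) (c h) ^ w k c)"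
      using nu k by (intro prod.group) auto
    also have "\<dots> = (\<Prod>h=1..d k. \<Prod>c\<in>cellsI0 m d nu k. ?q (nu k h) (c h) ^ w k c)"
    proof (rule prod.cong[OF refl])
      fix h assume h: "h \<in> {1..d k}"
      show "(\<Prod>i=0..m (nu k h). \<Prod>c\<in>{c\<in>cellsI0 m d nu k. c h = i}. ?q (nu k h) (c h) ^ w k c)
          = (\<Prod>c\<in>cellsI0 m d nu k. ?q (nu k h) (c h) ^ w k c)"
        using h by (intro prod.group finite_cellsI0) (auto simp: cellsI0_def PiE_iff)
    qed
    also have "\<dots> = (\<Prod>c\<in>cellsI0 m d nu k. \<Prod>h=1..d k. ?q (nu k h) (c h) ^ w k c)"
      by (rule prod.swap)
    finally show ?thesis by (simp add: prod_power_distrib)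
  qed
  have "(\<Prod>\<nu>=1..N. \<Prod>i=0..m \<nu>. ?q \<nu> i ^ cell_count m L d nu w \<nu> i)
      = (\<Prod>\<nu>=1..N. \<Prod>i=0..m \<nu>. \<Prod>k=1..L. ?q \<nu> i ^ slot_count m d nu k \<nu> i (w k))"
    by (simp add: cell_count_def power_sum)
  also have "\<dots> = (\<Prod>\<nu>=1..N. \<Prod>k=1..L. \<Prod>i=0..m \<nu>. ?q \<nu> i ^ slot_count m d nu k \<nu> i (w k))"
    by (intro prod.cong refl prod.swap)
  also have "\<dots> = (\<Prod>k=1..L. \<Prod>\<nu>=1..N. \<Prod>i=0..m \<nu>. ?q \<nu> i ^ slot_count m d nu k \<nu> i (w k))"
    by (rule prod.swap)
  also have "\<dots> = (\<Prod>k=1..L. \<Prod>c\<in>cellsI0 m d nu k. (\<Prod>h=1..d k. ?q (nu k h) (c h)) ^ w k c)"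
    by (rule prod.cong[OF refl one])
  finally show ?thesis
    by (simp add: tables_mass_def table_mass_def tables_coeff_def prod.distrib[symmetric])
qed

lemma card_slots:
  assumes "inj_on (nu k) {1..d k}" "k \<in> {1..L}"
  shows "card {h\<in>{1..d k}. nu k h = \<nu>} = (if k \<in> tables_of L d nu \<nu> then 1 else 0)"
proof (cases "k \<in> tables_of L d nu \<nu>")
  case True
  then obtain h where h: "h \<in> {1..d k}" "nu k h = \<nu>" by (auto simp: tables_of_def)
  have "h' = h" if "h' \<in> {1..d k}" "nu k h' = \<nu>" for h'
    using inj_onD[OF assms(1), of h' h] that h by simp
  then have "{h\<in>{1..d k}. nu k h = \<nu>} = {h}" using h by blast
  then show ?thesis using True by simp
next
  case False
  then have "{h\<in>{1..d k}. nu k h = \<nu>} = {}" using assms(2) by (auto simp: tables_of_def)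
  then show ?thesis using False by simp
qed

lemma sum_tables_of:
  "(\<Sum>k=1..L. if k \<in> tables_of L d nu \<nu> then f k else 0) = (\<Sum>k\<in>tables_of L d nu \<nu>. f k :: 'a :: comm_monoid_add)"
proof -
  have "{k \<in> {1..L}. k \<in> tables_of L d nu \<nu>} = tables_of L d nu \<nu>" by (auto simp: tables_of_def)
  then show ?thesis using sum.inter_filter[of "{1..L}" f "\<lambda>k. k \<in> tables_of L d nu \<nu>"] by simp
qed

lemma sum_cell_count:
  assumes inj: "\<forall>k\<in>{1..L}. inj_on (nu k) {1..d k}" and w: "w \<in> tablesW m L d l nu"
  shows "(\<Sum>i=0..m \<nu>. cell_count m L d nu w \<nu> i) = (\<Sum>k\<in>tables_of L d nu \<nu>. l k)"
proof -
  have one: "(\<Sum>i=0..m \<nu>. slot_count m d nu k \<nu> i (w k)) = (if k \<in> tables_of L d nu \<nu> then l k else 0)"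
    if k: "k \<in> {1..L}" for k
  proof -
    have "(\<Sum>i=0..m \<nu>. slot_count m d nu k \<nu> i (w k))
       = (\<Sum>h\<in>{h\<in>{1..d k}. nu k h = \<nu>}. \<Sum>i=0..m \<nu>. \<Sum>c\<in>{c\<in>cellsI0 m d nu k. c h = i}. w k c)"
      unfolding slot_count_def by (rule sum.swap)
    also have "\<dots> = (\<Sum>h\<in>{h\<in>{1..d k}. nu k h = \<nu>}. \<Sum>c\<in>cellsI0 m d nu k. w k c)"
      by (intro sum.cong[OF refl] sum.group finite_cellsI0) (auto simp: cellsI0_def PiE_iff)
    also have "(\<Sum>c\<in>cellsI0 m d nu k. w k c) = l k"
      using w k by (auto simp: tablesW_def tableW_def PiE_iff)
    finally show ?thesis using card_slots[of nu k d L \<nu>] inj k by auto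
  qed
  have "(\<Sum>i=0..m \<nu>. cell_count m L d nu w \<nu> i) = (\<Sum>k=1..L. \<Sum>i=0..m \<nu>. slot_count m d nu k \<nu> i (w k))"
    unfolding cell_count_def by (rule sum.swap)
  also have "\<dots> = (\<Sum>k=1..L. if k \<in> tables_of L d nu \<nu> then l k else 0)"
    by (rule sum.cong[OF refl one])
  finally show ?thesis unfolding sum_tables_of .
qed

lemma mean_cell_count_0:
  assumes inj: "\<forall>k\<in>{1..L}. inj_on (nu k) {1..d k}"
  shows "(\<Sum>w\<in>tablesW m L d l nu. tables_mass m L d l nu p w * real (cell_count m L d nu w \<nu> 0))
    = real (\<Sum>k\<in>tables_of L d nu \<nu>. l k) * cellprob m p \<nu> 0"
proof -
  let ?f = "\<lambda>k. table_mass m d l nu k p"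
  have one: "(\<Sum>v\<in>tableW m d l nu k. ?f k v * real (slot_count m d nu k \<nu> 0 v))
      = (if k \<in> tables_of L d nu \<nu> then real (l k) * cellprob m p \<nu> 0 else 0)" if k: "k \<in> {1..L}" for k
  proof -
    let ?q = "\<lambda>c. \<Prod>h=1..d k. cellprob m p (nu k h) (c h)"
    have "(\<Sum>v\<in>tableW m d l nu k. ?f k v * real (slot_count m d nu k \<nu> 0 v))
       = (\<Sum>h\<in>{h\<in>{1..d k}. nu k h = \<nu>}. \<Sum>c\<in>{c\<in>cellsI0 m d nu k. c h = 0}.
            \<Sum>v\<in>tableW m d l nu k. ?f k v * real (v c))"
      unfolding slot_count_def of_nat_sum sum_distrib_left
      by (subst sum.swap, rule sum.cong[OF refl], rule sum.swap)
    also have "\<dots> = (\<Sum>h\<in>{h\<in>{1..d k}. nu k h = \<nu>}. \<Sum>c\<in>{c\<in>cellsI0 m d nu k. c h = 0}. real (l k) * ?q c)"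
      unfolding tableW_eq_compositions table_mass_eq_multinomial_mass
      by (intro sum.cong refl sum_multinomial_mass_count finite_cellsI0 sum_cell_prob) auto
    also have "\<dots> = (\<Sum>h\<in>{h\<in>{1..d k}. nu k h = \<nu>}. real (l k) * cellprob m p \<nu> 0)"
      unfolding sum_distrib_left[symmetric]
    proof (rule arg_cong2[where f = "(*)", OF refl], rule sum.cong[OF refl])
      fix h assume "h \<in> {h\<in>{1..d k}. nu k h = \<nu>}"
      then show "(\<Sum>c\<in>{c\<in>cellsI0 m d nu k. c h = 0}. ?q c) = cellprob m p \<nu> 0"
        using sum_cell_prob_marginal[where h = h and k = k and d = d and m = m and nu = nu and p = p] by auto
    qed
    finally show ?thesis using card_slots[of nu k d L \<nu>] inj k by auto
  qed
  have "(\<Sum>w\<in>tablesW m L d l nu. tables_mass m L d l nu p w * real (cell_count m L d nu w \<nu> 0))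
     = (\<Sum>k=1..L. \<Sum>w\<in>tablesW m L d l nu. tables_mass m L d l nu p w * real (slot_count m d nu k \<nu> 0 (w k)))"
    unfolding cell_count_def of_nat_sum sum_distrib_left by (rule sum.swap)
  also have "\<dots> = (\<Sum>k=1..L. \<Sum>v\<in>tableW m d l nu k. ?f k v * real (slot_count m d nu k \<nu> 0 v))"
  proof (rule sum.cong[OF refl])
    fix k assume k: "k \<in> {1..L}"
    \<comment> \<open>Absorbing the count of table \<open>k\<close> into its own factor keeps the product form.\<close>
    let ?F = "\<lambda>j v. if j = k then ?f k v * real (slot_count m d nu k \<nu> 0 v) else ?f j v"
    have "tables_mass m L d l nu p w * real (slot_count m d nu k \<nu> 0 (w k)) = (\<Prod>j=1..L. ?F j (w j))" for w
    proof -
      have "(\<Prod>j\<in>{1..L} - {k}. ?F j (w j)) = (\<Prod>j\<in>{1..L} - {k}. ?f j (w j))"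
        by (intro prod.cong) auto
      then show ?thesis unfolding tables_mass_def using k by (simp add: prod.remove[of _ k])
    qed
    then have "(\<Sum>w\<in>tablesW m L d l nu. tables_mass m L d l nu p w * real (slot_count m d nu k \<nu> 0 (w k)))
       = (\<Prod>j=1..L. \<Sum>v\<in>tableW m d l nu j. ?F j v)"
      unfolding tablesW_def by (subst prod_sum_PiE) (auto simp: finite_tableW)
    also have "\<dots> = (\<Prod>j=1..L. if j = k then \<Sum>v\<in>tableW m d l nu k. ?f k v * real (slot_count m d nu k \<nu> 0 v) else 1)"
      by (intro prod.cong) (auto simp: sum_table_mass)
    also have "\<dots> = (\<Sum>v\<in>tableW m d l nu k. ?f k v * real (slot_count m d nu k \<nu> 0 v))"
      using k by simp
    finally show "(\<Sum>w\<in>tablesW m L d l nu. tables_mass m L d l nu p w * real (slot_count m d nu k \<nu> 0 (w k))) = \<dots>" .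
  qed
  also have "\<dots> = (\<Sum>k=1..L. if k \<in> tables_of L d nu \<nu> then real (l k) * cellprob m p \<nu> 0 else 0)"
    by (rule sum.cong[OF refl one])
  also have "\<dots> = real (\<Sum>k\<in>tables_of L d nu \<nu>. l k) * cellprob m p \<nu> 0"
    unfolding sum_tables_of of_nat_sum sum_distrib_right ..
  finally show ?thesis .
qed

lemma tables_coeff_pos: "0 < tables_coeff m L d l nu w"
  unfolding tables_coeff_def by (intro prod_pos ballI divide_pos_pos) auto

section \<open>Rising factorials and Gamma quotients\<close>

text \<open>
  A lower bound for \<open>ln (1 + t)\<close> that is valid for all \<open>t \<ge> 0\<close>: its exponential is controlled through
  \<open>(1 - t + t\<^sup>2) (1 + t) = 1 + t\<^sup>3 \<ge> 1\<close>.
\<close>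

lemma exp_minus_square_le:
  fixes t :: real
  assumes "0 \<le> t"
  shows "exp (t - t\<^sup>2) \<le> 1 + t"
proof -
  have pos: "0 < 1 - t + t\<^sup>2"
    using zero_le_power2[of "t - 1/2"] by (simp add: power2_eq_square algebra_simps)
  have "1 - t + t\<^sup>2 \<le> exp (- (t - t\<^sup>2))"
    using exp_ge_add_one_self[of "- (t - t\<^sup>2)"] by (simp add: algebra_simps)
  then have "(1 - t + t\<^sup>2) * exp (t - t\<^sup>2) \<le> exp (- (t - t\<^sup>2)) * exp (t - t\<^sup>2)"
    by (intro mult_right_mono) auto
  also have "\<dots> = 1" by (simp add: exp_add[symmetric])
  also have "1 \<le> (1 - t + t\<^sup>2) * (1 + t)"
  proof -
    have "(1 - t + t\<^sup>2) * (1 + t) = 1 + t ^ 3" by (simp add: power2_eq_square power3_eq_cube algebra_simps)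
    then show ?thesis using assms by simp
  qed
  finally show ?thesis using pos by simp
qed

text \<open>
  Each factor grows by \<open>1 + u / (R + j)\<close>, which is smallest for the last possible index \<open>j = S - 1\<close>. For
  \<open>S = 0\<close> both products are empty.
\<close>

lemma pochhammer_shift_lower:
  fixes R u :: real
  assumes "0 < R" "0 \<le> u" "s \<le> S" and c: "c = R + real S - 1"
  shows "pochhammer R s * exp (real s * (u / c - (u / c)\<^sup>2)) \<le> pochhammer (R + u) s"
proof -
  have "(\<Prod>j\<in>{0..<s}. (R + real j) * exp (u / c - (u / c)\<^sup>2)) \<le> (\<Prod>j\<in>{0..<s}. R + u + real j)"
  proof (rule prod_mono)
    fix j assume j: "j \<in> {0..<s}"
    then have Rc: "R + real j \<le> c" using assms by auto
    have c0: "0 < c" using assms Rc by linarith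
    have "(R + real j) * exp (u / c - (u / c)\<^sup>2) \<le> (R + real j) * (1 + u / c)"
      using assms c0 by (intro mult_left_mono exp_minus_square_le) auto
    also have "\<dots> = R + real j + u * ((R + real j) / c)" by (simp add: algebra_simps add_divide_distrib)
    also have "u * ((R + real j) / c) \<le> u * 1"
      using Rc c0 assms by (intro mult_left_mono) auto
    finally show "0 \<le> (R + real j) * exp (u / c - (u / c)\<^sup>2) \<and> (R + real j) * exp (u / c - (u / c)\<^sup>2) \<le> R + u + real j"
      using assms by simp
  qed
  then show ?thesis
    by (simp add: pochhammer_prod prod.distrib exp_of_nat_mult[symmetric] mult.commute)
qed

lemma pochhammer_shift_upper:
  fixes B u :: real
  assumes "0 < B" "0 \<le> u"
  shows "pochhammer (B + u) S \<le> pochhammer B S * exp (real S * (u / B))"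
proof -
  have "(\<Prod>j\<in>{0..<S}. B + u + real j) \<le> (\<Prod>j\<in>{0..<S}. (B + real j) * exp (u / B))"
  proof (rule prod_mono)
    fix j
    have "B + u + real j \<le> (B + real j) * (1 + u / B)"
      using assms by (simp add: field_simps)
    also have "\<dots> \<le> (B + real j) * exp (u / B)"
      using assms by (intro mult_left_mono exp_ge_add_one_self) auto
    finally show "0 \<le> B + u + real j \<and> B + u + real j \<le> (B + real j) * exp (u / B)"
      using assms by simp
  qed
  then show ?thesis
    by (simp add: pochhammer_prod prod.distrib exp_of_nat_mult[symmetric] mult.commute)
qed

lemma Gamma_add_nat:
  fixes z :: real
  assumes "0 < z"
  shows "Gamma (z + real n) = pochhammer z n * Gamma z"
proof -
  have "z \<notin> \<int>\<^sub>\<le>\<^sub>0" using assms by (auto elim: nonpos_Ints_cases)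
  moreover have "Gamma z \<noteq> 0" using assms by (intro less_imp_neq[symmetric] Gamma_real_pos)
  ultimately show ?thesis by (simp add: pochhammer_Gamma)
qed

text \<open>
  The quotient is a Beta function of its first argument, up to a constant, and that is an integral of a
  decreasing function.
\<close>

lemma Gamma_ratio_antimono:
  fixes \<delta> z z' :: real
  assumes "0 < \<delta>" "0 < z" "z \<le> z'"
  shows "Gamma z' / Gamma (z' + \<delta>) \<le> Gamma z / Gamma (z + \<delta>)"
proof -
  have "Beta z' \<delta> \<le> Beta z \<delta>" using assms by (intro Beta_real_mono) auto
  then have "Gamma \<delta> * (Gamma z' / Gamma (z' + \<delta>)) \<le> Gamma \<delta> * (Gamma z / Gamma (z + \<delta>))"
    by (simp add: Beta_def mult.commute)
  then show ?thesis using Gamma_real_pos[OF assms(1)] by (simp only: mult_le_cancel_left_pos)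
qed

lemma continuous_on_Gamma_shift:
  fixes z :: real
  assumes "0 \<le> z"
  shows "continuous_on {0<..} (\<lambda>u. Gamma (z + u))"
proof (rule continuous_on_compose2[of "{0<..}" Gamma])
  show "continuous_on {0 :: real<..} Gamma"
    by (rule continuous_on_Gamma) (auto elim: nonpos_Ints_cases)
qed (use assms in \<open>auto intro!: continuous_intros\<close>)

section \<open>The two Bayesian predictive masses\<close>

text \<open>
  Conditions on general \<open>a0\<close> and \<open>a\<close> under which the posterior is proper and both predictive masses
  have a closed form. That \<open>b \<nu> \<ge> 1\<close> keeps the quotients of rising factorials at most \<open>1\<close>.
\<close>

locale posterior_setting =
  fixes N L :: nat and m d l :: "nat \<Rightarrow> nat" and nu :: "nat \<Rightarrow> nat \<Rightarrow> nat"
    and r a0 :: "nat \<Rightarrow> real" and a :: "nat \<Rightarrow> nat \<Rightarrow> real"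
  assumes m_pos: "\<And>\<nu>. \<nu> \<in> {1..N} \<Longrightarrow> 1 \<le> m \<nu>"
    and r_pos: "\<And>\<nu>. \<nu> \<in> {1..N} \<Longrightarrow> 0 < r \<nu>"
    and R_pos: "\<And>\<nu>. \<nu> \<in> {1..N} \<Longrightarrow> 0 < r \<nu> + a0 \<nu>"
    and a_pos: "\<And>\<nu> i. \<nu> \<in> {1..N} \<Longrightarrow> i \<in> {1..m \<nu>} \<Longrightarrow> 0 < a \<nu> i"
    and b_ge_1: "\<And>\<nu>. \<nu> \<in> {1..N} \<Longrightarrow> 1 \<le> r \<nu> + a0 \<nu> + (\<Sum>i=1..m \<nu>. a \<nu> i)"
    and nu_range: "\<forall>k\<in>{1..L}. nu k \<in> {1..d k} \<rightarrow> {1..N}"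
    and nu_inj: "\<forall>k\<in>{1..L}. inj_on (nu k) {1..d k}"
begin

abbreviation tables where "tables \<equiv> tablesW m L d l nu"
abbreviation table_lik where "table_lik \<equiv> tables_mass m L d l nu"
abbreviation obs_lik where "obs_lik \<equiv> obs_mass N m r"
abbreviation obs_space where "obs_space \<equiv> count_space (obsX N m)"
abbreviation integrable_D :: "((nat \<Rightarrow> nat \<Rightarrow> real) \<Rightarrow> real) \<Rightarrow> bool" where
  "integrable_D \<equiv> set_integrable (lebP N m) (paramD N m)"
abbreviation totals where "totals \<equiv> obs_total m"
abbreviation base_prior where "base_prior \<equiv> prior_a N m a0 a"
abbreviation mix_prior where "mix_prior \<beta> \<equiv> prior_mix N m 1 \<beta> (\<lambda>_. 1) a0 a"
abbreviation bayes where "bayes \<equiv> bayes_predictive N m r L d l nu"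
abbreviation risk where "risk \<equiv> KL_risk N m r L d l nu"

definition R :: "nat \<Rightarrow> real" where "R \<nu> = r \<nu> + a0 \<nu>"
definition b :: "nat \<Rightarrow> real" where "b \<nu> = R \<nu> + (\<Sum>i=1..m \<nu>. a \<nu> i)"
definition S :: "nat \<Rightarrow> nat" where "S \<nu> = (\<Sum>k\<in>tables_of L d nu \<nu>. l k)"

abbreviation counts :: "(nat \<Rightarrow> (nat \<Rightarrow> nat) \<Rightarrow> nat) \<Rightarrow> nat \<Rightarrow> nat \<Rightarrow> nat" where
  "counts \<equiv> cell_count m L d nu"
abbreviation table_coeff :: "(nat \<Rightarrow> (nat \<Rightarrow> nat) \<Rightarrow> nat) \<Rightarrow> real" where
  "table_coeff \<equiv> tables_coeff m L d l nu"

text \<open>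
  The posterior exponents for the prior with \<open>t\<close> in place of \<open>a0\<close>. The parameter \<open>t\<close> is needed because
  the mixture prior shifts it by \<open>u\<close>.
\<close>

definition post :: "(nat \<Rightarrow> real) \<Rightarrow> (nat \<Rightarrow> nat \<Rightarrow> nat) \<Rightarrow> nat \<Rightarrow> nat \<Rightarrow> real" where
  "post t x \<nu> i = (if i = 0 then r \<nu> + t \<nu> else real (x \<nu> i) + a \<nu> i)"

definition add_counts :: "(nat \<Rightarrow> nat \<Rightarrow> real) \<Rightarrow> (nat \<Rightarrow> nat \<Rightarrow> nat) \<Rightarrow> nat \<Rightarrow> nat \<Rightarrow> real" where
  "add_counts e s \<nu> i = e \<nu> i + real (s \<nu> i)"

definition obs_coeff :: "(nat \<Rightarrow> nat \<Rightarrow> nat) \<Rightarrow> real" where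
  "obs_coeff x = (\<Prod>\<nu>=1..N. Gamma (r \<nu> + real (totals x \<nu>)) / (Gamma (r \<nu>) * (\<Prod>i=1..m \<nu>. fact (x \<nu> i))))"

lemma obs_coeff_pos: "0 < obs_coeff x"
  unfolding obs_coeff_def
proof (intro prod_pos ballI divide_pos_pos mult_pos_pos Gamma_real_pos)
  fix \<nu> assume "\<nu> \<in> {1..N}"
  then show "0 < r \<nu>" "0 < r \<nu> + real (totals x \<nu>)" using r_pos[of \<nu>] by auto
qed auto

lemma post_pos: "\<nu> \<in> {1..N} \<Longrightarrow> i \<le> m \<nu> \<Longrightarrow> 0 < post a0 x \<nu> i"
  using R_pos a_pos by (auto simp: post_def intro: add_nonneg_pos)

lemma add_counts_pos: "\<nu> \<in> {1..N} \<Longrightarrow> i \<le> m \<nu> \<Longrightarrow> 0 < add_counts (post a0 x) s \<nu> i"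
  using post_pos[of \<nu> i x] by (auto simp: add_counts_def intro: add_pos_nonneg)

lemma obs_mass_times_prior:
  assumes p: "p \<in> paramD N m"
  shows "obs_lik p x * prior_a N m t a p = obs_coeff x * dir_kernel N m (post t x) p"
proof -
  have "negmult_mass m r \<nu> p (x \<nu>) * (cellprob m p \<nu> 0 powr (t \<nu> - 1) * (\<Prod>i=1..m \<nu>. cellprob m p \<nu> i powr (a \<nu> i - 1)))
     = Gamma (r \<nu> + real (totals x \<nu>)) / (Gamma (r \<nu>) * (\<Prod>i=1..m \<nu>. fact (x \<nu> i)))
        * (\<Prod>i=0..m \<nu>. cellprob m p \<nu> i powr (post t x \<nu> i - 1))" if \<nu>: "\<nu> \<in> {1..N}" for \<nu>
  proof -
    have 1: "(\<Prod>i=1..m \<nu>. cellprob m p \<nu> i ^ x \<nu> i) * (\<Prod>i=1..m \<nu>. cellprob m p \<nu> i powr (a \<nu> i - 1))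
       = (\<Prod>i=1..m \<nu>. cellprob m p \<nu> i powr (post t x \<nu> i - 1))"
      unfolding prod.distrib[symmetric]
    proof (rule prod.cong[OF refl])
      fix i assume "i \<in> {1..m \<nu>}"
      then have "0 < cellprob m p \<nu> i" "i \<noteq> 0" using cellprob_pos[OF p \<nu>, of i] by auto
      then show "cellprob m p \<nu> i ^ x \<nu> i * cellprob m p \<nu> i powr (a \<nu> i - 1) = cellprob m p \<nu> i powr (post t x \<nu> i - 1)"
        by (simp add: powr_realpow[symmetric] powr_add[symmetric] post_def add.assoc[symmetric] diff_add_eq add_diff_eq)
    qed
    have 2: "cellprob m p \<nu> 0 powr r \<nu> * cellprob m p \<nu> 0 powr (t \<nu> - 1) = cellprob m p \<nu> 0 powr (post t x \<nu> 0 - 1)"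
      by (simp add: powr_add[symmetric] post_def add_diff_eq)
    have 3: "(\<Prod>i=0..m \<nu>. cellprob m p \<nu> i powr (post t x \<nu> i - 1))
       = cellprob m p \<nu> 0 powr (post t x \<nu> 0 - 1) * (\<Prod>i=1..m \<nu>. cellprob m p \<nu> i powr (post t x \<nu> i - 1))"
      using prod.atLeast_Suc_atMost[of 0 "m \<nu>" "\<lambda>i. cellprob m p \<nu> i powr (post t x \<nu> i - 1)"] by simp
    show ?thesis unfolding 3 1[symmetric] 2[symmetric] negmult_mass_def obs_total_def by (simp only: mult_ac times_divide_eq_left times_divide_eq_right)
  qed
  then show ?thesis
    unfolding obs_mass_def prior_a_def dir_kernel_def obs_coeff_def prod.distrib[symmetric] by (intro prod.cong) auto
qed

lemma tables_mass_times_kernel: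
  assumes p: "p \<in> paramD N m"
  shows "table_lik p w * dir_kernel N m e p = table_coeff w * dir_kernel N m (add_counts e (counts w)) p"
proof -
  have "cellprob m p \<nu> i ^ counts w \<nu> i * cellprob m p \<nu> i powr (e \<nu> i - 1) = cellprob m p \<nu> i powr (add_counts e (counts w) \<nu> i - 1)"
    if "\<nu> \<in> {1..N}" "i \<in> {0..m \<nu>}" for \<nu> i
    using cellprob_pos[OF p that(1), of i] that(2)
    by (simp add: powr_realpow[symmetric] powr_add[symmetric] add_counts_def algebra_simps)
  then have "(\<Prod>\<nu>=1..N. \<Prod>i=0..m \<nu>. cellprob m p \<nu> i ^ counts w \<nu> i) * dir_kernel N m e p = dir_kernel N m (add_counts e (counts w)) p"
    unfolding dir_kernel_def prod.distrib[symmetric] by (intro prod.cong refl) auto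
  then show ?thesis unfolding tables_mass_eq[OF nu_range] by (simp add: mult.assoc)
qed

lemma dir_kernel_cong:
  assumes "\<And>\<nu> i. \<nu> \<in> {1..N} \<Longrightarrow> i \<le> m \<nu> \<Longrightarrow> e \<nu> i = e' \<nu> i"
  shows "dir_kernel N m e p = dir_kernel N m e' p"
  unfolding dir_kernel_def using assms by (intro prod.cong refl) auto

lemma obs_mass_times_prior_mix:
  assumes p: "p \<in> paramD N m"
  shows "obs_lik p x * mix_prior \<beta> p = obs_coeff x * mixture_kernel N m \<beta> (post a0 x) p"
proof -
  have "obs_lik p x * mix_prior \<beta> p
     = (LBINT u:{0<..}. obs_lik p x * (u powr (1 - 1) * exp (- \<beta> * u) * prior_a N m (\<lambda>\<nu>. 1 * u + a0 \<nu>) a p))"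
    unfolding prior_mix_def prior_a_def by (rule set_integral_mult_right[symmetric])
  also have "\<dots> = (LBINT u:{0<..}. obs_coeff x * (exp (- \<beta> * u) * dir_kernel N m (tilt (post a0 x) u) p))"
  proof (rule set_lebesgue_integral_cong, simp, intro allI impI)
    fix u :: real assume "u \<in> {0<..}"
    then have "u powr (1 - 1) = 1" by simp
    then have "obs_lik p x * (u powr (1 - 1) * exp (- \<beta> * u) * prior_a N m (\<lambda>\<nu>. 1 * u + a0 \<nu>) a p)
      = exp (- \<beta> * u) * (obs_lik p x * prior_a N m (\<lambda>\<nu>. 1 * u + a0 \<nu>) a p)" by simp
    also have "\<dots> = exp (- \<beta> * u) * (obs_coeff x * dir_kernel N m (post (\<lambda>\<nu>. 1 * u + a0 \<nu>) x) p)"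
      unfolding obs_mass_times_prior[OF p] ..
    also have "dir_kernel N m (post (\<lambda>\<nu>. 1 * u + a0 \<nu>) x) p = dir_kernel N m (tilt (post a0 x) u) p"
      by (rule dir_kernel_cong) (auto simp: post_def tilt_def)
    finally show "obs_lik p x * (u powr (1 - 1) * exp (- \<beta> * u) * prior_a N m (\<lambda>\<nu>. 1 * u + a0 \<nu>) a p)
      = obs_coeff x * (exp (- \<beta> * u) * dir_kernel N m (tilt (post a0 x) u) p)" by (simp add: mult_ac)
  qed
  also have "\<dots> = obs_coeff x * mixture_kernel N m \<beta> (post a0 x) p"
    unfolding mixture_kernel_def by (rule set_integral_mult_right)
  finally show ?thesis .
qed

lemma tables_mass_times_mixture_kernel:
  assumes p: "p \<in> paramD N m"
  shows "table_lik p w * mixture_kernel N m \<beta> e p = table_coeff w * mixture_kernel N m \<beta> (add_counts e (counts w)) p"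
proof -
  have eq: "table_lik p w * (exp (- \<beta> * u) * dir_kernel N m (tilt e u) p)
     = table_coeff w * (exp (- \<beta> * u) * dir_kernel N m (tilt (add_counts e (counts w)) u) p)" for u
  proof -
    have "dir_kernel N m (add_counts (tilt e u) (counts w)) p = dir_kernel N m (tilt (add_counts e (counts w)) u) p"
      by (rule dir_kernel_cong) (auto simp: add_counts_def tilt_def)
    then show ?thesis using tables_mass_times_kernel[OF p, of w "tilt e u"] by (simp add: mult_ac)
  qed
  have "table_lik p w * mixture_kernel N m \<beta> e p
      = (LBINT u:{0<..}. table_lik p w * (exp (- \<beta> * u) * dir_kernel N m (tilt e u) p))"
    unfolding mixture_kernel_def by (rule set_integral_mult_right[symmetric])
  also have "\<dots> = table_coeff w * mixture_kernel N m \<beta> (add_counts e (counts w)) p"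
    unfolding eq mixture_kernel_def by (rule set_integral_mult_right)
  finally show ?thesis .
qed

text \<open>
  The dependence on \<open>u\<close> of the Dirichlet constant of the posterior with \<open>a0\<close> shifted by \<open>u\<close>.
\<close>

definition T :: "(nat \<Rightarrow> nat) \<Rightarrow> real \<Rightarrow> real" where
  "T n u = (\<Prod>\<nu>=1..N. Gamma (R \<nu> + u) / Gamma (b \<nu> + real (n \<nu>) + u))"

text \<open>
  The part of the predictive mass that depends on \<open>u\<close>; its value at \<open>u = 0\<close> belongs to the prior without
  mixing.
\<close>

definition odds :: "(nat \<Rightarrow> nat) \<Rightarrow> (nat \<Rightarrow> (nat \<Rightarrow> nat) \<Rightarrow> nat) \<Rightarrow> real \<Rightarrow> real" where
  "odds n w u = (\<Prod>\<nu>=1..N. pochhammer (R \<nu> + u) (counts w \<nu> 0) / pochhammer (b \<nu> + real (n \<nu>) + u) (S \<nu>))"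

definition obs_gamma :: "(nat \<Rightarrow> nat \<Rightarrow> nat) \<Rightarrow> real" where
  "obs_gamma x = (\<Prod>\<nu>=1..N. \<Prod>i=1..m \<nu>. Gamma (real (x \<nu> i) + a \<nu> i))"

definition cell_factor :: "(nat \<Rightarrow> nat \<Rightarrow> nat) \<Rightarrow> (nat \<Rightarrow> (nat \<Rightarrow> nat) \<Rightarrow> nat) \<Rightarrow> real" where
  "cell_factor x w = (\<Prod>\<nu>=1..N. \<Prod>i=1..m \<nu>. pochhammer (real (x \<nu> i) + a \<nu> i) (counts w \<nu> i))"

lemma R_gt_0: "\<nu> \<in> {1..N} \<Longrightarrow> 0 < R \<nu>"
  using R_pos by (simp add: R_def)

lemma R_less_b: "\<nu> \<in> {1..N} \<Longrightarrow> R \<nu> < b \<nu>"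
proof -
  assume "\<nu> \<in> {1..N}"
  then have "0 < (\<Sum>i=1..m \<nu>. a \<nu> i)" using m_pos[of \<nu>] a_pos[of \<nu>] by (intro sum_pos) auto
  then show ?thesis by (simp add: b_def)
qed

lemma b_ge: "\<nu> \<in> {1..N} \<Longrightarrow> 1 \<le> b \<nu>"
  using b_ge_1 by (simp add: b_def R_def)

lemma obs_gamma_pos: "0 < obs_gamma x"
  unfolding obs_gamma_def using a_pos by (intro prod_pos ballI Gamma_real_pos add_nonneg_pos) auto

lemma cell_factor_pos: "0 < cell_factor x w"
  unfolding cell_factor_def using a_pos by (intro prod_pos ballI pochhammer_pos add_nonneg_pos) auto

lemma T_pos:
  assumes "0 \<le> u"
  shows "0 < T n u"
  unfolding T_def
proof (intro prod_pos ballI divide_pos_pos Gamma_real_pos)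
  fix \<nu> assume "\<nu> \<in> {1..N}"
  then show "0 < R \<nu> + u" "0 < b \<nu> + real (n \<nu>) + u" using R_gt_0[of \<nu>] b_ge[of \<nu>] assms by auto
qed

lemma odds_pos:
  assumes "0 \<le> u"
  shows "0 < odds n w u"
  unfolding odds_def
proof (intro prod_pos ballI divide_pos_pos pochhammer_pos)
  fix \<nu> assume "\<nu> \<in> {1..N}"
  then show "0 < R \<nu> + u" "0 < b \<nu> + real (n \<nu>) + u" using R_gt_0[of \<nu>] b_ge[of \<nu>] assms by auto
qed

lemma sum_post:
  "(\<Sum>i=0..m \<nu>. tilt (post a0 x) u \<nu> i) = b \<nu> + real (totals x \<nu>) + u"
proof -
  have "(\<Sum>i=1..m \<nu>. tilt (post a0 x) u \<nu> i) = real (totals x \<nu>) + (\<Sum>i=1..m \<nu>. a \<nu> i)"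
    unfolding obs_total_def of_nat_sum sum.distrib[symmetric]
    by (intro sum.cong) (auto simp: tilt_def post_def)
  then show ?thesis
    by (subst sum.atLeast_Suc_atMost) (auto simp: tilt_def post_def b_def R_def)
qed

lemma dir_const_post:
  "dir_const N m (tilt (post a0 x) u) = obs_gamma x * T (totals x) u"
proof -
  have "(\<Prod>i=0..m \<nu>. Gamma (tilt (post a0 x) u \<nu> i)) / Gamma (\<Sum>i=0..m \<nu>. tilt (post a0 x) u \<nu> i)
      = (\<Prod>i=1..m \<nu>. Gamma (real (x \<nu> i) + a \<nu> i)) * (Gamma (R \<nu> + u) / Gamma (b \<nu> + real (totals x \<nu>) + u))" for \<nu>
  proof -
    have "(\<Prod>i=1..m \<nu>. Gamma (tilt (post a0 x) u \<nu> i)) = (\<Prod>i=1..m \<nu>. Gamma (real (x \<nu> i) + a \<nu> i))"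
      by (intro prod.cong) (auto simp: tilt_def post_def)
    then have "(\<Prod>i=0..m \<nu>. Gamma (tilt (post a0 x) u \<nu> i)) = Gamma (R \<nu> + u) * (\<Prod>i=1..m \<nu>. Gamma (real (x \<nu> i) + a \<nu> i))"
      by (subst prod.atLeast_Suc_atMost) (auto simp: tilt_def post_def R_def)
    then show ?thesis unfolding sum_post by simp
  qed
  then show ?thesis by (simp add: dir_const_def obs_gamma_def T_def prod.distrib prod_dividef)
qed

lemma dir_const_add_counts:
  assumes w: "w \<in> tables" and u: "0 \<le> u"
  shows "dir_const N m (tilt (add_counts (post a0 x) (counts w)) u)
    = obs_gamma x * cell_factor x w * (odds (totals x) w u * T (totals x) u)"
proof -
  let ?e = "tilt (post a0 x) u"
  have e: "tilt (add_counts (post a0 x) (counts w)) u \<nu> i = ?e \<nu> i + real (counts w \<nu> i)" for \<nu> i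
    by (simp add: tilt_def add_counts_def)
  have "(\<Prod>i=0..m \<nu>. Gamma (?e \<nu> i + real (counts w \<nu> i))) / Gamma (\<Sum>i=0..m \<nu>. ?e \<nu> i + real (counts w \<nu> i))
      = (\<Prod>i=0..m \<nu>. Gamma (?e \<nu> i)) / Gamma (\<Sum>i=0..m \<nu>. ?e \<nu> i)
        * ((\<Prod>i=1..m \<nu>. pochhammer (real (x \<nu> i) + a \<nu> i) (counts w \<nu> i))
           * (pochhammer (R \<nu> + u) (counts w \<nu> 0) / pochhammer (b \<nu> + real (totals x \<nu>) + u) (S \<nu>)))"
    if \<nu>: "\<nu> \<in> {1..N}" for \<nu>
  proof -
    have sum: "(\<Sum>i=0..m \<nu>. ?e \<nu> i + real (counts w \<nu> i)) = b \<nu> + real (totals x \<nu>) + u + real (S \<nu>)"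
    proof -
      have "(\<Sum>i=0..m \<nu>. ?e \<nu> i + real (counts w \<nu> i)) = (\<Sum>i=0..m \<nu>. ?e \<nu> i) + real (\<Sum>i=0..m \<nu>. counts w \<nu> i)"
        by (simp only: sum.distrib of_nat_sum)
      then show ?thesis unfolding sum_post sum_cell_count[OF nu_inj w] by (simp add: S_def)
    qed
    have "0 < b \<nu> + real (totals x \<nu>) + u" using b_ge[OF \<nu>] u by simp
    then have den: "Gamma (\<Sum>i=0..m \<nu>. ?e \<nu> i + real (counts w \<nu> i))
       = pochhammer (b \<nu> + real (totals x \<nu>) + u) (S \<nu>) * Gamma (\<Sum>i=0..m \<nu>. ?e \<nu> i)"
      unfolding sum sum_post by (rule Gamma_add_nat)
    have "(\<Prod>i=0..m \<nu>. Gamma (?e \<nu> i + real (counts w \<nu> i))) = (\<Prod>i=0..m \<nu>. pochhammer (?e \<nu> i) (counts w \<nu> i) * Gamma (?e \<nu> i))"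
      using \<nu> u by (intro prod.cong Gamma_add_nat tilt_pos[of N m "post a0 x"] post_pos) auto
    moreover have "(\<Prod>i=0..m \<nu>. pochhammer (?e \<nu> i) (counts w \<nu> i))
        = pochhammer (R \<nu> + u) (counts w \<nu> 0) * (\<Prod>i=1..m \<nu>. pochhammer (real (x \<nu> i) + a \<nu> i) (counts w \<nu> i))"
    proof -
      have "(\<Prod>i=1..m \<nu>. pochhammer (?e \<nu> i) (counts w \<nu> i)) = (\<Prod>i=1..m \<nu>. pochhammer (real (x \<nu> i) + a \<nu> i) (counts w \<nu> i))"
        by (intro prod.cong) (auto simp: tilt_def post_def)
      then show ?thesis by (subst prod.atLeast_Suc_atMost) (auto simp: tilt_def post_def R_def)
    qed
    ultimately show ?thesis unfolding den by (simp add: prod.distrib mult_ac)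
  qed
  then have "dir_const N m (tilt (add_counts (post a0 x) (counts w)) u)
      = dir_const N m ?e * (cell_factor x w * odds (totals x) w u)"
    unfolding dir_const_def cell_factor_def odds_def prod.distrib[symmetric] e by (intro prod.cong) auto
  then show ?thesis unfolding dir_const_post by (simp add: mult_ac)
qed

lemma tilt_0: "tilt e 0 = e"
  by (simp add: tilt_def fun_eq_iff)

lemma base_integrals:
  shows "integrable_D (\<lambda>p. table_lik p w * obs_lik p x * base_prior p)"
    and "(LINT p:paramD N m|lebP N m. table_lik p w * obs_lik p x * base_prior p)
      = table_coeff w * obs_coeff x * dir_const N m (add_counts (post a0 x) (counts w))"
    and "(LINT p:paramD N m|lebP N m. obs_lik p x * base_prior p)
      = obs_coeff x * dir_const N m (post a0 x)"
proof -
  have eq: "table_lik p w * obs_lik p x * base_prior p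
      = table_coeff w * obs_coeff x * dir_kernel N m (add_counts (post a0 x) (counts w)) p" if p: "p \<in> paramD N m" for p
    unfolding mult.assoc obs_mass_times_prior[OF p]
    by (metis mult.left_commute tables_mass_times_kernel[OF p])
  have K: "integrable_D (dir_kernel N m (add_counts (post a0 x) (counts w)))"
    "(LINT p:paramD N m|lebP N m. dir_kernel N m (add_counts (post a0 x) (counts w)) p) = dir_const N m (add_counts (post a0 x) (counts w))"
    by (rule integral_dir_kernel, rule add_counts_pos, assumption+)+
  have K0: "(LINT p:paramD N m|lebP N m. dir_kernel N m (post a0 x) p) = dir_const N m (post a0 x)"
    by (rule integral_dir_kernel, rule post_pos, assumption+)
  show "integrable_D (\<lambda>p. table_lik p w * obs_lik p x * base_prior p)"
  proof -
    have "integrable_D (\<lambda>p. table_coeff w * obs_coeff x * dir_kernel N m (add_counts (post a0 x) (counts w)) p)"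
      by (intro set_integrable_mult_right K)
    then show ?thesis by (subst set_integrable_cong[OF refl refl eq])
  qed
  have "(LINT p:paramD N m|lebP N m. table_lik p w * obs_lik p x * base_prior p)
      = (LINT p:paramD N m|lebP N m. table_coeff w * obs_coeff x * dir_kernel N m (add_counts (post a0 x) (counts w)) p)"
    by (intro set_lebesgue_integral_cong paramD_sets allI impI eq)
  then show "(LINT p:paramD N m|lebP N m. table_lik p w * obs_lik p x * base_prior p)
      = table_coeff w * obs_coeff x * dir_const N m (add_counts (post a0 x) (counts w))"
    by (simp add: K)
  have "(LINT p:paramD N m|lebP N m. obs_lik p x * base_prior p)
      = (LINT p:paramD N m|lebP N m. obs_coeff x * dir_kernel N m (post a0 x) p)"
    by (intro set_lebesgue_integral_cong paramD_sets allI impI obs_mass_times_prior)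
  then show "(LINT p:paramD N m|lebP N m. obs_lik p x * base_prior p) = obs_coeff x * dir_const N m (post a0 x)"
    by (simp add: K0)
qed

lemma bayes_prior_a_eq:
  assumes w: "w \<in> tables"
  shows "bayes base_prior w x = table_coeff w * cell_factor x w * odds (totals x) w 0"
proof -
  have "0 < obs_coeff x" "0 < obs_gamma x" "0 < T (totals x) 0"
    by (auto intro: obs_coeff_pos obs_gamma_pos T_pos)
  then show ?thesis
    using dir_const_add_counts[OF w, of 0 x] dir_const_post[of x 0]
    unfolding bayes_predictive_def base_integrals by (simp add: tilt_0)
qed

lemma cell_count_0_le:
  assumes "w \<in> tables"
  shows "counts w \<nu> 0 \<le> S \<nu>"
proof -
  have "counts w \<nu> 0 \<le> (\<Sum>i=0..m \<nu>. counts w \<nu> i)" by (rule member_le_sum) auto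
  then show ?thesis unfolding sum_cell_count[OF nu_inj assms] S_def .
qed

lemma odds_le_1:
  assumes w: "w \<in> tables" and u: "0 \<le> u"
  shows "odds n w u \<le> 1"
  unfolding odds_def
proof (rule prod_le_1)
  fix \<nu> assume \<nu>: "\<nu> \<in> {1..N}"
  define B where "B = b \<nu> + real (n \<nu>) + u"
  have B1: "1 \<le> B" using b_ge[OF \<nu>] u by (simp add: B_def)
  have R0: "0 < R \<nu> + u" using R_gt_0[OF \<nu>] u by simp
  have RB: "R \<nu> + u \<le> B" using R_less_b[OF \<nu>] by (simp add: B_def)
  have "pochhammer (R \<nu> + u) (counts w \<nu> 0) \<le> pochhammer B (counts w \<nu> 0)"
    unfolding pochhammer_prod using R0 RB by (intro prod_mono) auto
  also have "\<dots> * 1 \<le> pochhammer B (counts w \<nu> 0) * pochhammer (B + real (counts w \<nu> 0)) (S \<nu> - counts w \<nu> 0)"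
    using B1 unfolding pochhammer_prod by (intro mult_left_mono prod_ge_1 prod_nonneg) auto
  then have "pochhammer B (counts w \<nu> 0) \<le> pochhammer B (S \<nu>)"
    using pochhammer_product[OF cell_count_0_le[OF w], of B \<nu>] by simp
  finally show "0 \<le> pochhammer (R \<nu> + u) (counts w \<nu> 0) / pochhammer (b \<nu> + real (n \<nu>) + u) (S \<nu>) \<and>
      pochhammer (R \<nu> + u) (counts w \<nu> 0) / pochhammer (b \<nu> + real (n \<nu>) + u) (S \<nu>) \<le> 1"
    unfolding B_def[symmetric] using pochhammer_pos[OF R0, of "counts w \<nu> 0"] pochhammer_pos[of B "S \<nu>"] B1 by simp
qed

lemma tilted_exponential_T:
  assumes "0 < \<beta>"
  shows "tilted_exponential \<beta> (T n)"
proof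
  show "0 < \<beta>" by fact
  show "0 < T n u" if "0 \<le> u" for u using that by (rule T_pos)
  show "T n v \<le> T n u" if u: "0 \<le> u" "u \<le> v" for u v
    unfolding T_def
  proof (rule prod_mono)
    fix \<nu> assume \<nu>: "\<nu> \<in> {1..N}"
    define \<delta> where "\<delta> = b \<nu> - R \<nu> + real (n \<nu>)"
    have eq: "b \<nu> + real (n \<nu>) + z = R \<nu> + z + \<delta>" for z by (simp add: \<delta>_def)
    have \<delta>: "0 < \<delta>" using R_less_b[OF \<nu>] by (simp add: \<delta>_def)
    have "0 < R \<nu> + u" using R_gt_0[OF \<nu>] u by simp
    then have "Gamma (R \<nu> + v) / Gamma (R \<nu> + v + \<delta>) \<le> Gamma (R \<nu> + u) / Gamma (R \<nu> + u + \<delta>)"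
      using \<delta> u by (intro Gamma_ratio_antimono) auto
    moreover have "0 < Gamma (R \<nu> + v) / Gamma (R \<nu> + v + \<delta>)"
      using \<open>0 < R \<nu> + u\<close> \<delta> u by (intro divide_pos_pos Gamma_real_pos) auto
    ultimately show "0 \<le> Gamma (R \<nu> + v) / Gamma (b \<nu> + real (n \<nu>) + v) \<and>
      Gamma (R \<nu> + v) / Gamma (b \<nu> + real (n \<nu>) + v) \<le> Gamma (R \<nu> + u) / Gamma (b \<nu> + real (n \<nu>) + u)"
      unfolding eq by simp
  qed
  show "continuous_on {0<..} (T n)"
    unfolding T_def
  proof (intro continuous_on_prod continuous_on_divide continuous_on_Gamma_shift ballI)
    fix \<nu> assume \<nu>: "\<nu> \<in> {1..N}"
    show "0 \<le> R \<nu>" using R_gt_0[OF \<nu>] by simp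
    show "0 \<le> b \<nu> + real (n \<nu>)" using b_ge[OF \<nu>] by simp
    fix u :: real assume u: "u \<in> {0<..}"
    have "0 < b \<nu> + real (n \<nu>) + u" using b_ge[OF \<nu>] u by simp
    then show "Gamma (b \<nu> + real (n \<nu>) + u) \<noteq> 0" by (intro less_imp_neq[symmetric] Gamma_real_pos)
  qed
qed

abbreviation wt :: "real \<Rightarrow> (nat \<Rightarrow> nat) \<Rightarrow> real \<Rightarrow> real" where
  "wt \<beta> n \<equiv> tilted_exponential.wt \<beta> (T n)"
abbreviation mom :: "real \<Rightarrow> (nat \<Rightarrow> nat) \<Rightarrow> nat \<Rightarrow> real" where
  "mom \<beta> n \<equiv> tilted_exponential.mom \<beta> (T n)"

lemma odds_measurable [measurable]: "odds n w \<in> borel_measurable borel"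
  unfolding odds_def[abs_def] pochhammer_prod by measurable

lemma integrable_odds_wt:
  assumes "w \<in> tables" "0 < \<beta>"
  shows "integrable lborel (\<lambda>u. odds n w u * wt \<beta> n u)"
proof -
  interpret P: tilted_exponential \<beta> "T n" by (rule tilted_exponential_T[OF assms(2)])
  show ?thesis
  proof (rule Bochner_Integration.integrable_bound[OF P.integrable_mom[of 0]])
    show "AE u in lborel. norm (odds n w u * wt \<beta> n u) \<le> norm (u ^ 0 * wt \<beta> n u)"
    proof (rule AE_I2)
      fix u :: real
      show "norm (odds n w u * wt \<beta> n u) \<le> norm (u ^ 0 * wt \<beta> n u)"
      proof (cases "0 < u")
        case True
        then show ?thesis using odds_le_1[OF assms(1), of u n] odds_pos[of u n w] P.wt_nonneg[of u]
          by (simp add: abs_mult mult_left_le_one_le)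
      qed (simp add: P.wt_def)
    qed
  qed measurable
qed

lemma mixture_integrals:
  assumes w: "w \<in> tables" and \<beta>: "0 < \<beta>"
  shows "integrable_D
      (\<lambda>p. table_lik p w * obs_lik p x * mix_prior \<beta> p)" (is ?th1)
    and "(LINT p:paramD N m|lebP N m. table_lik p w * obs_lik p x * mix_prior \<beta> p)
      = table_coeff w * obs_coeff x * (obs_gamma x * cell_factor x w * (LBINT u. odds (totals x) w u * wt \<beta> (totals x) u))" (is ?th2)
    and "(LINT p:paramD N m|lebP N m. obs_lik p x * mix_prior \<beta> p)
      = obs_coeff x * (obs_gamma x * mom \<beta> (totals x) 0)" (is ?th3)
proof -
  interpret P: tilted_exponential \<beta> "T (totals x)" by (rule tilted_exponential_T[OF \<beta>])
  let ?e = "add_counts (post a0 x) (counts w)"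
  let ?\<pi> = "mix_prior \<beta>"
  have eq: "table_lik p w * obs_lik p x * ?\<pi> p
      = table_coeff w * obs_coeff x * mixture_kernel N m \<beta> ?e p" if p: "p \<in> paramD N m" for p
    unfolding mult.assoc obs_mass_times_prior_mix[OF p]
    by (metis mult.left_commute tables_mass_times_mixture_kernel[OF p])
  have 1: "indicator {0<..} u *\<^sub>R (exp (- \<beta> * u) * dir_const N m (tilt ?e u))
      = obs_gamma x * cell_factor x w * (odds (totals x) w u * wt \<beta> (totals x) u)" for u
    using dir_const_add_counts[OF w, of u x] by (auto simp: P.wt_def indicator_def)
  have 2: "indicator {0<..} u *\<^sub>R (exp (- \<beta> * u) * dir_const N m (tilt (post a0 x) u))
      = obs_gamma x * (u ^ 0 * wt \<beta> (totals x) u)" for u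
    using dir_const_post[of x u] by (auto simp: P.wt_def indicator_def)
  have int1: "set_integrable lborel {0<..} (\<lambda>u. exp (- \<beta> * u) * dir_const N m (tilt ?e u))"
    unfolding set_integrable_def 1 by (intro integrable_mult_right integrable_odds_wt w \<beta>)
  have int2: "set_integrable lborel {0<..} (\<lambda>u. exp (- \<beta> * u) * dir_const N m (tilt (post a0 x) u))"
    unfolding set_integrable_def 2 by (intro integrable_mult_right P.integrable_mom)
  have M: "integrable_D (mixture_kernel N m \<beta> ?e)"
    "(LINT p:paramD N m|lebP N m. mixture_kernel N m \<beta> ?e p) = (LBINT u:{0<..}. exp (- \<beta> * u) * dir_const N m (tilt ?e u))"
    by (rule integral_mixture_kernel[OF add_counts_pos \<beta> int1], assumption+)+
  have M0: "(LINT p:paramD N m|lebP N m. mixture_kernel N m \<beta> (post a0 x) p)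
      = (LBINT u:{0<..}. exp (- \<beta> * u) * dir_const N m (tilt (post a0 x) u))"
    by (rule integral_mixture_kernel[OF post_pos \<beta> int2], assumption+)
  have "integrable_D (\<lambda>p. table_coeff w * obs_coeff x * mixture_kernel N m \<beta> ?e p)"
    by (intro set_integrable_mult_right M)
  then show ?th1 by (subst set_integrable_cong[OF refl refl eq])
  have "(LINT p:paramD N m|lebP N m. table_lik p w * obs_lik p x * ?\<pi> p)
      = (LINT p:paramD N m|lebP N m. table_coeff w * obs_coeff x * mixture_kernel N m \<beta> ?e p)"
    by (intro set_lebesgue_integral_cong paramD_sets allI impI eq)
  also have "\<dots> = table_coeff w * obs_coeff x * (LBINT u. obs_gamma x * cell_factor x w * (odds (totals x) w u * wt \<beta> (totals x) u))"
    unfolding set_integral_mult_right M(2) unfolding set_lebesgue_integral_def 1 ..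
  finally show ?th2 by simp
  have "(LINT p:paramD N m|lebP N m. obs_lik p x * ?\<pi> p)
      = (LINT p:paramD N m|lebP N m. obs_coeff x * mixture_kernel N m \<beta> (post a0 x) p)"
    by (intro set_lebesgue_integral_cong paramD_sets allI impI obs_mass_times_prior_mix)
  also have "\<dots> = obs_coeff x * (LBINT u. obs_gamma x * (u ^ 0 * wt \<beta> (totals x) u))"
    unfolding set_integral_mult_right M0 unfolding set_lebesgue_integral_def 2 ..
  finally show ?th3 unfolding integral_mult_right_zero P.mom_def .
qed

lemma bayes_prior_mix_eq:
  assumes w: "w \<in> tables" and \<beta>: "0 < \<beta>"
  shows "bayes (mix_prior \<beta>) w x
    = table_coeff w * cell_factor x w * ((LBINT u. odds (totals x) w u * wt \<beta> (totals x) u) / mom \<beta> (totals x) 0)"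
proof -
  have "0 < obs_coeff x" "0 < obs_gamma x" by (auto intro: obs_coeff_pos obs_gamma_pos)
  then show ?thesis
    unfolding bayes_predictive_def mixture_integrals[OF w \<beta>] by simp
qed

text \<open>
  The masses of the tables sum to \<open>1\<close> for every \<open>p\<close>, hence so do their posterior means.
\<close>

lemma predictive_mass_bayes:
  assumes int: "\<And>x w. x \<in> obsX N m \<Longrightarrow> w \<in> tables \<Longrightarrow>
      integrable_D (\<lambda>p. table_lik p w * obs_lik p x * \<pi> p)"
    and nz: "\<And>x. (LINT p:paramD N m|lebP N m. obs_lik p x * \<pi> p) \<noteq> 0"
    and nonneg: "\<And>x w. w \<in> tables \<Longrightarrow> 0 \<le> bayes \<pi> w x"
  shows "predictive_mass N m L d l nu (bayes \<pi>)"
  unfolding predictive_mass_def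
proof (intro ballI conjI nonneg)
  fix x assume x: "x \<in> obsX N m"
  have "(\<Sum>w\<in>tables. LINT p:paramD N m|lebP N m. table_lik p w * obs_lik p x * \<pi> p)
      = (LINT p|lebP N m. (\<Sum>w\<in>tables. indicator (paramD N m) p *\<^sub>R (table_lik p w * obs_lik p x * \<pi> p)))"
    unfolding set_lebesgue_integral_def
    by (rule Bochner_Integration.integral_sum[symmetric]) (use int[OF x] in \<open>simp add: set_integrable_def\<close>)
  also have "\<dots> = (LINT p:paramD N m|lebP N m. obs_lik p x * \<pi> p)"
    unfolding set_lebesgue_integral_def
  proof (rule Bochner_Integration.integral_cong[OF refl])
    fix p
    have "(\<Sum>w\<in>tables. indicator (paramD N m) p *\<^sub>R (table_lik p w * obs_lik p x * \<pi> p))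
        = (\<Sum>w\<in>tables. table_lik p w) * (indicator (paramD N m) p *\<^sub>R (obs_lik p x * \<pi> p))"
      unfolding sum_distrib_right by (intro sum.cong) (auto simp: mult_ac)
    then show "(\<Sum>w\<in>tables. indicator (paramD N m) p *\<^sub>R (table_lik p w * obs_lik p x * \<pi> p))
        = indicator (paramD N m) p *\<^sub>R (obs_lik p x * \<pi> p)" by (simp add: sum_tables_mass)
  qed
  finally show "(\<Sum>w\<in>tables. bayes \<pi> w x) = 1"
    using nz[of x] unfolding bayes_predictive_def sum_divide_distrib[symmetric] by simp
qed auto

end

section \<open>Comparison of the risks\<close>

lemma integrable_Times_finite:
  fixes F :: "'a \<Rightarrow> 'b \<Rightarrow> real"
  assumes A: "countable A" and B: "finite B"
    and int: "\<And>w. w \<in> B \<Longrightarrow> integrable (count_space A) (\<lambda>x. F x w)"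
  shows "integrable (count_space (A \<times> B)) (\<lambda>(x, w). F x w)"
    and "(LINT z|count_space (A \<times> B). (case z of (x, w) \<Rightarrow> F x w)) = (LINT x|count_space A. (\<Sum>w\<in>B. F x w))"
proof -
  have "integrable (count_space A) (\<lambda>x. \<Sum>w\<in>B. \<bar>F x w\<bar>)"
    by (intro Bochner_Integration.integrable_sum integrable_abs int)
  then have abs: "Infinite_Set_Sum.abs_summable_on (\<lambda>(x, w). F x w) (A \<times> B)"
    using A B by (subst abs_summable_on_Sigma_iff) (auto simp: Infinite_Set_Sum.abs_summable_on_def countable_finite integrable_count_space)
  then show "integrable (count_space (A \<times> B)) (\<lambda>(x, w). F x w)"
    by (simp add: Infinite_Set_Sum.abs_summable_on_def)
  show "(LINT z|count_space (A \<times> B). (case z of (x, w) \<Rightarrow> F x w)) = (LINT x|count_space A. (\<Sum>w\<in>B. F x w))"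
    using infsetsum_Times[OF A countable_finite[OF B] abs] B by (simp add: infsetsum_def[of _ A] infsetsum_def[of _ "A \<times> B"])
qed

lemma ereal_expectation_ereal:
  assumes "integrable M h"
  shows "ereal_expectation M (\<lambda>z. ereal (h z)) = ereal (integral\<^sup>L M h)"
proof -
  have fin: "(\<integral>\<^sup>+z. ennreal (h z) \<partial>M) \<noteq> \<infinity>" "(\<integral>\<^sup>+z. ennreal (- h z) \<partial>M) \<noteq> \<infinity>"
    using assms by (auto simp: real_integrable_def)
  then show ?thesis
    unfolding ereal_expectation_def real_lebesgue_integral_def[OF assms]
    by (cases "\<integral>\<^sup>+z. ennreal (h z) \<partial>M"; cases "\<integral>\<^sup>+z. ennreal (- h z) \<partial>M") (auto simp: enn2ereal_ennreal)
qed

text \<open>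
  With an integrable loss the two parts of \<open>ereal_expectation\<close> are finite, and the risk is an ordinary
  sum over observations and tables.
\<close>

lemma KL_risk_eq_integral:
  assumes p: "p \<in> paramD N m" and r: "\<forall>\<nu>\<in>{1..N}. 0 < r \<nu>"
    and f: "\<And>w. w \<in> tablesW m L d l nu \<Longrightarrow> 0 < tables_mass m L d l nu p w"
    and fh: "\<And>x w. x \<in> obsX N m \<Longrightarrow> w \<in> tablesW m L d l nu \<Longrightarrow> 0 < fh w x"
    and int: "\<And>w. w \<in> tablesW m L d l nu \<Longrightarrow> integrable (count_space (obsX N m))
        (\<lambda>x. obs_mass N m r p x * ln (tables_mass m L d l nu p w / fh w x))"
  shows "KL_risk N m r L d l nu fh p = ereal (LINT x|count_space (obsX N m).
      (\<Sum>w\<in>tablesW m L d l nu. tables_mass m L d l nu p w * (obs_mass N m r p x * ln (tables_mass m L d l nu p w / fh w x))))"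
proof -
  let ?A = "obsX N m \<times> tablesW m L d l nu"
  define \<rho> where "\<rho> = (\<lambda>(x, w). obs_mass N m r p x * tables_mass m L d l nu p w)"
  define h where "h = (\<lambda>(x, w). ln (tables_mass m L d l nu p w / fh w x))"
  have law: "joint_law N m r L d l nu p = density (count_space ?A) (\<lambda>z. ennreal (\<rho> z))"
    unfolding joint_law_def point_measure_def \<rho>_def by (rule arg_cong[where f = "density _"]) auto
  have \<rho>: "AE z in count_space ?A. 0 \<le> \<rho> z"
    using obs_mass_pos[OF p r] f by (auto simp: AE_count_space \<rho>_def less_imp_le)
  let ?F = "\<lambda>x w. tables_mass m L d l nu p w * (obs_mass N m r p x * ln (tables_mass m L d l nu p w / fh w x))"
  have eqF: "(\<lambda>z. \<rho> z *\<^sub>R h z) = (\<lambda>(x, w). ?F x w)" by (auto simp: fun_eq_iff \<rho>_def h_def)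
  have F: "integrable (count_space ?A) (\<lambda>(x, w). ?F x w)"
    "(LINT z|count_space ?A. (case z of (x, w) \<Rightarrow> ?F x w)) = (LINT x|count_space (obsX N m). (\<Sum>w\<in>tablesW m L d l nu. ?F x w))"
    by (rule integrable_Times_finite[OF countable_obsX finite_tablesW], intro integrable_mult_right int, assumption)+
  have "integrable (count_space ?A) (\<lambda>z. \<rho> z *\<^sub>R h z)" unfolding eqF by (rule F)
  then have hint: "integrable (joint_law N m r L d l nu p) h"
    unfolding law by (subst integrable_density[OF _ _ \<rho>]) simp_all
  have "KL_risk N m r L d l nu fh p = ereal_expectation (joint_law N m r L d l nu p) (\<lambda>z. ereal (h z))"
  proof -
    have "(case z of (x, w) \<Rightarrow> log_ratio (tables_mass m L d l nu p w) (fh w x)) = ereal (h z)"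
      if "z \<in> space (joint_law N m r L d l nu p)" for z
      using that fh[of "fst z" "snd z"] by (auto simp: law log_ratio_def h_def)
    then show ?thesis unfolding KL_risk_def ereal_expectation_def
      by (intro arg_cong2[where f = "(-)"] arg_cong[where f = enn2ereal] nn_integral_cong) auto
  qed
  also have "\<dots> = ereal (integral\<^sup>L (joint_law N m r L d l nu p) h)"
    by (rule ereal_expectation_ereal[OF hint])
  also have "integral\<^sup>L (joint_law N m r L d l nu p) h = (LINT z|count_space ?A. \<rho> z *\<^sub>R h z)"
    unfolding law by (rule integral_density[OF _ _ \<rho>]) auto
  finally show ?thesis unfolding eqF F .
qed

lemma paramD_nonempty: "paramD N m \<noteq> {}"
proof -
  have "(\<lambda>\<nu>\<in>{1..N}. \<lambda>i\<in>{1..m \<nu>}. 1 / (real (m \<nu>) + 1)) \<in> paramD N m"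
    by (auto simp: paramD_def simplexD_def)
  then show ?thesis by blast
qed

context posterior_setting
begin

definition base_predictor :: "predictor" where "base_predictor = bayes base_prior"
definition mixture_predictor :: "real \<Rightarrow> predictor" where
  "mixture_predictor \<beta> = bayes (mix_prior \<beta>)"

text \<open>
  The largest factor \<open>R \<nu> + j\<close> with \<open>j < S \<nu>\<close>. The domination rests on \<open>c \<nu> < r \<nu> - 1\<close>.
\<close>

definition c :: "nat \<Rightarrow> real" where "c \<nu> = R \<nu> + real (S \<nu>) - 1"

text \<open>
  The slope \<open>1 / c\<close> of \<open>ln (1 + u / c)\<close>, reduced by the second-order term \<open>u\<^sup>2 / c\<^sup>2\<close> with the second moment
  bounded by \<open>2 / \<beta>\<close> times the first.
\<close>

definition \<kappa> :: "real \<Rightarrow> nat \<Rightarrow> real" where "\<kappa> \<beta> \<nu> = 1 / c \<nu> - 2 / \<beta> / (c \<nu>)\<^sup>2"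
definition tilt_mean :: "real \<Rightarrow> (nat \<Rightarrow> nat) \<Rightarrow> real" where "tilt_mean \<beta> n = mom \<beta> n 1 / mom \<beta> n 0"

text \<open>
  The coefficient of \<open>tilt_mean\<close> in the lower bound for the logarithm of the ratio of the two predictive
  masses.
\<close>

definition gain :: "real \<Rightarrow> (nat \<Rightarrow> nat) \<Rightarrow> (nat \<Rightarrow> (nat \<Rightarrow> nat) \<Rightarrow> nat) \<Rightarrow> real" where
  "gain \<beta> n w = (\<Sum>\<nu>=1..N. real (counts w \<nu> 0) * \<kappa> \<beta> \<nu> - real (S \<nu>) / (b \<nu> + real (n \<nu>)))"

lemma base_eq: "w \<in> tables \<Longrightarrow> base_predictor w x = table_coeff w * cell_factor x w * odds (totals x) w 0"
  unfolding base_predictor_def by (rule bayes_prior_a_eq)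

lemma base_pos: "w \<in> tables \<Longrightarrow> 0 < base_predictor w x"
  by (simp add: base_eq tables_coeff_pos cell_factor_pos odds_pos)

lemma odds_lower:
  assumes w: "w \<in> tables" and u: "0 \<le> u"
  shows "odds n w 0 * exp ((\<Sum>\<nu>=1..N. real (counts w \<nu> 0) / c \<nu> - real (S \<nu>) / (b \<nu> + real (n \<nu>))) * u
      - (\<Sum>\<nu>=1..N. real (counts w \<nu> 0) / (c \<nu>)\<^sup>2) * u\<^sup>2) \<le> odds n w u"
proof -
  let ?t = "\<lambda>\<nu>. real (counts w \<nu> 0) * (u / c \<nu> - (u / c \<nu>)\<^sup>2) - real (S \<nu>) * (u / (b \<nu> + real (n \<nu>)))"
  have exponent: "(\<Sum>\<nu>=1..N. real (counts w \<nu> 0) / c \<nu> - real (S \<nu>) / (b \<nu> + real (n \<nu>))) * u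
      - (\<Sum>\<nu>=1..N. real (counts w \<nu> 0) / (c \<nu>)\<^sup>2) * u\<^sup>2 = (\<Sum>\<nu>=1..N. ?t \<nu>)"
    unfolding sum_distrib_right sum_subtractf[symmetric]
    by (intro sum.cong refl) (simp add: algebra_simps power_divide)
  have "odds n w 0 * exp ((\<Sum>\<nu>=1..N. real (counts w \<nu> 0) / c \<nu> - real (S \<nu>) / (b \<nu> + real (n \<nu>))) * u
      - (\<Sum>\<nu>=1..N. real (counts w \<nu> 0) / (c \<nu>)\<^sup>2) * u\<^sup>2)
     = (\<Prod>\<nu>=1..N. pochhammer (R \<nu>) (counts w \<nu> 0) / pochhammer (b \<nu> + real (n \<nu>)) (S \<nu>) * exp (?t \<nu>))"
    unfolding exponent exp_sum[OF finite_atLeastAtMost] prod.distrib odds_def by (simp only: add_0_right)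
  also have "\<dots> \<le> odds n w u"
    unfolding odds_def
  proof (rule prod_mono)
    fix \<nu> assume \<nu>: "\<nu> \<in> {1..N}"
    define B where "B = b \<nu> + real (n \<nu>)"
    have B: "0 < B" using b_ge[OF \<nu>] by (simp add: B_def)
    have R0: "0 < R \<nu>" by (rule R_gt_0[OF \<nu>])
    let ?s = "counts w \<nu> 0"
    have 1: "pochhammer (R \<nu>) ?s * exp (real ?s * (u / c \<nu> - (u / c \<nu>)\<^sup>2)) \<le> pochhammer (R \<nu> + u) ?s"
      by (rule pochhammer_shift_lower[OF R0 u cell_count_0_le[OF w] c_def])
    have 2: "pochhammer (B + u) (S \<nu>) \<le> pochhammer B (S \<nu>) * exp (real (S \<nu>) * (u / B))"
      by (rule pochhammer_shift_upper[OF B u])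
    have "pochhammer (R \<nu>) ?s / pochhammer B (S \<nu>) * exp (?t \<nu>)
        = pochhammer (R \<nu>) ?s * exp (real ?s * (u / c \<nu> - (u / c \<nu>)\<^sup>2)) / (pochhammer B (S \<nu>) * exp (real (S \<nu>) * (u / B)))"
      by (simp add: B_def exp_diff)
    also have "\<dots> \<le> pochhammer (R \<nu> + u) ?s / pochhammer (B + u) (S \<nu>)"
      using 1 2 B u R0 by (intro frac_le) (auto intro!: pochhammer_pos less_imp_le)
    finally show "0 \<le> pochhammer (R \<nu>) ?s / pochhammer (b \<nu> + real (n \<nu>)) (S \<nu>) * exp (?t \<nu>) \<and>
        pochhammer (R \<nu>) ?s / pochhammer (b \<nu> + real (n \<nu>)) (S \<nu>) * exp (?t \<nu>)
          \<le> pochhammer (R \<nu> + u) ?s / pochhammer (b \<nu> + real (n \<nu>) + u) (S \<nu>)"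
      using B R0 pochhammer_pos[OF B, of "S \<nu>"] pochhammer_pos[OF R0, of ?s] by (simp add: B_def)
  qed
  finally show ?thesis .
qed

text \<open>
  The ratio of the two predictive masses is the mean of \<open>odds u / odds 0\<close> under the tilted exponential law,
  so the bound follows from the previous lemma and Jensen's inequality.
\<close>

lemma mixture_ge:
  assumes w: "w \<in> tables" and \<beta>: "0 < \<beta>"
  shows "base_predictor w x * exp (tilt_mean \<beta> (totals x) * gain \<beta> (totals x) w) \<le> mixture_predictor \<beta> w x"
proof -
  let ?n = "totals x"
  interpret P: tilted_exponential \<beta> "T ?n" by (rule tilted_exponential_T[OF \<beta>])
  define A where "A = (\<Sum>\<nu>=1..N. real (counts w \<nu> 0) / c \<nu> - real (S \<nu>) / (b \<nu> + real (?n \<nu>)))"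
  define B where "B = (\<Sum>\<nu>=1..N. real (counts w \<nu> 0) / (c \<nu>)\<^sup>2)"
  have o0: "0 < odds ?n w 0" by (rule odds_pos) simp
  have gain: "A - B * (2 / \<beta>) = gain \<beta> ?n w"
    unfolding A_def B_def gain_def \<kappa>_def sum_distrib_right sum_subtractf[symmetric]
    by (intro sum.cong refl) (simp add: algebra_simps)
  have "exp ((A - B * (2 / \<beta>)) * (mom \<beta> ?n 1 / mom \<beta> ?n 0)) \<le> (LBINT u. odds ?n w u / odds ?n w 0 * wt \<beta> ?n u) / mom \<beta> ?n 0"
  proof (rule P.exp_le_weighted_mean)
    show "integrable lborel (\<lambda>u. odds ?n w u / odds ?n w 0 * wt \<beta> ?n u)"
      using integrable_mult_right[OF integrable_odds_wt[OF w \<beta>, of ?n], of "1 / odds ?n w 0"] by simp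
    show "exp (A * u - B * u\<^sup>2) \<le> odds ?n w u / odds ?n w 0" if "0 < u" for u
      using odds_lower[OF w, of u ?n] that o0 by (simp add: A_def B_def field_simps)
    show "0 \<le> B" unfolding B_def by (intro sum_nonneg) auto
  qed
  also have "(LBINT u. odds ?n w u / odds ?n w 0 * wt \<beta> ?n u) = (LBINT u. odds ?n w u * wt \<beta> ?n u) / odds ?n w 0"
    by simp
  also have "(A - B * (2 / \<beta>)) * (mom \<beta> ?n 1 / mom \<beta> ?n 0) = tilt_mean \<beta> ?n * gain \<beta> ?n w"
    unfolding gain tilt_mean_def by (rule mult.commute)
  finally have "odds ?n w 0 * exp (tilt_mean \<beta> ?n * gain \<beta> ?n w)
      \<le> odds ?n w 0 * ((LBINT u. odds ?n w u * wt \<beta> ?n u) / odds ?n w 0 / mom \<beta> ?n 0)"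
    using o0 by (intro mult_left_mono) auto
  also have "\<dots> = (LBINT u. odds ?n w u * wt \<beta> ?n u) / mom \<beta> ?n 0" using o0 by simp
  finally have "odds ?n w 0 * exp (tilt_mean \<beta> ?n * gain \<beta> ?n w) \<le> (LBINT u. odds ?n w u * wt \<beta> ?n u) / mom \<beta> ?n 0" .
  then have "(table_coeff w * cell_factor x w) * (odds ?n w 0 * exp (tilt_mean \<beta> ?n * gain \<beta> ?n w))
      \<le> (table_coeff w * cell_factor x w) * ((LBINT u. odds ?n w u * wt \<beta> ?n u) / mom \<beta> ?n 0)"
    by (intro mult_left_mono) (auto intro: less_imp_le mult_pos_pos tables_coeff_pos cell_factor_pos)
  then show ?thesis
    unfolding mixture_predictor_def bayes_prior_mix_eq[OF w \<beta>] base_eq[OF w] by (simp add: mult_ac)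
qed

lemma mixture_pos:
  assumes "w \<in> tables" "0 < \<beta>"
  shows "0 < mixture_predictor \<beta> w x"
  by (rule less_le_trans[OF _ mixture_ge[OF assms]]) (simp add: base_pos assms)

lemma base_predictive: "predictive_mass N m L d l nu base_predictor"
  unfolding base_predictor_def
proof (rule predictive_mass_bayes)
  show "0 \<le> bayes base_prior w x" if "w \<in> tables" for w x
    using base_pos[OF that] by (simp add: base_predictor_def less_imp_le)
  show "(LINT p:paramD N m|lebP N m. obs_lik p x * base_prior p) \<noteq> 0" for x
    unfolding base_integrals using obs_coeff_pos[of x] dir_const_post[of x 0] obs_gamma_pos[of x] T_pos[of 0 "totals x"]
    by (simp add: tilt_0)
qed (rule base_integrals)

lemma mixture_predictive:
  assumes \<beta>: "0 < \<beta>"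
  shows "predictive_mass N m L d l nu (mixture_predictor \<beta>)"
  unfolding mixture_predictor_def
proof (rule predictive_mass_bayes)
  show "0 \<le> bayes (mix_prior \<beta>) w x" if "w \<in> tables" for w x
    using mixture_pos[OF that \<beta>] by (simp add: mixture_predictor_def less_imp_le)
  show "integrable_D
      (\<lambda>p. table_lik p w * obs_lik p x * mix_prior \<beta> p)"
    if "w \<in> tables" for x w
    by (rule mixture_integrals[OF that \<beta>])
  show "(LINT p:paramD N m|lebP N m. obs_lik p x * mix_prior \<beta> p) \<noteq> 0" for x
  proof -
    interpret P: tilted_exponential \<beta> "T (totals x)" by (rule tilted_exponential_T[OF \<beta>])
    \<comment> \<open>The closed form of the integral is stated together with a table, so one has to exist.\<close>
    obtain w where w: "w \<in> tables"
      using sum_tables_mass[of m L d l nu undefined] by fastforce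
    then show ?thesis
      unfolding mixture_integrals(3)[OF w \<beta>] using obs_coeff_pos[of x] obs_gamma_pos[of x] P.mom_pos[of 0] by simp
  qed
qed

lemma predictive_le_1:
  assumes "predictive_mass N m L d l nu fh" "x \<in> obsX N m" "w \<in> tables"
  shows "fh w x \<le> 1"
proof -
  have "fh w x \<le> (\<Sum>w\<in>tables. fh w x)"
    using assms by (intro member_le_sum) (auto simp: finite_tablesW predictive_mass_def)
  then show ?thesis using assms by (simp add: predictive_mass_def)
qed

lemma tables_mass_pos:
  assumes "p \<in> paramD N m"
  shows "0 < table_lik p w"
  unfolding tables_mass_eq[OF nu_range] using cellprob_pos[OF assms] tables_coeff_pos[of m L d l nu w]
  by (intro mult_pos_pos prod_pos ballI zero_less_power) auto

definition log_growth :: "(nat \<Rightarrow> nat \<Rightarrow> nat) \<Rightarrow> real" where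
  "log_growth x = (\<Sum>\<nu>=1..N. real (S \<nu>) / b \<nu> * real (totals x \<nu>))"

text \<open>
  Compared with no observations at all, the denominators grow at most exponentially in the totals. So the
  loss grows at most linearly, which makes it integrable.
\<close>

lemma base_lower:
  assumes w: "w \<in> tables"
  shows "base_predictor w (\<lambda>_ _. 0) * exp (- log_growth x) \<le> base_predictor w x"
proof -
  have cf: "cell_factor (\<lambda>_ _. 0) w \<le> cell_factor x w"
    unfolding cell_factor_def pochhammer_prod
    by (intro prod_mono conjI prod_nonneg ballI) (auto intro!: add_nonneg_nonneg less_imp_le[OF a_pos])
  have od: "odds (totals (\<lambda>_ _. 0)) w 0 * exp (- log_growth x) \<le> odds (totals x) w 0"
  proof -
    have "odds (totals (\<lambda>_ _. 0)) w 0 * exp (- log_growth x)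
      = (\<Prod>\<nu>=1..N. pochhammer (R \<nu>) (counts w \<nu> 0) / pochhammer (b \<nu>) (S \<nu>) * exp (- (real (S \<nu>) / b \<nu> * real (totals x \<nu>))))"
    proof -
      have "exp (- log_growth x)
          = (\<Prod>\<nu>=1..N. exp (- (real (S \<nu>) / b \<nu> * real (totals x \<nu>))))"
        unfolding log_growth_def by (subst sum_negf[symmetric]) (rule exp_sum, simp)
      moreover have "totals (\<lambda>_ _. 0) \<nu> = 0" for \<nu> by (simp add: obs_total_def)
      ultimately show ?thesis by (simp only: odds_def prod.distrib of_nat_0 add_0_right)
    qed
    also have "\<dots> \<le> odds (totals x) w 0" unfolding odds_def
    proof (rule prod_mono)
      fix \<nu> assume \<nu>: "\<nu> \<in> {1..N}"
      let ?n = "real (totals x \<nu>)" and ?R = "pochhammer (R \<nu>) (counts w \<nu> 0)"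
      have b0: "0 < b \<nu>" using b_ge[OF \<nu>] by simp
      have R0: "0 < ?R" by (rule pochhammer_pos[OF R_gt_0[OF \<nu>]])
      have pb: "0 < pochhammer (b \<nu>) (S \<nu>)" by (rule pochhammer_pos[OF b0])
      have pn: "0 < pochhammer (b \<nu> + ?n) (S \<nu>)" using b0 by (intro pochhammer_pos) auto
      have "pochhammer (b \<nu> + ?n) (S \<nu>) \<le> pochhammer (b \<nu>) (S \<nu>) * exp (real (S \<nu>) * (?n / b \<nu>))"
        by (rule pochhammer_shift_upper[OF b0]) simp
      then have "?R / (pochhammer (b \<nu>) (S \<nu>) * exp (real (S \<nu>) * (?n / b \<nu>)))
          \<le> ?R / pochhammer (b \<nu> + ?n) (S \<nu>)"
        using R0 pn by (intro frac_le) auto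
      then show "0 \<le> ?R / pochhammer (b \<nu>) (S \<nu>) * exp (- (real (S \<nu>) / b \<nu> * ?n)) \<and>
          ?R / pochhammer (b \<nu>) (S \<nu>) * exp (- (real (S \<nu>) / b \<nu> * ?n))
          \<le> pochhammer (R \<nu> + 0) (counts w \<nu> 0) / pochhammer (b \<nu> + ?n + 0) (S \<nu>)"
        using R0 pb by (simp add: exp_minus divide_inverse mult_ac)
    qed
    finally show ?thesis .
  qed
  have "table_coeff w * (cell_factor (\<lambda>_ _. 0) w * (odds (totals (\<lambda>_ _. 0)) w 0 * exp (- log_growth x)))
      \<le> table_coeff w * (cell_factor x w * odds (totals x) w 0)"
    using cf od tables_coeff_pos[of m L d l nu w] cell_factor_pos odds_pos[of 0]
    by (intro mult_left_mono mult_mono) (auto intro: less_imp_le)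
  then show ?thesis unfolding base_eq[OF w] by (simp add: mult_ac)
qed

lemma r_all: "\<forall>\<nu>\<in>{1..N}. 0 < r \<nu>"
  using r_pos by auto

text \<open>
  The predictive mass is at most \<open>1\<close>, so the loss is at least \<open>ln f\<close>; from above it is bounded by a linear
  function of the totals.
\<close>

lemma base_loss_integrable:
  assumes p: "p \<in> paramD N m" and w: "w \<in> tables"
  shows "integrable obs_space (\<lambda>x. obs_lik p x * ln (table_lik p w / base_predictor w x))"
proof (rule Bochner_Integration.integrable_bound)
  let ?f = "table_lik p w"
  define K where "K = \<bar>ln ?f\<bar> + \<bar>ln (?f / base_predictor w (\<lambda>_ _. 0))\<bar>"
  let ?D = "\<lambda>x. K * obs_lik p x + (\<Sum>\<nu>=1..N. real (S \<nu>) / b \<nu> * (obs_lik p x * real (totals x \<nu>)))"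
  have f: "0 < ?f" by (rule tables_mass_pos[OF p])
  have growth0: "0 \<le> log_growth x" for x
    unfolding log_growth_def using b_ge by (intro sum_nonneg mult_nonneg_nonneg divide_nonneg_nonneg) (auto intro: order_trans[OF zero_le_one])
  show "integrable obs_space ?D"
    by (intro Bochner_Integration.integrable_add Bochner_Integration.integrable_sum integrable_mult_right
        obs_mass_integrable obs_mass_times_total_integrable p r_all)
  have "norm (obs_lik p x * ln (?f / base_predictor w x)) \<le> norm (?D x)"
    if x: "x \<in> obsX N m" for x
  proof -
    have J: "0 < base_predictor w x" "base_predictor w x \<le> 1" "0 < base_predictor w (\<lambda>_ _. 0)"
      using base_pos[OF w] predictive_le_1[OF base_predictive x w] by auto
    have lower: "ln ?f \<le> ln (?f / base_predictor w x)" using f J by (simp add: ln_div)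
    have "ln (base_predictor w (\<lambda>_ _. 0) * exp (- log_growth x)) \<le> ln (base_predictor w x)"
      using base_lower[OF w, of x] J by (intro ln_mono) auto
    then have "ln (?f / base_predictor w x) \<le> ln (?f / base_predictor w (\<lambda>_ _. 0)) + log_growth x"
      using f J by (simp add: ln_div ln_mult)
    with lower have "\<bar>ln (?f / base_predictor w x)\<bar> \<le> K + log_growth x"
      unfolding K_def using growth0[of x] by linarith
    then have "\<bar>obs_lik p x * ln (?f / base_predictor w x)\<bar> \<le> obs_lik p x * (K + log_growth x)"
      using obs_mass_pos[OF p r_all, of x] by (simp add: abs_mult)
    also have "\<dots> = ?D x"
      unfolding log_growth_def distrib_left sum_distrib_left by (simp add: mult_ac)
    finally show ?thesis by simp
  qed
  then show "AE x in obs_space. norm (obs_lik p x * ln (?f / base_predictor w x)) \<le> norm (?D x)"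
    by (auto simp: AE_count_space)
qed simp

lemma tilt_mean_pos: "0 < \<beta> \<Longrightarrow> 0 < tilt_mean \<beta> n"
  unfolding tilt_mean_def using tilted_exponential.mom_pos[OF tilted_exponential_T] by simp

lemma tilt_mean_le:
  assumes "0 < \<beta>"
  shows "tilt_mean \<beta> n \<le> 1 / \<beta>"
proof -
  interpret P: tilted_exponential \<beta> "T n" by (rule tilted_exponential_T[OF assms])
  show ?thesis unfolding tilt_mean_def using P.mom_Suc_le[of 0] P.mom_pos[of 0] by (simp add: field_simps)
qed

lemma gain_bounded: "\<bar>gain \<beta> n w\<bar> \<le> (\<Sum>\<nu>=1..N. real (counts w \<nu> 0) * \<bar>\<kappa> \<beta> \<nu>\<bar> + real (S \<nu>))"
  unfolding gain_def
proof (rule order_trans[OF sum_abs], rule sum_mono)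
  fix \<nu> assume \<nu>: "\<nu> \<in> {1..N}"
  have "1 \<le> b \<nu> + real (n \<nu>)" using b_ge[OF \<nu>] by simp
  then have "real (S \<nu>) / (b \<nu> + real (n \<nu>)) \<le> real (S \<nu>)" "0 \<le> real (S \<nu>) / (b \<nu> + real (n \<nu>))"
    using divide_left_mono[of 1 "b \<nu> + real (n \<nu>)" "real (S \<nu>)"] by auto
  moreover have "\<bar>real (counts w \<nu> 0) * \<kappa> \<beta> \<nu>\<bar> = real (counts w \<nu> 0) * \<bar>\<kappa> \<beta> \<nu>\<bar>" by (simp add: abs_mult)
  ultimately show "\<bar>real (counts w \<nu> 0) * \<kappa> \<beta> \<nu> - real (S \<nu>) / (b \<nu> + real (n \<nu>))\<bar> \<le> real (counts w \<nu> 0) * \<bar>\<kappa> \<beta> \<nu>\<bar> + real (S \<nu>)"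
    by linarith
qed

lemma gain_term_bounded:
  assumes "0 < \<beta>"
  shows "\<bar>tilt_mean \<beta> n * gain \<beta> n w\<bar> \<le> 1 / \<beta> * (\<Sum>\<nu>=1..N. real (counts w \<nu> 0) * \<bar>\<kappa> \<beta> \<nu>\<bar> + real (S \<nu>))"
  unfolding abs_mult using tilt_mean_le[OF assms, of n] tilt_mean_pos[OF assms, of n] gain_bounded[of \<beta> n w] assms
  by (intro mult_mono) auto

lemma mixture_log_gain:
  assumes "w \<in> tables" "0 < \<beta>" "0 < f"
  shows "tilt_mean \<beta> (totals x) * gain \<beta> (totals x) w \<le> ln (f / base_predictor w x) - ln (f / mixture_predictor \<beta> w x)"
proof -
  have "ln (base_predictor w x * exp (tilt_mean \<beta> (totals x) * gain \<beta> (totals x) w)) \<le> ln (mixture_predictor \<beta> w x)"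
    using mixture_ge[OF assms(1,2), of x] base_pos[OF assms(1), of x] by (intro ln_mono) auto
  then show ?thesis using assms base_pos[OF assms(1), of x] mixture_pos[OF assms(1,2), of x]
    by (simp add: ln_div ln_mult)
qed

text \<open>
  The loss exceeds that of the other predictive mass by a bounded amount at most, since \<open>tilt_mean\<close> and
  \<open>gain\<close> are bounded.
\<close>

lemma mixture_loss_integrable:
  assumes p: "p \<in> paramD N m" and w: "w \<in> tables" and \<beta>: "0 < \<beta>"
  shows "integrable obs_space (\<lambda>x. obs_lik p x * ln (table_lik p w / mixture_predictor \<beta> w x))"
proof (rule Bochner_Integration.integrable_bound)
  let ?f = "table_lik p w"
  define K where "K = \<bar>ln ?f\<bar> + 1 / \<beta> * (\<Sum>\<nu>=1..N. real (counts w \<nu> 0) * \<bar>\<kappa> \<beta> \<nu>\<bar> + real (S \<nu>))"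
  have f: "0 < ?f" by (rule tables_mass_pos[OF p])
  show "integrable obs_space (\<lambda>x. K * obs_lik p x + \<bar>obs_lik p x * ln (?f / base_predictor w x)\<bar>)"
    by (intro Bochner_Integration.integrable_add integrable_mult_right integrable_abs obs_mass_integrable base_loss_integrable p r_all w)
  have "norm (obs_lik p x * ln (?f / mixture_predictor \<beta> w x)) \<le> norm (K * obs_lik p x + \<bar>obs_lik p x * ln (?f / base_predictor w x)\<bar>)"
    if x: "x \<in> obsX N m" for x
  proof -
    have "ln ?f \<le> ln (?f / mixture_predictor \<beta> w x)"
      using f mixture_pos[OF w \<beta>, of x] predictive_le_1[OF mixture_predictive[OF \<beta>] x w] by (simp add: ln_div)
    moreover have "ln (?f / mixture_predictor \<beta> w x) \<le> ln (?f / base_predictor w x) - tilt_mean \<beta> (totals x) * gain \<beta> (totals x) w"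
      using mixture_log_gain[OF w \<beta> f, of x] by linarith
    ultimately have "\<bar>ln (?f / mixture_predictor \<beta> w x)\<bar> \<le> K + \<bar>ln (?f / base_predictor w x)\<bar>"
      unfolding K_def using gain_term_bounded[OF \<beta>, of "totals x" w] by linarith
    then have "\<bar>obs_lik p x * ln (?f / mixture_predictor \<beta> w x)\<bar> \<le> obs_lik p x * (K + \<bar>ln (?f / base_predictor w x)\<bar>)"
      using obs_mass_pos[OF p r_all, of x] by (simp add: abs_mult)
    also have "\<dots> = K * obs_lik p x + \<bar>obs_lik p x * ln (?f / base_predictor w x)\<bar>"
      using obs_mass_pos[OF p r_all, of x] by (simp add: abs_mult algebra_simps)
    finally show ?thesis by simp
  qed
  then show "AE x in obs_space. norm (obs_lik p x * ln (?f / mixture_predictor \<beta> w x))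
      \<le> norm (K * obs_lik p x + \<bar>obs_lik p x * ln (?f / base_predictor w x)\<bar>)"
    by (auto simp: AE_count_space)
qed simp

text \<open>
  One more observation changes a single Gamma function, by its functional equation.
\<close>

lemma T_bump:
  assumes \<nu>: "\<nu> \<in> {1..N}" and i: "i \<in> {1..m \<nu>}" and u: "0 < u"
  shows "T (totals (bump \<nu> i x)) u = 1 * T (totals x) u / (b \<nu> + real (totals x \<nu>) + u)"
proof -
  let ?z = "b \<nu> + real (totals x \<nu>) + u"
  have z: "0 < ?z" using b_ge[OF \<nu>] u by simp
  have "Gamma (b \<nu> + real (totals (bump \<nu> i x) \<nu>) + u) = ?z * Gamma ?z"
    unfolding obs_total_bump[where m = m, OF i] using Gamma_real_Suc[OF z] by (simp add: add_ac)
  moreover have "(\<Prod>\<mu>\<in>{1..N} - {\<nu>}. Gamma (R \<mu> + u) / Gamma (b \<mu> + real (totals (bump \<nu> i x) \<mu>) + u))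
      = (\<Prod>\<mu>\<in>{1..N} - {\<nu>}. Gamma (R \<mu> + u) / Gamma (b \<mu> + real (totals x \<mu>) + u))"
    by (intro prod.cong) (auto simp: obs_total_bump_other)
  ultimately show ?thesis unfolding T_def using \<nu> by (simp add: prod.remove[of _ \<nu>])
qed

text \<open>
  The general shift bound has the factor \<open>1 - \<epsilon> / q\<close> with \<open>q = b\<^sub>\<nu> + n\<^sub>\<nu>\<close> on the other side. Since
  \<open>\<epsilon> \<le> 1/2 \<le> b\<^sub>\<nu> - r\<^sub>\<nu>\<close>, inverting it costs no more than \<open>1 + \<epsilon> / (r\<^sub>\<nu> + n\<^sub>\<nu>)\<close>.
\<close>

lemma tilt_mean_bump:
  assumes \<nu>: "\<nu> \<in> {1..N}" and i: "i \<in> {1..m \<nu>}" and \<beta>: "0 < \<beta>" "2 / \<beta> \<le> 1 / 2" and b: "r \<nu> + 1 / 2 \<le> b \<nu>"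
  shows "tilt_mean \<beta> (totals x) \<le> tilt_mean \<beta> (totals (bump \<nu> i x)) * (1 + 2 / \<beta> / (r \<nu> + real (totals x \<nu>)))"
proof -
  define q where "q = b \<nu> + real (totals x \<nu>)"
  define s where "s = r \<nu> + real (totals x \<nu>)"
  have q: "0 < q" using b_ge[OF \<nu>] by (simp add: q_def)
  have s: "0 < s" using r_pos[OF \<nu>] by (simp add: s_def)
  have sp: "0 < s + 2 / \<beta>" using s \<beta>(1) by (intro add_pos_pos) auto
  have sq: "s + 2 / \<beta> \<le> q" unfolding s_def q_def using b \<beta>(2) by linarith
  have "tilt_mean \<beta> (totals x) * (1 - 2 / \<beta> / q) \<le> tilt_mean \<beta> (totals (bump \<nu> i x))"
    unfolding tilt_mean_def
    by (rule tilted_mean_shift[where K = 1 and q = q, OF tilted_exponential_T[OF \<beta>(1)] tilted_exponential_T[OF \<beta>(1)] q zero_less_one])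
      (simp only: T_bump[OF \<nu> i] q_def)
  moreover have "s / (s + 2 / \<beta>) \<le> 1 - 2 / \<beta> / q"
  proof -
    have "2 / \<beta> / q \<le> 2 / \<beta> / (s + 2 / \<beta>)"
      using sq sp \<beta> by (intro frac_le) auto
    moreover have "1 - 2 / \<beta> / (s + 2 / \<beta>) = s / (s + 2 / \<beta>)"
    proof -
      have "(s + 2 / \<beta>) / (s + 2 / \<beta>) = 1" using sp by simp
      then have "s / (s + 2 / \<beta>) + 2 / \<beta> / (s + 2 / \<beta>) = 1" by (simp only: add_divide_distrib)
      then show ?thesis by linarith
    qed
    ultimately show ?thesis by linarith
  qed
  then have "tilt_mean \<beta> (totals x) * (s / (s + 2 / \<beta>)) \<le> tilt_mean \<beta> (totals x) * (1 - 2 / \<beta> / q)"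
    using tilt_mean_pos[OF \<beta>(1), of "totals x"] by (intro mult_left_mono) auto
  ultimately have "tilt_mean \<beta> (totals x) * (s / (s + 2 / \<beta>)) \<le> tilt_mean \<beta> (totals (bump \<nu> i x))" by linarith
  then have "tilt_mean \<beta> (totals x) * (s / (s + 2 / \<beta>)) * ((s + 2 / \<beta>) / s) \<le> tilt_mean \<beta> (totals (bump \<nu> i x)) * ((s + 2 / \<beta>) / s)"
    using s \<beta> by (intro mult_right_mono) auto
  moreover have "tilt_mean \<beta> (totals x) * (s / (s + 2 / \<beta>)) * ((s + 2 / \<beta>) / s) = tilt_mean \<beta> (totals x)"
  proof -
    have "x / y * (y / x) = 1" if "0 < x" "0 < y" for x y :: real using that by simp
    from this[OF s sp] show ?thesis by (simp only: mult.assoc mult_1_right)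
  qed
  moreover have "(s + 2 / \<beta>) / s = 1 + 2 / \<beta> / s" using s by (simp add: add_divide_distrib)
  ultimately show ?thesis using s by (simp add: s_def[symmetric])
qed

lemma l_le_S:
  assumes "k \<in> tables_of L d nu \<nu>"
  shows "l k \<le> S \<nu>"
  unfolding S_def by (rule member_le_sum[OF assms]) (auto simp: tables_of_def)

text \<open>
  The difference of the risks is at least the mean of \<open>tilt_mean * gain\<close>. Averaging over the tables replaces
  the counts of the cells \<open>0\<close> by \<open>S \<nu> p\<^sub>0\<^sub>,\<^sub>\<nu>\<close> and leaves, for each population, a sum that
  \<open>mean_gain_positive\<close> shows to be positive.
\<close>

lemma mixture_dominates:
  assumes \<beta>: "0 < \<beta>" "2 / \<beta> \<le> 1 / 2"
    and b: "\<And>\<nu>. \<nu> \<in> {1..N} \<Longrightarrow> r \<nu> + 1 / 2 \<le> b \<nu>"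
    and used: "\<And>\<nu>. \<nu> \<in> {1..N} \<Longrightarrow> 1 \<le> S \<nu> \<Longrightarrow>
        1 < r \<nu> \<and> 0 \<le> \<kappa> \<beta> \<nu> \<and> 1 \<le> \<kappa> \<beta> \<nu> * (r \<nu> - 1 - 2 / \<beta>)"
    and ex: "\<exists>\<nu>\<in>{1..N}. 1 \<le> S \<nu>"
  shows "dominates N m r L d l nu (mixture_predictor \<beta>) base_predictor"
proof -
  let ?M = "obs_space"
  let ?W = "tables"
  have less: "risk (mixture_predictor \<beta>) p < risk base_predictor p" if p: "p \<in> paramD N m" for p
  proof -
    let ?o = "obs_lik p"
    let ?f = "table_lik p"
    let ?la = "\<lambda>x w. ?f w * (?o x * ln (?f w / base_predictor w x))"
    let ?lm = "\<lambda>x w. ?f w * (?o x * ln (?f w / mixture_predictor \<beta> w x))"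
    let ?n = "\<lambda>x. totals x"
    let ?G = "\<lambda>x \<nu>. ?o x * (tilt_mean \<beta> (?n x) * (\<kappa> \<beta> \<nu> * cellprob m p \<nu> 0 - 1 / (b \<nu> + real (?n x \<nu>))))"
    have f: "0 < ?f w" for w by (rule tables_mass_pos[OF p])
    have risk_a: "risk base_predictor p = ereal (LINT x|?M. (\<Sum>w\<in>?W. ?la x w))"
      by (rule KL_risk_eq_integral[OF p r_all f base_pos base_loss_integrable[OF p]])
    have risk_m: "risk (mixture_predictor \<beta>) p = ereal (LINT x|?M. (\<Sum>w\<in>?W. ?lm x w))"
      by (rule KL_risk_eq_integral[OF p r_all f mixture_pos mixture_loss_integrable[OF p]]) (assumption | rule \<beta>)+
    have ia: "integrable ?M (\<lambda>x. \<Sum>w\<in>?W. ?la x w)"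
      by (intro Bochner_Integration.integrable_sum integrable_mult_right base_loss_integrable p)
    have im: "integrable ?M (\<lambda>x. \<Sum>w\<in>?W. ?lm x w)"
      by (intro Bochner_Integration.integrable_sum integrable_mult_right mixture_loss_integrable p \<beta>)
    have Gint: "integrable ?M (\<lambda>x. ?G x \<nu>)" if \<nu>: "\<nu> \<in> {1..N}" for \<nu>
    proof (rule obs_mass_bounded_integrable[OF p r_all])
      fix x
      have "1 \<le> b \<nu> + real (?n x \<nu>)" using b_ge[OF \<nu>] by simp
      then have "\<bar>1 / (b \<nu> + real (?n x \<nu>))\<bar> \<le> 1" by simp
      then have "\<bar>\<kappa> \<beta> \<nu> * cellprob m p \<nu> 0 - 1 / (b \<nu> + real (?n x \<nu>))\<bar> \<le> \<bar>\<kappa> \<beta> \<nu> * cellprob m p \<nu> 0\<bar> + 1" by linarith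
      then show "\<bar>tilt_mean \<beta> (?n x) * (\<kappa> \<beta> \<nu> * cellprob m p \<nu> 0 - 1 / (b \<nu> + real (?n x \<nu>)))\<bar> \<le> 1 / \<beta> * (\<bar>\<kappa> \<beta> \<nu> * cellprob m p \<nu> 0\<bar> + 1)"
        unfolding abs_mult[of "tilt_mean \<beta> (?n x)"] using tilt_mean_le[OF \<beta>(1), of "?n x"] tilt_mean_pos[OF \<beta>(1), of "?n x"] \<beta>
        by (intro mult_mono) auto
    qed
    have Gpos: "0 < (LINT x|?M. ?G x \<nu>)" if \<nu>: "\<nu> \<in> {1..N}" and S1: "1 \<le> S \<nu>" for \<nu>
      by (rule mean_gain_positive[where C = "1 / \<beta>" and \<epsilon> = "2 / \<beta>", OF p r_all \<nu>])
        (use used[OF \<nu> S1] b[OF \<nu>] \<beta> tilt_mean_pos tilt_mean_le tilt_mean_bump[OF \<nu> _ \<beta> b[OF \<nu>]] in auto)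
    have "0 < (\<Sum>\<nu>=1..N. real (S \<nu>) * (LINT x|?M. ?G x \<nu>))"
    proof -
      obtain \<nu> where \<nu>: "\<nu> \<in> {1..N}" "1 \<le> S \<nu>" using ex by blast
      show ?thesis
      proof (rule sum_pos2[OF _ \<nu>(1)])
        show "0 < real (S \<nu>) * (LINT x|?M. ?G x \<nu>)" using Gpos[OF \<nu>] \<nu> by simp
        show "0 \<le> real (S \<mu>) * (LINT x|?M. ?G x \<mu>)" if "\<mu> \<in> {1..N}" for \<mu>
          using Gpos[OF that] by (cases "S \<mu> = 0") (auto simp: less_imp_le)
      qed simp
    qed
    also have "\<dots> = (LINT x|?M. (\<Sum>\<nu>=1..N. real (S \<nu>) * ?G x \<nu>))"
    proof -
      have "(LINT x|?M. (\<Sum>\<nu>=1..N. real (S \<nu>) * ?G x \<nu>)) = (\<Sum>\<nu>=1..N. (LINT x|?M. real (S \<nu>) * ?G x \<nu>))"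
        by (rule Bochner_Integration.integral_sum) (intro integrable_mult_right Gint)
      then show ?thesis by (simp only: integral_mult_right_zero)
    qed
    also have "\<dots> \<le> (LINT x|?M. (\<Sum>w\<in>?W. ?la x w) - (\<Sum>w\<in>?W. ?lm x w))"
    proof (rule integral_mono)
      show "integrable ?M (\<lambda>x. \<Sum>\<nu>=1..N. real (S \<nu>) * ?G x \<nu>)"
        by (intro Bochner_Integration.integrable_sum integrable_mult_right Gint)
      show "integrable ?M (\<lambda>x. (\<Sum>w\<in>?W. ?la x w) - (\<Sum>w\<in>?W. ?lm x w))"
        by (rule Bochner_Integration.integrable_diff[OF ia im])
      fix x
      have mean: "(\<Sum>w\<in>?W. ?f w * gain \<beta> (?n x) w) = (\<Sum>\<nu>=1..N. real (S \<nu>) * (\<kappa> \<beta> \<nu> * cellprob m p \<nu> 0 - 1 / (b \<nu> + real (?n x \<nu>))))"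
      proof -
        have "(\<Sum>w\<in>?W. ?f w * gain \<beta> (?n x) w)
            = (\<Sum>\<nu>=1..N. \<Sum>w\<in>?W. ?f w * (real (counts w \<nu> 0) * \<kappa> \<beta> \<nu> - real (S \<nu>) / (b \<nu> + real (?n x \<nu>))))"
          unfolding gain_def sum_distrib_left by (rule sum.swap)
        also have "\<dots> = (\<Sum>\<nu>=1..N. (\<Sum>w\<in>?W. ?f w * real (counts w \<nu> 0)) * \<kappa> \<beta> \<nu> - (\<Sum>w\<in>?W. ?f w) * (real (S \<nu>) / (b \<nu> + real (?n x \<nu>))))"
          unfolding sum_distrib_right sum_subtractf[symmetric] by (simp add: algebra_simps)
        also have "\<dots> = (\<Sum>\<nu>=1..N. real (S \<nu>) * (\<kappa> \<beta> \<nu> * cellprob m p \<nu> 0 - 1 / (b \<nu> + real (?n x \<nu>))))"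
          unfolding mean_cell_count_0[OF nu_inj] sum_tables_mass S_def[symmetric] by (simp add: algebra_simps)
        finally show ?thesis .
      qed
      have "(\<Sum>\<nu>=1..N. real (S \<nu>) * ?G x \<nu>) = (\<Sum>w\<in>?W. ?f w * (?o x * (tilt_mean \<beta> (?n x) * gain \<beta> (?n x) w)))"
      proof -
        have "(\<Sum>\<nu>=1..N. real (S \<nu>) * ?G x \<nu>) = ?o x * tilt_mean \<beta> (?n x) * (\<Sum>w\<in>?W. ?f w * gain \<beta> (?n x) w)"
          unfolding mean sum_distrib_left by (simp add: mult_ac)
        then show ?thesis unfolding sum_distrib_left by (simp add: mult_ac)
      qed
      also have "\<dots> \<le> (\<Sum>w\<in>?W. ?f w * (?o x * (ln (?f w / base_predictor w x) - ln (?f w / mixture_predictor \<beta> w x))))"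
        using f obs_mass_pos[OF p r_all, of x]
        by (intro sum_mono mult_left_mono mixture_log_gain \<beta>) (auto intro: less_imp_le)
      also have "\<dots> = (\<Sum>w\<in>?W. ?la x w) - (\<Sum>w\<in>?W. ?lm x w)"
        unfolding sum_subtractf[symmetric] by (simp add: right_diff_distrib)
      finally show "(\<Sum>\<nu>=1..N. real (S \<nu>) * ?G x \<nu>) \<le> (\<Sum>w\<in>?W. ?la x w) - (\<Sum>w\<in>?W. ?lm x w)" .
    qed
    also have "\<dots> = (LINT x|?M. (\<Sum>w\<in>?W. ?la x w)) - (LINT x|?M. (\<Sum>w\<in>?W. ?lm x w))"
      by (rule Bochner_Integration.integral_diff[OF ia im])
    finally show ?thesis unfolding risk_a risk_m by simp
  qed
  then show ?thesis
    unfolding dominates_def using base_predictive mixture_predictive[OF \<beta>(1)] paramD_nonempty[of N m]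
    by (auto intro: less_imp_le)
qed

end

section \<open>Choice of the prior\<close>

text \<open>
  As \<open>\<epsilon>\<close> tends to \<open>0\<close> the product tends to \<open>q / c > 1\<close>.
\<close>

lemma eventually_rate_condition:
  fixes c q :: real
  assumes "0 < c" "c < q"
  shows "\<forall>\<^sub>F \<epsilon> in at_right 0. 0 \<le> 1 / c - \<epsilon> / c\<^sup>2 \<and> 1 \<le> (1 / c - \<epsilon> / c\<^sup>2) * (q - \<epsilon>)"
proof -
  have lim: "((\<lambda>\<epsilon>. 1 / c - \<epsilon> / c\<^sup>2) \<longlongrightarrow> 1 / c - 0 / c\<^sup>2) (at_right 0)"
    "((\<lambda>\<epsilon>. (1 / c - \<epsilon> / c\<^sup>2) * (q - \<epsilon>)) \<longlongrightarrow> (1 / c - 0 / c\<^sup>2) * (q - 0)) (at_right 0)"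
    using assms by (intro tendsto_intros; simp)+
  have "\<forall>\<^sub>F \<epsilon> in at_right 0. 0 < 1 / c - \<epsilon> / c\<^sup>2"
    by (rule order_tendstoD(1)[OF lim(1)]) (use assms in simp)
  moreover have "\<forall>\<^sub>F \<epsilon> in at_right 0. 1 < (1 / c - \<epsilon> / c\<^sup>2) * (q - \<epsilon>)"
    by (rule order_tendstoD(1)[OF lim(2)]) (use assms in simp)
  ultimately show ?thesis by eventually_elim auto
qed

lemma first_table_used: 
  fixes d :: "nat \<Rightarrow> nat"
  assumes L: "1 \<le> L" and d: "\<forall>k\<in>{1..L}. d k \<in> {1..N}" and nu: "\<forall>k\<in>{1..L}. nu k \<in> {1..d k} \<rightarrow> {1..N}"
  shows "nu 1 1 \<in> {1..N}" "1 \<in> tables_of L d nu (nu 1 1)"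
proof -
  have 1: "1 \<in> {1..L}" using L by simp
  have "1 \<le> d 1" using bspec[OF d 1] by simp
  then have d1: "1 \<in> {1..d 1}" by simp
  show "nu 1 1 \<in> {1..N}" by (rule funcset_mem[OF bspec[OF nu 1] d1])
  show "1 \<in> tables_of L d nu (nu 1 1)" unfolding tables_of_def using 1 d1 by blast
qed

theorem corollary3p1:
  fixes N L :: nat and m d l :: "nat \<Rightarrow> nat" and nu :: "nat \<Rightarrow> nat \<Rightarrow> nat"
    and r a0 :: "nat \<Rightarrow> real" and a :: "nat \<Rightarrow> nat \<Rightarrow> real"
  assumes "1 \<le> N"
    and "\<forall>\<nu>\<in>{1..N}. 1 \<le> m \<nu>"
    and "\<forall>\<nu>\<in>{1..N}. 0 < r \<nu>"
    and "1 \<le> L"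
    and "\<forall>k\<in>{1..L}. d k \<in> {1..N}"
    and "\<forall>k\<in>{1..L}. 1 \<le> l k"
    and "\<forall>k\<in>{1..L}. nu k \<in> {1..d k} \<rightarrow> {1..N} \<and> strict_mono_on {1..d k} (nu k)"
    and "\<forall>\<nu>\<in>{1..N}. r \<nu> \<ge> 1 \<and> r \<nu> > (real (m \<nu>) - 1) / 2
           \<and> (real (m \<nu>) - 1) / 2 > real (\<Sum>k\<in>tables_of L d nu \<nu>. l k)"
    and "\<forall>\<nu>\<in>{1..N}. a0 \<nu> = (1 - real (m \<nu>)) / 2"
    and "\<forall>\<nu>\<in>{1..N}. \<forall>i\<in>{1..m \<nu>}. a \<nu> i = 1 / 2"
  shows "inadmissible N m r L d l nu (bayes_predictive N m r L d l nu (prior_a N m a0 a))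
    \<and> (\<exists>\<alpha> \<beta> \<gamma>. \<alpha> > 0 \<and> \<beta> > 0 \<and> (\<forall>\<nu>\<in>{1..N}. \<gamma> \<nu> > 0) \<and>
         dominates N m r L d l nu
           (bayes_predictive N m r L d l nu (prior_mix N m \<alpha> \<beta> \<gamma> a0 a))
           (bayes_predictive N m r L d l nu (prior_a N m a0 a)))"
proof -
  have sum_a: "(\<Sum>i=1..m \<nu>. a \<nu> i) = real (m \<nu>) / 2" if "\<nu> \<in> {1..N}" for \<nu>
  proof -
    have "(\<Sum>i=1..m \<nu>. a \<nu> i) = (\<Sum>i=1..m \<nu>. 1 / 2)" using assms(10) that by (intro sum.cong) auto
    then show ?thesis by simp
  qed
  have R: "r \<nu> + a0 \<nu> = r \<nu> - (real (m \<nu>) - 1) / 2" if "\<nu> \<in> {1..N}" for \<nu>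
    using assms(9) that by (simp add: field_simps)
  interpret posterior_setting N L m d l nu r a0 a
  proof
    fix \<nu> assume \<nu>: "\<nu> \<in> {1..N}"
    show "1 \<le> m \<nu>" "0 < r \<nu>" using assms(2,3) \<nu> by auto
    show "0 < r \<nu> + a0 \<nu>" unfolding R[OF \<nu>] using assms(8) \<nu> by auto
    show "1 \<le> r \<nu> + a0 \<nu> + (\<Sum>i=1..m \<nu>. a \<nu> i)"
    proof -
      have "1 \<le> r \<nu>" using assms(8) \<nu> by auto
      then show ?thesis unfolding R[OF \<nu>] sum_a[OF \<nu>] by (simp add: diff_divide_distrib)
    qed
    show "0 < a \<nu> i" if "i \<in> {1..m \<nu>}" for i
    proof -
      have "a \<nu> i = 1 / 2" using assms(10) \<nu> that by blast
      then show ?thesis by simp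
    qed
  next
    show "\<forall>k\<in>{1..L}. nu k \<in> {1..d k} \<rightarrow> {1..N}" using assms(7) by blast
    show "\<forall>k\<in>{1..L}. inj_on (nu k) {1..d k}" using assms(7) strict_mono_on_imp_inj_on by blast
  qed
  have b_eq: "b \<nu> = r \<nu> + 1 / 2" if "\<nu> \<in> {1..N}" for \<nu>
    unfolding b_def R_def R[OF that] sum_a[OF that] by (simp add: field_simps)
  \<comment> \<open>The hypothesis on \<open>m \<nu>\<close> enters here: it says that \<open>S \<nu> - (m \<nu> - 1) / 2 < 0\<close>.\<close>
  have c_bounds: "0 < c \<nu>" "c \<nu> < r \<nu> - 1" if \<nu>: "\<nu> \<in> {1..N}" and S1: "1 \<le> S \<nu>" for \<nu>
  proof -
    have "0 < R \<nu>" by (rule R_gt_0[OF \<nu>])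
    then show "0 < c \<nu>" using S1 by (simp add: c_def)
    have "real (S \<nu>) < (real (m \<nu>) - 1) / 2" using assms(8) \<nu> by (auto simp: S_def)
    then show "c \<nu> < r \<nu> - 1" by (simp add: c_def R_def R[OF \<nu>])
  qed
  let ?ok = "\<lambda>\<epsilon> \<nu>. 0 \<le> 1 / c \<nu> - \<epsilon> / (c \<nu>)\<^sup>2 \<and> 1 \<le> (1 / c \<nu> - \<epsilon> / (c \<nu>)\<^sup>2) * (r \<nu> - 1 - \<epsilon>)"
  have "\<forall>\<^sub>F \<epsilon> in at_right 0. \<forall>\<nu>\<in>{\<nu>\<in>{1..N}. 1 \<le> S \<nu>}.
      ?ok \<epsilon> \<nu>"
    using c_bounds by (intro eventually_ball_finite ballI eventually_rate_condition) auto
  moreover have "\<forall>\<^sub>F \<epsilon> in at_right 0. \<epsilon> \<in> {0<..<1 / 2 :: real}"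
    by (rule eventually_at_right_real) simp
  ultimately have "\<forall>\<^sub>F \<epsilon> in at_right 0. (\<forall>\<nu>\<in>{\<nu>\<in>{1..N}. 1 \<le> S \<nu>}.
      ?ok \<epsilon> \<nu>)
      \<and> \<epsilon> \<in> {0<..<1 / 2 :: real}"
    by (rule eventually_conj)
  then obtain \<epsilon> where all: "\<forall>\<nu>\<in>{\<nu>\<in>{1..N}. 1 \<le> S \<nu>}.
      ?ok \<epsilon> \<nu>"
    and range: "\<epsilon> \<in> {0<..<1 / 2 :: real}"
    by (blast dest: eventually_happens'[OF trivial_limit_at_right_real])
  have rate: "?ok \<epsilon> \<nu>"
    if "\<nu> \<in> {1..N}" "1 \<le> S \<nu>" for \<nu>
    by (rule bspec[OF all]) (use that in simp)
  have \<epsilon>: "0 < \<epsilon>" "\<epsilon> < 1 / 2" using range by auto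
  \<comment> \<open>All bounds on the mixing parameter are in terms of \<open>2 / \<beta>\<close>.\<close>
  define \<beta> where "\<beta> = 2 / \<epsilon>"
  have \<beta>: "0 < \<beta>" and \<epsilon>_eq: "2 / \<beta> = \<epsilon>" using \<epsilon> by (auto simp: \<beta>_def)
  have used: "\<exists>\<nu>\<in>{1..N}. 1 \<le> S \<nu>"
  proof (rule bexI[of _ "nu 1 1"])
    have tab: "1 \<in> tables_of L d nu (nu 1 1)"
      by (rule first_table_used[OF assms(4,5) nu_range])
    have "1 \<le> l 1" using assms(4) by (intro bspec[OF assms(6)]) simp
    also have "l 1 \<le> S (nu 1 1)" by (rule l_le_S[OF tab])
    finally show "1 \<le> S (nu 1 1)" .
    show "nu 1 1 \<in> {1..N}" by (rule first_table_used[OF assms(4,5) nu_range])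
  qed
  have "dominates N m r L d l nu (mixture_predictor \<beta>) base_predictor"
  proof (rule mixture_dominates[OF \<beta>])
    show "2 / \<beta> \<le> 1 / 2" using \<epsilon> by (simp add: \<epsilon>_eq)
    show "r \<nu> + 1 / 2 \<le> b \<nu>" if "\<nu> \<in> {1..N}" for \<nu> by (simp add: b_eq[OF that])
    show "1 < r \<nu> \<and> 0 \<le> \<kappa> \<beta> \<nu> \<and> 1 \<le> \<kappa> \<beta> \<nu> * (r \<nu> - 1 - 2 / \<beta>)" if "\<nu> \<in> {1..N}" "1 \<le> S \<nu>" for \<nu>
      using rate[OF that] c_bounds[OF that] unfolding \<kappa>_def \<epsilon>_eq by auto
    show "\<exists>\<nu>\<in>{1..N}. 1 \<le> S \<nu>" by (rule used)
  qed
  then have dom: "dominates N m r L d l nu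
      (bayes_predictive N m r L d l nu (prior_mix N m 1 \<beta> (\<lambda>_. 1) a0 a))
      (bayes_predictive N m r L d l nu (prior_a N m a0 a))"
    by (simp add: mixture_predictor_def base_predictor_def)
  have "\<exists>\<alpha> \<beta> \<gamma>. \<alpha> > 0 \<and> \<beta> > 0 \<and> (\<forall>\<nu>\<in>{1..N}. \<gamma> \<nu> > 0) \<and>
         dominates N m r L d l nu
           (bayes_predictive N m r L d l nu (prior_mix N m \<alpha> \<beta> \<gamma> a0 a))
           (bayes_predictive N m r L d l nu (prior_a N m a0 a))"
    by (intro exI[of _ 1] exI[of _ \<beta>] exI[of _ "\<lambda>_. 1"] conjI dom) (use \<beta> in auto)
  moreover have "inadmissible N m r L d l nu (bayes_predictive N m r L d l nu (prior_a N m a0 a))"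
    unfolding inadmissible_def using dom by blast
  ultimately show ?thesis by blast
qed

end
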